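(* Let $G$ and $H$ be connected ribbon graphs. (1) If $G$ and $H$ are both plane, then they are partial duals of each other if and only if they are related by dualling join-summands. (2) If $G$ and $H$ are both $\mathbb{R}\mathrm{P}^2$, then they are partial duals of each other if and only if they are related by dualling join-summands.
   Context: A ribbon graph is a surface with boundary made of vertex discs and edge discs meeting in disjoint segments, each segment on the boundary of exactly one vertex and one edge, each edge containing exactly two segments; considered up to homeomorphism. Euler genus $\gamma$: twice the genus if orientable, non-orientable genus otherwise. Plane (resp. $\mathbb{R}\mathrm{P}^2$) ribbon graph: connected with $\gamma=0$ (resp. $\gamma=1$). Partial dual $G^A$ ($A\subseteq E(G)$): orient each edge boundary arbitrarily; the boundary components of the spanning ribbon subgraph $(V(G),A)$ meet the edges of $G$ in disjoint arcs; mark each such arc with an arrow in the direction of the edge's boundary orientation, labelled by the edge; $G^A$ is obtained by capping each marked boundary component with a vertex disc and, for each label $e$, attaching an edge disc along the two $e$-labelled arrows respecting directions. $G^{E(G)}=G^*$ is the geometric dual. $G$ and $H$ are partial duals of each other if $H=G^A$ for some $A\subseteq E(G)$. Join: for connected $G$ with non-trivial connected ribbon subgraphs $P,Q$, $G=P\cup Q$, $P\cap Q=\{v\}$, and an arc on the boundary of $v$ met by all edges of $P$ incident to $v$ and by no edges of $Q$, write $G=P\vee Q$. If $G=P\vee Q$, the ribbon graph $G^{E(Q)}=P\vee Q^*$ is obtained from $G$ by a dual-of-a-join-summand move. Two ribbon graphs are related by dualling join-summands if there is a sequence of dual-of-a-join-summand moves taking one to the other, or if they are geometric duals. *)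

theory Defs
  imports Main
begin

text \<open>
  A ribbon graph is recorded by the cell structure that its discs induce on its boundary curves.
  The boundary of an edge disc consists of the two segments in which the edge meets vertices and
  of two free sides; the boundary of a vertex disc consists of segments, separated by gaps,
  or it meets no edge at all. The points of the encoding are the ends of the segments (corners;
  there are four on every edge) and one base point on each vertex disc that meets no edge.
  Each of seg, side and gap sends a corner to the other end of the arc of that kind at the corner.
  The values of these functions outside the corners are irrelevant.
\<close>

record 'a ribbon_graph =
  corners :: "'a set"
  isolated :: "'a set"
  seg :: "'a \<Rightarrow> 'a"
  side :: "'a \<Rightarrow> 'a"
  gap :: "'a \<Rightarrow> 'a"

definition matching_on :: "'a set \<Rightarrow> ('a \<Rightarrow> 'a) \<Rightarrow> bool" where
  "matching_on X f \<longleftrightarrow> (\<forall>x\<in>X. f x \<in> X \<and> f x \<noteq> x \<and> f (f x) = x)"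

text \<open>
  The last condition says that the boundary of every edge disc is a circle made of exactly two
  segments and two sides. A gap may have the same ends as a segment or a side.
\<close>

definition is_ribbon_graph :: "'a ribbon_graph \<Rightarrow> bool" where
  "is_ribbon_graph G \<longleftrightarrow>
     finite (corners G) \<and> finite (isolated G) \<and> corners G \<inter> isolated G = {} \<and>
     matching_on (corners G) (seg G) \<and> matching_on (corners G) (side G) \<and>
     matching_on (corners G) (gap G) \<and>
     (\<forall>x\<in>corners G. seg G x \<noteq> side G x \<and> seg G (side G x) = side G (seg G x))"

text \<open>
  Homeomorphism of ribbon graphs (carrying vertices to vertices and edges to edges).
\<close>

definition rg_homeo :: "'a ribbon_graph \<Rightarrow> 'b ribbon_graph \<Rightarrow> bool" (infix \<open>\<simeq>\<close> 50) where
  "G \<simeq> H \<longleftrightarrow>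
     (\<exists>f h. bij_betw f (corners G) (corners H) \<and> bij_betw h (isolated G) (isolated H) \<and>
        (\<forall>x\<in>corners G. f (seg G x) = seg H (f x) \<and> f (side G x) = side H (f x) \<and>
                        f (gap G x) = gap H (f x)))"

inductive_set orbit :: "('a \<Rightarrow> 'a) \<Rightarrow> ('a \<Rightarrow> 'a) \<Rightarrow> 'a \<Rightarrow> 'a set"
  for f g :: "'a \<Rightarrow> 'a" and x :: 'a where
  orbit_refl: "x \<in> orbit f g x"
| orbit_left: "y \<in> orbit f g x \<Longrightarrow> f y \<in> orbit f g x"
| orbit_right: "y \<in> orbit f g x \<Longrightarrow> g y \<in> orbit f g x"

text \<open>
  Vertices, edges and boundary components are represented by the sets of points on their
  boundary curves; in particular a vertex and an edge are incident iff these sets meet.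
\<close>

definition edge_of :: "'a ribbon_graph \<Rightarrow> 'a \<Rightarrow> 'a set" where
  "edge_of G x = orbit (seg G) (side G) x"

definition edges :: "'a ribbon_graph \<Rightarrow> 'a set set" where
  "edges G = edge_of G ` corners G"

definition verts :: "'a ribbon_graph \<Rightarrow> 'a set set" where
  "verts G = orbit (seg G) (gap G) ` corners G \<union> (\<lambda>x. {x}) ` isolated G"

text \<open>
  The arc in which an edge meets the boundary of the spanning ribbon subgraph with edge set
  \<open>A\<close> is a free side if the edge is in \<open>A\<close>, and a segment on a vertex otherwise.
\<close>

definition marked_arc :: "'a ribbon_graph \<Rightarrow> 'a set set \<Rightarrow> 'a \<Rightarrow> 'a" where
  "marked_arc G A x = (if x \<in> \<Union>A then side G x else seg G x)"

definition boundary_components :: "'a ribbon_graph \<Rightarrow> 'a set set \<Rightarrow> 'a set set" where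
  "boundary_components G A =
     orbit (marked_arc G A) (gap G) ` corners G \<union> (\<lambda>x. {x}) ` isolated G"


text \<open>
  A ribbon subgraph is given by its vertex set and edge set.
\<close>

definition ribbon_subgraph :: "'a ribbon_graph \<Rightarrow> 'a set set \<times> 'a set set \<Rightarrow> bool" where
  "ribbon_subgraph G P \<longleftrightarrow>
     fst P \<subseteq> verts G \<and> snd P \<subseteq> edges G \<and>
     (\<forall>v\<in>verts G. \<forall>e\<in>snd P. v \<inter> e \<noteq> {} \<longrightarrow> v \<in> fst P)"

definition joined_in :: "'a set set \<times> 'a set set \<Rightarrow> ('a set \<times> 'a set) set" where
  "joined_in P =
     {(u, w). u \<in> fst P \<and> w \<in> fst P \<and>
        (u, w) \<in> {(u', w'). u' \<in> fst P \<and> w' \<in> fst P \<and>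
                    (\<exists>e\<in>snd P. u' \<inter> e \<noteq> {} \<and> w' \<inter> e \<noteq> {})}\<^sup>*}"

definition components :: "'a set set \<times> 'a set set \<Rightarrow> 'a set set set" where
  "components P = fst P // joined_in P"

definition connected_sub :: "'a set set \<times> 'a set set \<Rightarrow> bool" where
  "connected_sub P \<longleftrightarrow> fst P \<noteq> {} \<and> (\<forall>u\<in>fst P. \<forall>w\<in>fst P. (u, w) \<in> joined_in P)"

definition rg_connected :: "'a ribbon_graph \<Rightarrow> bool" where
  "rg_connected G \<longleftrightarrow> connected_sub (verts G, edges G)"


text \<open>
  An orientation of all vertex and edge discs that agrees along the segments amounts to a
  two-colouring of the corners: colour a corner by whether its segment starts or ends there in
  the direction of the vertex boundary. Colours alternate along the vertex boundary, and, since
  the adjacent edge boundary runs through each segment in the opposite direction, also along the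
  edge boundary.
\<close>

definition orientable :: "'a ribbon_graph \<Rightarrow> bool" where
  "orientable G \<longleftrightarrow>
     (\<exists>c :: 'a \<Rightarrow> bool. \<forall>x\<in>corners G.
        c (seg G x) \<noteq> c x \<and> c (side G x) \<noteq> c x \<and> c (gap G x) \<noteq> c x)"

text \<open>
  The Euler characteristic is that of the closed surface obtained by capping all boundary
  components with discs. The genus and the non-orientable genus of a surface are determined by
  \<open>\<chi> = 2k - 2g\<close> and \<open>\<chi> = 2k - g\<close> respectively, where \<open>k\<close> is the number of components.
\<close>

definition euler_char :: "'a ribbon_graph \<Rightarrow> int" where
  "euler_char G =
     int (card (verts G)) - int (card (edges G)) + int (card (boundary_components G (edges G)))"

definition orientable_genus :: "'a ribbon_graph \<Rightarrow> int" where
  "orientable_genus G = (2 * int (card (components (verts G, edges G))) - euler_char G) div 2"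

definition nonorientable_genus :: "'a ribbon_graph \<Rightarrow> int" where
  "nonorientable_genus G = 2 * int (card (components (verts G, edges G))) - euler_char G"

definition euler_genus :: "'a ribbon_graph \<Rightarrow> int" where
  "euler_genus G = (if orientable G then 2 * orientable_genus G else nonorientable_genus G)"

definition plane :: "'a ribbon_graph \<Rightarrow> bool" where
  "plane G \<longleftrightarrow> rg_connected G \<and> euler_genus G = 0"

definition RP2 :: "'a ribbon_graph \<Rightarrow> bool" where
  "RP2 G \<longleftrightarrow> rg_connected G \<and> euler_genus G = 1"


text \<open>
  An orientation of the boundaries of all edge discs, as the map sending each corner to the
  next corner on its edge.
\<close>

definition edge_orientation :: "'a ribbon_graph \<Rightarrow> ('a \<Rightarrow> 'a) \<Rightarrow> bool" where
  "edge_orientation G d \<longleftrightarrow>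
     (\<forall>x\<in>corners G. (d x = seg G x \<and> d (d x) = side G (d x)) \<or>
                     (d x = side G x \<and> d (d x) = seg G (d x)))"

text \<open>
  The arrow on a marked arc points in the direction of the orientation \<open>d\<close>.
\<close>

definition arrow_tail :: "'a ribbon_graph \<Rightarrow> ('a \<Rightarrow> 'a) \<Rightarrow> 'a set set \<Rightarrow> 'a \<Rightarrow> bool" where
  "arrow_tail G d A x \<longleftrightarrow> d x = marked_arc G A x"

text \<open>
  When an edge disc is attached along the two arrows with label \<open>e\<close>, both arrows agree with one
  orientation of the boundary of the disc, so each free side of the disc joins the head of one of
  the arrows to the tail of the other.
\<close>

definition attached_side :: "'a ribbon_graph \<Rightarrow> ('a \<Rightarrow> 'a) \<Rightarrow> 'a set set \<Rightarrow> 'a \<Rightarrow> 'a" where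
  "attached_side G d A x =
     (THE y. y \<in> edge_of G x \<and> y \<noteq> x \<and> y \<noteq> marked_arc G A x \<and>
             (arrow_tail G d A y \<longleftrightarrow> \<not> arrow_tail G d A x))"

text \<open>
  The boundary components of the spanning ribbon subgraph \<open>(V(G), A)\<close> bound the new vertex
  discs, so the marked arcs become the segments, and the gaps do not change.
\<close>

definition partial_dual :: "'a ribbon_graph \<Rightarrow> 'a set set \<Rightarrow> 'a ribbon_graph" where
  "partial_dual G A =
     (let d = (SOME d. edge_orientation G d)
      in G\<lparr>seg := marked_arc G A, side := attached_side G d A\<rparr>)"

definition geometric_dual :: "'a ribbon_graph \<Rightarrow> 'a ribbon_graph" where
  "geometric_dual G = partial_dual G (edges G)"

definition partial_duals :: "'a ribbon_graph \<Rightarrow> 'b ribbon_graph \<Rightarrow> bool" where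
  "partial_duals G H \<longleftrightarrow> (\<exists>A\<subseteq>edges G. partial_dual G A \<simeq> H)"


text \<open>
  The corners on the arc of a vertex boundary that starts just before the corner \<open>x\<close>, runs
  through the segment at \<open>x\<close> and contains exactly the first \<open>n\<close> segments met in this direction.
\<close>

definition boundary_arc :: "'a ribbon_graph \<Rightarrow> 'a \<Rightarrow> nat \<Rightarrow> 'a set" where
  "boundary_arc G x n = (\<Union>i<n. let y = ((gap G \<circ> seg G) ^^ i) x in {y, seg G y})"

definition is_join ::
  "'a ribbon_graph \<Rightarrow> 'a set set \<times> 'a set set \<Rightarrow> 'a set set \<times> 'a set set \<Rightarrow> bool" where
  "is_join G P Q \<longleftrightarrow>
     rg_connected G \<and>
     ribbon_subgraph G P \<and> connected_sub P \<and> snd P \<noteq> {} \<and>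
     ribbon_subgraph G Q \<and> connected_sub Q \<and> snd Q \<noteq> {} \<and>
     fst P \<union> fst Q = verts G \<and> snd P \<union> snd Q = edges G \<and>
     (\<exists>v. fst P \<inter> fst Q = {v} \<and> snd P \<inter> snd Q = {} \<and>
          (\<exists>x\<in>v. \<exists>n. v \<inter> \<Union>(snd P) \<subseteq> boundary_arc G x n \<and>
                      boundary_arc G x n \<inter> \<Union>(snd Q) = {}))"

definition join_summand_move :: "'a ribbon_graph \<Rightarrow> 'a ribbon_graph \<Rightarrow> bool" where
  "join_summand_move G G' \<longleftrightarrow> (\<exists>P Q. is_join G P Q \<and> G' = partial_dual G (snd Q))"

definition related_by_dualling_join_summands ::
  "'a ribbon_graph \<Rightarrow> 'b ribbon_graph \<Rightarrow> bool" where
  "related_by_dualling_join_summands G H \<longleftrightarrow>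
     (\<exists>K. join_summand_move\<^sup>*\<^sup>* G K \<and> K \<simeq> H) \<or> geometric_dual G \<simeq> H"


lemma edge_of_eq:
  assumes "is_ribbon_graph G" "x \<in> corners G"
  shows "edge_of G x = {x, seg G x, side G x, seg G (side G x)}" (is "_ = ?R")
proof
  show "edge_of G x \<subseteq> ?R"
  proof
    fix y assume "y \<in> edge_of G x"
    then have "y \<in> orbit (seg G) (side G) x" by (simp add: edge_of_def)
    then show "y \<in> ?R"
      by induction (use assms in \<open>auto simp: is_ribbon_graph_def matching_on_def\<close>)
  qed
  show "?R \<subseteq> edge_of G x"
    unfolding edge_of_def by (auto intro: orbit.intros)
qed

lemma edge_of_cong:
  assumes "is_ribbon_graph G" "x \<in> corners G" "y \<in> edge_of G x"
  shows "edge_of G y = edge_of G x"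
proof -
  have y: "y \<in> corners G"
    using assms by (auto simp: edge_of_eq is_ribbon_graph_def matching_on_def)
  show ?thesis
    using assms y unfolding edge_of_eq[OF assms(1,2)] edge_of_eq[OF assms(1) y]
    by (auto simp: is_ribbon_graph_def matching_on_def)
qed

lemma edge_set_closed:
  assumes "is_ribbon_graph G" "A \<subseteq> edges G" "x \<in> corners G" "y \<in> edge_of G x"
  shows "y \<in> \<Union>A \<longleftrightarrow> x \<in> \<Union>A"
proof -
  have y: "y \<in> corners G"
    using assms by (auto simp: edge_of_eq is_ribbon_graph_def matching_on_def)
  have *: "z \<in> \<Union>A \<longleftrightarrow> edge_of G z \<in> A" if z: "z \<in> corners G" for z
  proof
    assume "z \<in> \<Union>A"
    then obtain w where "w \<in> corners G" "z \<in> edge_of G w" "edge_of G w \<in> A"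
      using assms(2) by (auto simp: edges_def)
    then show "edge_of G z \<in> A" using edge_of_cong[OF assms(1)] by metis
  next
    assume "edge_of G z \<in> A"
    then show "z \<in> \<Union>A" using edge_of_eq[OF assms(1) z] by auto
  qed
  show ?thesis using *[OF y] *[OF assms(3)] edge_of_cong[OF assms(1,3,4)] by simp
qed

lemma edge_orientation_exists:
  assumes "is_ribbon_graph G"
  shows "\<exists>d. edge_orientation G d"
proof -
  define r where "r e = (SOME x. x \<in> e)" for e :: "'a set"
  define d where
    "d x = (let z = r (edge_of G x) in if x = z \<or> x = seg G (side G z) then seg G x else side G x)"
    for x
  have "(d x = seg G x \<and> d (d x) = side G (d x)) \<or> (d x = side G x \<and> d (d x) = seg G (d x))"
    if x: "x \<in> corners G" for x
  proof -
    let ?z = "r (edge_of G x)"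
    have zx: "?z \<in> edge_of G x"
      unfolding r_def edge_of_def by (rule someI, rule orbit_refl)
    have z: "?z \<in> corners G"
      using zx assms x by (auto simp: edge_of_eq is_ribbon_graph_def matching_on_def)
    have same: "edge_of G ?z = edge_of G x" by (rule edge_of_cong[OF assms x zx])
    have xin: "x \<in> {?z, seg G ?z, side G ?z, seg G (side G ?z)}"
      using edge_of_eq[OF assms z] same orbit_refl[of x] by (simp add: edge_of_def)
    have dy: "d y = (if y = ?z \<or> y = seg G (side G ?z) then seg G y else side G y)"
      if "y \<in> edge_of G x" for y
      using edge_of_cong[OF assms x that] by (simp add: d_def Let_def)
    have mem: "x \<in> edge_of G x" "seg G x \<in> edge_of G x" "side G x \<in> edge_of G x"
      using edge_of_eq[OF assms x] by auto
    have R: "\<forall>x\<in>corners G. seg G x \<in> corners G \<and> seg G x \<noteq> x \<and> seg G (seg G x) = x \<and>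
        side G x \<in> corners G \<and> side G x \<noteq> x \<and> side G (side G x) = x \<and>
        seg G x \<noteq> side G x \<and> seg G (side G x) = side G (seg G x)"
      using assms by (auto simp: is_ribbon_graph_def matching_on_def)
    show ?thesis
    proof -
      let ?s = "seg G ?z" and ?t = "side G ?z" and ?st = "seg G (side G ?z)"
      have f: "seg G ?s = ?z" "side G ?t = ?z" "seg G ?st = ?t" "side G ?s = ?st" "side G ?st = ?s"
        "?s \<noteq> ?z" "?t \<noteq> ?z" "?s \<noteq> ?t" "?st \<noteq> ?z" "?st \<noteq> ?s" "?st \<noteq> ?t"
        using R z by metis+
      have "?s \<in> edge_of G x" "?t \<in> edge_of G x" "?st \<in> edge_of G x"
        using edge_of_eq[OF assms z] same by auto
      from this[THEN dy] dy[OF zx] have "d ?z = ?s" "d ?s = ?st" "d ?st = ?t" "d ?t = ?z"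
        using f by auto
      then show ?thesis using xin f by auto
    qed
  qed
  then have "edge_orientation G d" by (simp add: edge_orientation_def)
  then show ?thesis by blast
qed

text \<open>
  The result of the arrow construction does not depend on the orientations of the edges.
\<close>

lemma attached_side_eq:
  assumes G: "is_ribbon_graph G" and A: "A \<subseteq> edges G" and d: "edge_orientation G d"
    and x: "x \<in> corners G"
  shows "attached_side G d A x = (if x \<in> \<Union>A then seg G x else side G x)"
proof -
  have R: "\<forall>x\<in>corners G. seg G x \<in> corners G \<and> seg G x \<noteq> x \<and> seg G (seg G x) = x \<and>
      side G x \<in> corners G \<and> side G x \<noteq> x \<and> side G (side G x) = x \<and>
      seg G x \<noteq> side G x \<and> seg G (side G x) = side G (seg G x)"
    using G by (auto simp: is_ribbon_graph_def matching_on_def)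
  have D: "\<forall>x\<in>corners G. (d x = seg G x \<and> d (d x) = side G (d x)) \<or>
      (d x = side G x \<and> d (d x) = seg G (d x))"
    using d by (simp add: edge_orientation_def)
  have E: "edge_of G x = {x, seg G x, side G x, seg G (side G x)}" by (rule edge_of_eq[OF G x])
  have c: "seg G x \<in> \<Union>A \<longleftrightarrow> x \<in> \<Union>A" "side G x \<in> \<Union>A \<longleftrightarrow> x \<in> \<Union>A"
     "seg G (side G x) \<in> \<Union>A \<longleftrightarrow> x \<in> \<Union>A"
    by (rule edge_set_closed[OF G A x], simp add: E)+
  let ?s = "seg G x" and ?t = "side G x" and ?st = "seg G (side G x)"
  have f: "seg G ?s = x" "side G ?t = x" "seg G ?st = ?t" "side G ?s = ?st" "side G ?st = ?s"
    "?s \<noteq> x" "?t \<noteq> x" "?s \<noteq> ?t" "?st \<noteq> x" "?st \<noteq> ?s" "?st \<noteq> ?t"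
    using R x by metis+
  note n = f(6-11) f(6-11)[symmetric]
  have cs: "?s \<in> corners G" "?t \<in> corners G" "?st \<in> corners G" using R x by metis+
  have D': "(d x = ?s \<and> d (d x) = side G (d x)) \<or> (d x = ?t \<and> d (d x) = seg G (d x))"
     "(d ?s = x \<and> d (d ?s) = side G (d ?s)) \<or> (d ?s = ?st \<and> d (d ?s) = seg G (d ?s))"
     "(d ?t = ?st \<and> d (d ?t) = side G (d ?t)) \<or> (d ?t = x \<and> d (d ?t) = seg G (d ?t))"
     "(d ?st = ?t \<and> d (d ?st) = side G (d ?st)) \<or> (d ?st = ?s \<and> d (d ?st) = seg G (d ?st))"
    using D[rule_format, OF x] D[rule_format, OF cs(1)] D[rule_format, OF cs(2)]
      D[rule_format, OF cs(3)] unfolding f(1-5) by blast+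
  have o: "(d x = ?s \<and> d ?s = ?st \<and> d ?t = x \<and> d ?st = ?t) \<or>
           (d x = ?t \<and> d ?t = ?st \<and> d ?s = x \<and> d ?st = ?s)"
  proof (cases "d x = ?s")
    case True
    with D'(1) n f(4) have 1: "d ?s = ?st" by auto
    with D'(2) n f(3) have 2: "d ?st = ?t" by auto
    with D'(4) n f(2) have 3: "d ?t = x" by auto
    from True 1 2 3 show ?thesis by blast
  next
    case False
    with D'(1) have 0: "d x = ?t" "d ?t = ?st" by auto
    with D'(3) n f(5) have 2: "d ?st = ?s" by auto
    with D'(4) n f(1) have 3: "d ?s = x" by auto
    from 0 2 3 show ?thesis by blast
  qed
  define X where "X \<longleftrightarrow> x \<in> \<Union>A"
  have m: "marked_arc G A x = (if X then ?t else ?s)" "marked_arc G A ?s = (if X then ?st else x)"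
    "marked_arc G A ?t = (if X then x else ?st)" "marked_arc G A ?st = (if X then ?s else ?t)"
    unfolding marked_arc_def c X_def[symmetric] f by (rule refl)+
  have "attached_side G d A x = (if X then ?s else ?t)"
    unfolding attached_side_def E
  proof (rule the_equality)
    show "(if X then ?s else ?t) \<in> {x, ?s, ?t, ?st} \<and> (if X then ?s else ?t) \<noteq> x \<and>
      (if X then ?s else ?t) \<noteq> marked_arc G A x \<and>
      (arrow_tail G d A (if X then ?s else ?t) \<longleftrightarrow> \<not> arrow_tail G d A x)"
      using o n by (cases X) (auto simp: arrow_tail_def m simp del: Union_iff)
  next
    fix y
    assume y: "y \<in> {x, ?s, ?t, ?st} \<and> y \<noteq> x \<and> y \<noteq> marked_arc G A x \<and>
      (arrow_tail G d A y \<longleftrightarrow> \<not> arrow_tail G d A x)"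
    have "y \<noteq> ?st"
    proof
      assume "y = ?st"
      with y have "arrow_tail G d A ?st \<longleftrightarrow> \<not> arrow_tail G d A x" by simp
      then show False using o n by (cases X) (auto simp: arrow_tail_def m)
    qed
    then show "y = (if X then ?s else ?t)" using y m(1) by auto
  qed
  then show ?thesis by (simp only: X_def)
qed

lemma is_ribbon_graph_partial_dual:
  assumes G: "is_ribbon_graph G" and A: "A \<subseteq> edges G"
  shows "is_ribbon_graph (partial_dual G A)"
proof -
  define d where "d = (SOME d. edge_orientation G d)"
  have d: "edge_orientation G d"
    unfolding d_def by (rule someI_ex[OF edge_orientation_exists[OF G]])
  have R: "\<forall>x\<in>corners G. seg G x \<in> corners G \<and> seg G x \<noteq> x \<and> seg G (seg G x) = x \<and>
      side G x \<in> corners G \<and> side G x \<noteq> x \<and> side G (side G x) = x \<and>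
      seg G x \<noteq> side G x \<and> seg G (side G x) = side G (seg G x)"
    using G by (auto simp: is_ribbon_graph_def matching_on_def)
  have c: "seg G x \<in> \<Union>A \<longleftrightarrow> x \<in> \<Union>A" "side G x \<in> \<Union>A \<longleftrightarrow> x \<in> \<Union>A" if "x \<in> corners G" for x
    by (rule edge_set_closed[OF G A that], simp add: edge_of_eq[OF G that])+
  have s: "attached_side G d A x = (if x \<in> \<Union>A then seg G x else side G x)"
    if "x \<in> corners G" for x
    by (rule attached_side_eq[OF G A d that])
  have cl: "marked_arc G A x \<in> corners G" "attached_side G d A x \<in> corners G"
    if "x \<in> corners G" for x
    using R[rule_format, OF that] unfolding s[OF that] marked_arc_def by simp_all
  have "matching_on (corners G) (marked_arc G A)"
    unfolding matching_on_def
  proof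
    fix x assume x: "x \<in> corners G"
    show "marked_arc G A x \<in> corners G \<and> marked_arc G A x \<noteq> x \<and>
        marked_arc G A (marked_arc G A x) = x"
      using R[rule_format, OF x] c[OF x] unfolding marked_arc_def
      by (cases "x \<in> \<Union>A") (simp_all del: Union_iff)
  qed
  moreover have "matching_on (corners G) (attached_side G d A)"
    unfolding matching_on_def
  proof
    fix x assume x: "x \<in> corners G"
    show "attached_side G d A x \<in> corners G \<and> attached_side G d A x \<noteq> x \<and>
        attached_side G d A (attached_side G d A x) = x"
      using R[rule_format, OF x] c[OF x] unfolding s[OF cl(2)[OF x]] unfolding s[OF x]
      by (cases "x \<in> \<Union>A") (simp_all del: Union_iff)
  qed
  moreover have "\<forall>x\<in>corners G. marked_arc G A x \<noteq> attached_side G d A x \<and>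
      marked_arc G A (attached_side G d A x) = attached_side G d A (marked_arc G A x)"
  proof
    fix x assume x: "x \<in> corners G"
    show "marked_arc G A x \<noteq> attached_side G d A x \<and>
        marked_arc G A (attached_side G d A x) = attached_side G d A (marked_arc G A x)"
      using R[rule_format, OF x] c[OF x] unfolding s[OF cl(1)[OF x]]
      unfolding s[OF x] marked_arc_def
      by (cases "x \<in> \<Union>A") (auto simp del: Union_iff)
  qed
  ultimately show ?thesis
    using G unfolding is_ribbon_graph_def partial_dual_def Let_def d_def[symmetric] by simp
qed

lemma verts_partial_dual: "verts (partial_dual G A) = boundary_components G A"
  by (simp add: verts_def boundary_components_def partial_dual_def Let_def)

end

theory Submission
  imports Defs "HOL-Combinatorics.Permutations"
begin

text \<open>
  The medial graph, with the edges of \<open>G\<close> as nodes and the gaps as links, is the same for all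
  partial duals of \<open>G\<close>, and the join decompositions of \<open>G\<close> are its cuts with exactly two links.
  So \<open>G\<^sup>A\<close> is reachable by moves iff \<open>A\<close> is a sum modulo 2 of sides of two-link cuts.

  Let \<open>D\<close> be the set of gaps between an edge in \<open>A\<close> and an edge outside \<open>A\<close>. If \<open>G\<close> is plane, the
  boundaries of vertices and faces generate the cycle space of the medial graph, so a set of gaps is a cut
  iff it meets each of them evenly. For a vertex \<open>v\<close>, the gaps of \<open>D\<close> on \<open>v\<close> meet evenly
  all vertex and face boundaries of \<open>G\<^sup>A\<close>, as these run along \<open>v\<close> between consecutive gaps of \<open>D\<close> on
  one side; since \<open>G\<^sup>A\<close> is plane they form a cut, hence meet every face \<open>f\<close> of \<open>G\<close> evenly. Any two
  gaps on the same \<open>v\<close> and \<open>f\<close> form a cut, so pairing them up within each \<open>v\<close> and \<open>f\<close> writes \<open>D\<close> as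
  a sum of two-link cuts; hence \<open>A\<close> is such a sum, or \<open>A = E(G)\<close>. In the projective case the same
  argument is applied to the orientable double cover, which is plane.
\<close>

section \<open>Parities and orbits of matchings\<close>

text \<open>The set \<open>D\<close> does not pair up by itself: a partner must share both the
  vertex and the face of a gap, so \<open>D\<close> has to be even on every intersection of a vertex
  with a face, which in general does not follow from evenness on vertices and on faces separately.
  Generation of the cycle space is obtained by counting instead of topology: cuts and sets of gaps
  with even boundary intersections are vector spaces over the two-element field, the first inside
  the second, and Euler's formula says that their dimensions agree. The count also bounds the Euler
  characteristic of every connected encoding by 2, which is how the double cover of a projective
  graph is seen to be plane: its vertices and faces at least double. There the full preimage of
  \<open>D\<close> is useless, since it contains each gap twice and cancels modulo 2 on projection.
  Keeping only the gaps on one chosen lift of every vertex leaves each gap once and preserves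
  evenness. The exceptional case \<open>A = E(G)\<close> arises because a cut determines its side
  only up to complement.\<close>

lemma even_card_sym_diff:
  assumes "finite A" "finite B"
  shows "even (card (sym_diff A B)) \<longleftrightarrow> (even (card A) \<longleftrightarrow> even (card B))"
proof -
  have "card (sym_diff A B) = card (A - B) + card (B - A)"
    using assms by (intro card_Un_disjoint) auto
  moreover have "card A = card (A - B) + card (A \<inter> B)"
    using assms by (subst card_Un_disjoint[symmetric]) (auto intro: arg_cong[of _ _ card])
  moreover have "card B = card (B - A) + card (A \<inter> B)"
    using assms by (subst card_Un_disjoint[symmetric]) (auto intro: arg_cong[of _ _ card])
  ultimately show ?thesis by presburger
qed

lemma odd_card_sym_diff_Int:
  assumes "finite A" "finite B"
  shows "odd (card (sym_diff A B \<inter> K)) \<longleftrightarrow> (odd (card (A \<inter> K)) \<longleftrightarrow> even (card (B \<inter> K)))"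
proof -
  have "sym_diff A B \<inter> K = sym_diff (A \<inter> K) (B \<inter> K)" by auto
  then show ?thesis using even_card_sym_diff[of "A \<inter> K" "B \<inter> K"] assms by auto
qed

text \<open>Rank-nullity over the field with two elements, for parities of intersections.\<close>

lemma card_even_sets:
  fixes K :: "'n \<Rightarrow> 'a set"
  assumes R: "finite R" and N: "finite N"
    and single: "\<And>n. n \<in> N \<Longrightarrow> \<exists>X\<subseteq>R. {m\<in>N. odd (card (X \<inter> K m))} = {n}"
  shows "card {X. X \<subseteq> R \<and> (\<forall>n\<in>N. even (card (X \<inter> K n)))} * 2 ^ card N = 2 ^ card R"
proof -
  define p where "p X = {m\<in>N. odd (card (X \<inter> K m))}" for X
  define Z where "Z = {X. X \<subseteq> R \<and> (\<forall>n\<in>N. even (card (X \<inter> K n)))}"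
  have p_sd: "p (sym_diff X Y) = sym_diff (p X) (p Y)" if "X \<subseteq> R" "Y \<subseteq> R" for X Y
  proof -
    have "finite X" "finite Y" using that R finite_subset by auto
    then show ?thesis unfolding p_def using odd_card_sym_diff_Int[of X Y] by auto
  qed
  \<comment> \<open>By \<open>p_sd\<close> the map \<open>p\<close> is linear, so reaching all
    singletons makes it onto \<open>Pow N\<close>.\<close>
  have "\<exists>X\<subseteq>R. p X = U" if "U \<subseteq> N" for U
    using finite_subset[OF that N] that
  proof (induction U rule: finite_induct)
    case empty
    have "p {} = {}" by (auto simp: p_def)
    then show ?case by blast
  next
    case (insert n U)
    then obtain X where X: "X \<subseteq> R" "p X = U" by auto
    obtain Y where Y: "Y \<subseteq> R" "p Y = {n}" using single[of n] insert.prems by (auto simp: p_def)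
    have "p (sym_diff X Y) = insert n U" using p_sd[OF X(1) Y(1)] X Y insert by auto
    then show ?case using X Y by (intro exI[of _ "sym_diff X Y"]) auto
  qed
  then obtain h where h: "\<And>U. U \<subseteq> N \<Longrightarrow> h U \<subseteq> R \<and> p (h U) = U" by metis
  have pZ: "Z = {X. X \<subseteq> R \<and> p X = {}}" by (auto simp: Z_def p_def)
  have pN: "p X \<subseteq> N" for X by (auto simp: p_def)
  \<comment> \<open>\<open>h\<close> picks one preimage of every parity vector. Adding
    \<open>h (p X)\<close> moves \<open>X\<close> into the kernel \<open>Z\<close>; this splits
    \<open>Pow R\<close> as a product of \<open>Z\<close> and \<open>Pow N\<close> although
    \<open>h\<close> need not be additive.\<close>
  define F where "F y = sym_diff (fst y) (h (snd y))" for y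
  define F' where "F' X = (sym_diff X (h (p X)), p X)" for X
  have pF: "p (F (X, U)) = U" "F (X, U) \<subseteq> R" if "X \<in> Z" "U \<subseteq> N" for X U
  proof -
    show "p (F (X, U)) = U"
      using that h[of U] p_sd[of X "h U"] by (simp add: pZ F_def)
    show "F (X, U) \<subseteq> R" using that h[of U] by (auto simp: pZ F_def)
  qed
  have sd: "sym_diff (sym_diff A B) B = A" for A B :: "'a set" by auto
  have "bij_betw F (Z \<times> Pow N) (Pow R)"
  proof (rule bij_betw_byWitness[where f' = F'])
    show "\<forall>a\<in>Z \<times> Pow N. F' (F a) = a"
    proof clarify
      fix X U assume "X \<in> Z" "U \<subseteq> N"
      then show "F' (F (X, U)) = (X, U)" unfolding F'_def by (simp only: pF) (simp only: F_def fst_conv snd_conv sd)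
    qed
    show "\<forall>a'\<in>Pow R. F (F' a') = a'"
      by (simp only: F_def F'_def fst_conv snd_conv sd) simp
    show "F ` (Z \<times> Pow N) \<subseteq> Pow R"
      using pF by blast
    show "F' ` Pow R \<subseteq> Z \<times> Pow N"
    proof (rule image_subsetI)
      fix X assume "X \<in> Pow R"
      then have X: "X \<subseteq> R" by simp
      have "p (sym_diff X (h (p X))) = {}" using p_sd[OF X, of "h (p X)"] h[OF pN] by auto
      moreover have "sym_diff X (h (p X)) \<subseteq> R" using X h[OF pN[of X]] by blast
      ultimately show "F' X \<in> Z \<times> Pow N"
        using pN by (simp add: pZ F'_def)
    qed
  qed
  then have "card (Z \<times> Pow N) = card (Pow R)" by (rule bij_betw_same_card)
  then show ?thesis using N R by (simp add: Z_def card_cartesian_product card_Pow)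
qed

lemma matching_onD:
  assumes "matching_on X f" "x \<in> X"
  shows "f x \<in> X" "f x \<noteq> x" "f (f x) = x"
  using assms by (auto simp: matching_on_def)

lemma matching_on_subset:
  assumes "matching_on X f" "Y \<subseteq> X" "\<And>x. x \<in> Y \<Longrightarrow> f x \<in> Y"
  shows "matching_on Y f"
  using assms by (auto simp: matching_on_def)

lemma even_card_matching_on:
  assumes "finite U" "matching_on U f"
  shows "even (card U)"
proof -
  have "2 * card ((\<lambda>x. {x, f x}) ` U) = card (\<Union>((\<lambda>x. {x, f x}) ` U))"
  proof (rule card_partition)
    show "card c = 2" if c: "c \<in> (\<lambda>x. {x, f x}) ` U" for c
    proof -
      obtain x where "x \<in> U" "c = {x, f x}" using c by blast
      then show ?thesis using matching_onD(2)[OF assms(2)] by (metis card_2_iff)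
    qed
    show "c \<inter> d = {}" if cd: "c \<in> (\<lambda>x. {x, f x}) ` U" "d \<in> (\<lambda>x. {x, f x}) ` U" "c \<noteq> d" for c d
    proof -
      obtain x y where "x \<in> U" "c = {x, f x}" "y \<in> U" "d = {y, f y}" using cd by blast
      then show ?thesis using matching_onD(3)[OF assms(2)] cd(3) by (metis disjoint_iff doubleton_eq_iff insertE singletonD)
    qed
  qed (use assms in auto)
  also have "\<Union>((\<lambda>x. {x, f x}) ` U) = U" using assms by (auto simp: matching_on_def)
  finally show ?thesis by presburger
qed

lemma orbit_minimal:
  assumes "x \<in> U" "\<And>y. y \<in> U \<Longrightarrow> f y \<in> U" "\<And>y. y \<in> U \<Longrightarrow> g y \<in> U"
  shows "orbit f g x \<subseteq> U"
proof
  fix y assume "y \<in> orbit f g x" then show "y \<in> U" by induction (use assms in auto)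
qed

text \<open>The functions of a ribbon graph are arbitrary off the corners, so orbits in two
  encodings are compared on a closed set containing the starting point.\<close>

lemma orbit_cong:
  assumes "x \<in> U" "\<And>y. y \<in> U \<Longrightarrow> f y \<in> U \<and> f' y = f y" "\<And>y. y \<in> U \<Longrightarrow> g y \<in> U \<and> g' y = g y"
  shows "orbit f' g' x = orbit f g x"
proof
  have "y \<in> orbit f g x \<inter> U" if "y \<in> orbit f' g' x" for y
    using that by induction (use assms in \<open>auto intro: orbit.intros\<close>)
  then show "orbit f' g' x \<subseteq> orbit f g x" by blast
  have "y \<in> orbit f' g' x \<inter> U" if "y \<in> orbit f g x" for y
    using that
  proof induction
    case (orbit_left y) then show ?case using assms(2)[of y] orbit.orbit_left[of y f' g' x] by force
  next
    case (orbit_right y) then show ?case using assms(3)[of y] orbit.orbit_right[of y f' g' x] by force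
  qed (use assms in \<open>auto intro: orbit.intros\<close>)
  then show "orbit f g x \<subseteq> orbit f' g' x" by blast
qed

lemma orbit_commute: "orbit f g x = orbit g f x"
proof -
  have "y \<in> orbit g f x" if "y \<in> orbit f g x" for f g :: "'a \<Rightarrow> 'a" and y
    using that by induction (auto intro: orbit.intros)
  then show ?thesis by blast
qed

lemma orbit_subset:
  assumes "matching_on C f" "matching_on C g" "x \<in> C"
  shows "orbit f g x \<subseteq> C"
  by (rule orbit_minimal) (use assms in \<open>auto simp: matching_on_def\<close>)

lemma orbit_eq:
  assumes f: "matching_on C f" and g: "matching_on C g" and x: "x \<in> C" and y: "y \<in> orbit f g x"
  shows "orbit f g y = orbit f g x"
proof
  show "orbit f g y \<subseteq> orbit f g x" by (rule orbit_minimal) (use y in \<open>auto intro: orbit.intros\<close>)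
  have "x \<in> orbit f g y" using y
  proof induction
    case (orbit_left y)
    then have "y \<in> C" using orbit_subset[OF f g x] by blast
    then have "y \<in> orbit f g (f y)"
      using matching_onD(3)[OF f] orbit.orbit_left[OF orbit_refl[of "f y" f g]] by auto
    then have "orbit f g y \<subseteq> orbit f g (f y)" by (rule orbit_minimal) (auto intro: orbit.intros)
    then show ?case using orbit_left by blast
  next
    case (orbit_right y)
    then have "y \<in> C" using orbit_subset[OF f g x] by blast
    then have "y \<in> orbit f g (g y)"
      using matching_onD(3)[OF g] orbit.orbit_right[OF orbit_refl[of "g y" f g]] by auto
    then have "orbit f g y \<subseteq> orbit f g (g y)" by (rule orbit_minimal) (auto intro: orbit.intros)
    then show ?case using orbit_right by blast
  qed (rule orbit_refl)
  then show "orbit f g x \<subseteq> orbit f g y" by (rule orbit_minimal) (auto intro: orbit.intros)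
qed

lemma orbit_step_eq:
  assumes "matching_on C f" "matching_on C g" "x \<in> C"
  shows "orbit f g (f x) = orbit f g x" "orbit f g (g x) = orbit f g x"
  using orbit_eq[OF assms] by (auto intro: orbit.intros)

lemma mem_orbits_eq:
  assumes "matching_on C f" "matching_on C g" "u \<in> orbit f g ` C" "x \<in> u"
  shows "orbit f g x = u"
proof -
  obtain y where "y \<in> C" "u = orbit f g y" using assms(3) by blast
  then show ?thesis using orbit_eq[OF assms(1,2)] assms(4) by blast
qed

lemma orbits_disjoint:
  assumes "matching_on C f" "matching_on C g" "u \<in> orbit f g ` C" "w \<in> orbit f g ` C" "u \<noteq> w"
  shows "u \<inter> w = {}"
  using mem_orbits_eq[OF assms(1,2,3)] mem_orbits_eq[OF assms(1,2,4)] assms(5) by blast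

lemma orbits_closed:
  assumes "u \<in> orbit f g ` C" "x \<in> u"
  shows "f x \<in> u" "g x \<in> u"
  using assms by (auto intro: orbit.intros)

section \<open>Cuts of the medial graph\<close>

text \<open>
  A set of edges is encoded by the set of its corners, and a set of gaps by one end of each, chosen
  from a fixed half of the corners.
\<close>

definition edge_closed :: "'a set \<Rightarrow> ('a \<Rightarrow> 'a) \<Rightarrow> ('a \<Rightarrow> 'a) \<Rightarrow> 'a set \<Rightarrow> bool" where
  "edge_closed C s t S \<longleftrightarrow> S \<subseteq> C \<and> (\<forall>x\<in>S. s x \<in> S \<and> t x \<in> S)"

text \<open>Connectedness in terms of closed sets. It is symmetric in \<open>s\<close> and
  \<open>t\<close>, so partial duality, which only exchanges these two on some edges, visibly
  preserves it.\<close>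

definition transitive_on :: "'a set \<Rightarrow> ('a \<Rightarrow> 'a) \<Rightarrow> ('a \<Rightarrow> 'a) \<Rightarrow> ('a \<Rightarrow> 'a) \<Rightarrow> bool" where
  "transitive_on C s t g \<longleftrightarrow>
     (\<forall>U\<subseteq>C. U \<noteq> {} \<longrightarrow> (\<forall>x\<in>U. s x \<in> U \<and> t x \<in> U \<and> g x \<in> U) \<longrightarrow> U = C)"

lemma transitive_onD:
  assumes "transitive_on C s t g" "U \<subseteq> C" "x \<in> U"
    and "\<And>x. x \<in> U \<Longrightarrow> s x \<in> U \<and> t x \<in> U \<and> g x \<in> U"
  shows "U = C"
proof -
  have "U \<noteq> {}" using assms(3) by blast
  then show ?thesis using assms(1,2,4) unfolding transitive_on_def by simp
qed

definition half_of :: "'a set \<Rightarrow> ('a \<Rightarrow> 'a) \<Rightarrow> 'a set \<Rightarrow> bool" where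
  "half_of C g R \<longleftrightarrow> R \<subseteq> C \<and> (\<forall>x\<in>C. x \<in> R \<longleftrightarrow> g x \<notin> R)"

definition cut :: "('a \<Rightarrow> 'a) \<Rightarrow> 'a set \<Rightarrow> 'a set \<Rightarrow> 'a set" where
  "cut g R S = {x\<in>R. x \<in> S \<longleftrightarrow> g x \<notin> S}"

text \<open>A leaving gap is counted by its end in \<open>S\<close>, so that no half of the corners
  has to be fixed; by \<open>card_cut\<close> the count agrees with the size of \<open>cut\<close>
  for every half.\<close>

definition two_cut :: "'a set \<Rightarrow> ('a \<Rightarrow> 'a) \<Rightarrow> ('a \<Rightarrow> 'a) \<Rightarrow> ('a \<Rightarrow> 'a) \<Rightarrow> 'a set \<Rightarrow> bool" where
  "two_cut C s t g S \<longleftrightarrow> edge_closed C s t S \<and> card {x\<in>S. g x \<notin> S} = 2"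

inductive_set two_cut_span :: "'a set \<Rightarrow> ('a \<Rightarrow> 'a) \<Rightarrow> ('a \<Rightarrow> 'a) \<Rightarrow> ('a \<Rightarrow> 'a) \<Rightarrow> 'a set set"
  for C s t g where
  span_empty: "{} \<in> two_cut_span C s t g"
| span_add: "S \<in> two_cut_span C s t g \<Longrightarrow> two_cut C s t g T \<Longrightarrow>
    sym_diff S T \<in> two_cut_span C s t g"

lemma edge_closed_iff:
  assumes "matching_on C s" "matching_on C t" "edge_closed C s t S" "x \<in> C"
  shows "s x \<in> S \<longleftrightarrow> x \<in> S" "t x \<in> S \<longleftrightarrow> x \<in> S"
  using assms matching_onD(3)[OF assms(1,4)] matching_onD(3)[OF assms(2,4)]
  unfolding edge_closed_def by metis+

lemma edge_closed_sym_diff: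
  assumes "matching_on C s" "matching_on C t" "edge_closed C s t S" "edge_closed C s t T"
  shows "edge_closed C s t (sym_diff S T)"
proof -
  have "sym_diff S T \<subseteq> C" using assms(3,4) by (auto simp: edge_closed_def)
  moreover have "s x \<in> sym_diff S T \<and> t x \<in> sym_diff S T" if "x \<in> sym_diff S T" for x
  proof -
    have "x \<in> C" using that calculation by blast
    then show ?thesis
      using that edge_closed_iff[OF assms(1-3)] edge_closed_iff[OF assms(1,2,4)] by simp
  qed
  ultimately show ?thesis by (simp add: edge_closed_def)
qed

lemma two_cut_span_closed:
  assumes "matching_on C s" "matching_on C t" "S \<in> two_cut_span C s t g"
  shows "edge_closed C s t S"
  using assms(3)
proof induction
  case (span_add S T)
  then show ?case using edge_closed_sym_diff[OF assms(1,2)] by (simp add: two_cut_def)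
qed (simp add: edge_closed_def)

lemma cut_sym_diff:
  "cut g R (sym_diff S T) = sym_diff (cut g R S) (cut g R T)"
  by (auto simp: cut_def)

text \<open>Orbits of \<open>s, t\<close> are edges, orbits of \<open>s, g\<close> vertices and
  orbits of \<open>t, g\<close> boundary components. The carrier and the functions are kept abstract
  because the results are instantiated with the graph, with its partial duals and with the double
  cover.\<close>

locale medial =
  fixes C :: "'a set" and s t g :: "'a \<Rightarrow> 'a"
  assumes fin: "finite C"
    and ms: "matching_on C s" and mt: "matching_on C t" and mg: "matching_on C g"
    and st: "\<And>x. x \<in> C \<Longrightarrow> s (t x) = t (s x)"
    and s_neq_t: "\<And>x. x \<in> C \<Longrightarrow> s x \<noteq> t x"
begin

lemmas sD = matching_onD[OF ms] and tD = matching_onD[OF mt] and gD = matching_onD[OF mg]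

lemma edge_orbit:
  assumes "x \<in> C"
  shows "orbit s t x = {x, s x, t x, s (t x)}"
proof
  show "orbit s t x \<subseteq> {x, s x, t x, s (t x)}"
    by (rule orbit_minimal) (use assms sD tD st in auto)
qed (auto intro: orbit.intros)

lemma card_edge_orbit:
  assumes "x \<in> C"
  shows "card (orbit s t x) = 4"
proof -
  have "s (t x) \<noteq> x" using assms sD tD s_neq_t by metis
  moreover have "s (t x) \<noteq> s x" using assms sD tD by metis
  moreover have "s (t x) \<noteq> t x" using assms sD tD by metis
  ultimately have "distinct [x, s x, t x, s (t x)]"
    using assms sD(2)[of x] tD(2)[of x] s_neq_t[of x] by auto
  from distinct_card[OF this] show ?thesis using edge_orbit[OF assms] by simp
qed

lemma card_corners: "card C = 4 * card (orbit s t ` C)"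
proof -
  have U: "\<Union>(orbit s t ` C) = C" using orbit_subset[OF ms mt] by (auto intro: orbit_refl)
  have "4 * card (orbit s t ` C) = card (\<Union>(orbit s t ` C))"
    by (rule card_partition)
      (use fin U card_edge_orbit orbits_disjoint[OF ms mt] in auto)
  then show ?thesis using U by simp
qed

lemma card_half_of:
  assumes "half_of C g R"
  shows "card R = 2 * card (orbit s t ` C)"
proof -
  have "bij_betw g R (C - R)"
    by (rule bij_betw_byWitness[where f' = g])
      (use assms gD in \<open>auto simp: half_of_def\<close>)
  then have "card R = card (C - R)" by (rule bij_betw_same_card)
  also have "card (C - R) = card C - card R"
    using assms fin by (intro card_Diff_subset) (auto simp: half_of_def intro: finite_subset)
  finally have "card C = 2 * card R"
    using card_mono[OF fin, of R] assms by (auto simp: half_of_def)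
  then show ?thesis using card_corners by simp
qed

text \<open>A gap crosses \<open>S\<close> iff exactly one of its ends is in \<open>S\<close>, so
  modulo 2 the crossing gaps in \<open>Y\<close> are as many as the corners in \<open>S\<close> and
  \<open>Y\<close>, and \<open>m\<close> pairs these up. With \<open>m = s\<close> this handles
  vertices, with \<open>m = t\<close> boundary components.\<close>

lemma even_card_cut_Int:
  assumes R: "half_of C g R" and Y: "Y \<subseteq> C" "\<And>x. x \<in> Y \<Longrightarrow> g x \<in> Y"
    and m: "matching_on C m" "\<And>x. x \<in> S \<inter> Y \<Longrightarrow> m x \<in> S \<inter> Y"
  shows "even (card (cut g R S \<inter> Y))"
proof -
  let ?A = "R \<inter> Y \<inter> S" and ?B = "{x\<in>R \<inter> Y. g x \<in> S}" and ?B' = "(C - R) \<inter> Y \<inter> S"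
  have fY: "finite Y" using Y fin finite_subset by blast
  have f: "finite ?A" "finite ?B" "finite ?B'" using fY by auto
  have "bij_betw g ?B ?B'"
    by (rule bij_betw_byWitness[where f' = g])
      (use R gD Y in \<open>auto simp: half_of_def\<close>)
  then have "card ?B = card ?B'" by (rule bij_betw_same_card)
  moreover have "cut g R S \<inter> Y = sym_diff ?A ?B" by (auto simp: cut_def)
  ultimately have "even (card (cut g R S \<inter> Y)) \<longleftrightarrow> even (card ?A + card ?B')"
    using even_card_sym_diff[OF f(1,2)] by simp
  also have "card ?A + card ?B' = card (?A \<union> ?B')"
    using f by (intro card_Un_disjoint[symmetric]) auto
  also have "?A \<union> ?B' = S \<inter> Y" using Y R by (auto simp: half_of_def)
  also have "even (card (S \<inter> Y))"
    by (rule even_card_matching_on[of _ m])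
      (use fY Y in \<open>auto intro!: matching_on_subset[OF m(1)] m(2)\<close>)
  finally show ?thesis .
qed

lemma cut_empty_iff:
  assumes tr: "transitive_on C s t g" and R: "half_of C g R" and S: "edge_closed C s t S"
    and c: "cut g R S = {}"
  shows "S = {} \<or> S = C"
proof -
  have "g x \<in> S" if "x \<in> S" for x
  proof -
    have x: "x \<in> C" using that S by (auto simp: edge_closed_def)
    show ?thesis
    proof (cases "x \<in> R")
      case True
      then show ?thesis using c that by (auto simp: cut_def)
    next
      case False
      then have "g x \<in> R" using R x by (auto simp: half_of_def)
      then show ?thesis using c that gD(3)[OF x] by (auto simp: cut_def)
    qed
  qed
  then have "S = C" if "x \<in> S" for x
    using transitive_onD[OF tr _ that] S unfolding edge_closed_def by simp
  then show ?thesis by blast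
qed

lemma cut_eq_iff:
  assumes tr: "transitive_on C s t g" and R: "half_of C g R"
    and S: "edge_closed C s t S" and T: "edge_closed C s t T"
    and c: "cut g R S = cut g R T"
  shows "T = S \<or> T = C - S"
proof -
  have "edge_closed C s t (sym_diff S T)" by (rule edge_closed_sym_diff[OF ms mt S T])
  moreover have "cut g R (sym_diff S T) = {}" by (simp add: cut_sym_diff c)
  ultimately have "sym_diff S T = {} \<or> sym_diff S T = C" using cut_empty_iff[OF tr R] by blast
  then show ?thesis using S T unfolding edge_closed_def by blast
qed

text \<open>Write \<open>V\<close>, \<open>F\<close>, \<open>E\<close> for the numbers of orbits of
  \<open>s, g\<close>, of \<open>t, g\<close> and of \<open>s, t\<close>. By connectivity there are
  \<open>2^(E-1)\<close> cuts. On the \<open>2E\<close> gaps, \<open>V+F-1\<close> of the parity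
  conditions are independent, which leaves \<open>2^(2E-V-F+1)\<close> even sets. Cuts are even
  sets, so the exponents compare, which is the inequality; if they agree, every even set is a
  cut.\<close>

lemma cut_criterion:
  assumes tr: "transitive_on C s t g" and ne: "C \<noteq> {}" and R: "half_of C g R"
  shows "card (orbit s g ` C) + card (orbit t g ` C) \<le> card (orbit s t ` C) + 2" (is ?le)
    and "card (orbit s g ` C) + card (orbit t g ` C) = card (orbit s t ` C) + 2 \<Longrightarrow> X \<subseteq> R \<Longrightarrow>
      (\<And>u. u \<in> orbit s g ` C \<Longrightarrow> even (card (X \<inter> u))) \<Longrightarrow>
      (\<And>u. u \<in> orbit t g ` C \<Longrightarrow> even (card (X \<inter> u))) \<Longrightarrow>
      \<exists>S. edge_closed C s t S \<and> cut g R S = X"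
proof -
  define V where "V = orbit s g ` C"
  define F where "F = orbit t g ` C"
  define E where "E = orbit s t ` C"
  note VFE = V_def[symmetric] F_def[symmetric] E_def[symmetric]
  have fV: "finite V" "finite F" "finite E" using fin by (auto simp: V_def F_def E_def)
  have mem: "orbit s g x \<in> V" "orbit t g x \<in> F" "orbit s t x \<in> E" if "x \<in> C" for x
    using that by (auto simp: V_def F_def E_def)
  obtain x0 where x0: "x0 \<in> C" using ne by blast
  define v0 where "v0 = orbit s g x0"
  define e0 where "e0 = orbit s t x0"
  have RC: "R \<subseteq> C" and fR: "finite R" using R fin finite_subset by (auto simp: half_of_def)
  \<comment> \<open>\<open>U\<close> and \<open>W\<close> are the vertices and boundary components
    that \<open>X\<close> meets oddly; \<open>I\<close> tells which parity vectors
    \<open>(U, W)\<close> occur.\<close>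
  define par where "par X U W \<longleftrightarrow> X \<subseteq> R \<and> (\<forall>u\<in>V. odd (card (X \<inter> u)) \<longleftrightarrow> u \<in> U) \<and>
      (\<forall>u\<in>F. odd (card (X \<inter> u)) \<longleftrightarrow> u \<in> W)" for X U W
  define I where "I U W \<longleftrightarrow> (\<exists>X. par X U W)" for U W
  have I_add: "I (sym_diff U U') (sym_diff W W')" if UW: "I U W" "I U' W'" for U W U' W'
  proof -
    obtain X where X: "par X U W" using UW(1) unfolding I_def by blast
    obtain X' where X': "par X' U' W'" using UW(2) unfolding I_def by blast
    have "finite X" "finite X'" using X X' fR finite_subset unfolding par_def by auto
    note o = odd_card_sym_diff_Int[OF this]
    have "odd (card (sym_diff X X' \<inter> u)) \<longleftrightarrow> u \<in> sym_diff U U'" if "u \<in> V" for u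
    proof -
      have "odd (card (X \<inter> u)) \<longleftrightarrow> u \<in> U" "odd (card (X' \<inter> u)) \<longleftrightarrow> u \<in> U'"
        using X X' that by (simp_all add: par_def)
      then show ?thesis unfolding o by blast
    qed
    moreover have "odd (card (sym_diff X X' \<inter> u)) \<longleftrightarrow> u \<in> sym_diff W W'" if "u \<in> F" for u
    proof -
      have "odd (card (X \<inter> u)) \<longleftrightarrow> u \<in> W" "odd (card (X' \<inter> u)) \<longleftrightarrow> u \<in> W'"
        using X X' that by (simp_all add: par_def)
      then show ?thesis unfolding o by blast
    qed
    moreover have "sym_diff X X' \<subseteq> R" using X X' by (auto simp: par_def)
    ultimately have "par (sym_diff X X') (sym_diff U U') (sym_diff W W')"
      unfolding par_def by (intro conjI ballI)
    then show ?thesis unfolding I_def by blast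
  qed
  \<comment> \<open>A single gap lies on one vertex and one boundary component.\<close>
  have I_corner: "I {orbit s g x} {orbit t g x}" if x: "x \<in> C" for x
  proof -
    define y where "y = (if x \<in> R then x else g x)"
    have y: "y \<in> R" "y \<in> orbit s g x" "y \<in> orbit t g x"
      using R x by (auto simp: y_def half_of_def intro: orbit.intros)
    have iff: "y \<in> u \<longleftrightarrow> u = orbit s g x" if "u \<in> V" for u
      using mem_orbits_eq[OF ms mg that[unfolded V_def], of y] orbit_eq[OF ms mg x y(2)] y(2) by auto
    have iff': "y \<in> u \<longleftrightarrow> u = orbit t g x" if "u \<in> F" for u
      using mem_orbits_eq[OF mt mg that[unfolded F_def], of y] orbit_eq[OF mt mg x y(3)] y(3) by auto
    have c: "odd (card ({y} \<inter> u)) \<longleftrightarrow> y \<in> u" for u by (cases "y \<in> u") auto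
    have "par {y} {orbit s g x} {orbit t g x}"
      unfolding par_def c using y(1) iff iff' by simp
    then show ?thesis unfolding I_def by blast
  qed
  \<comment> \<open>Connectivity enters here. Steps along \<open>s\<close> and \<open>g\<close> stay
    on the vertex. A step along \<open>t\<close> may change the vertex but keeps the boundary
    component, which cancels when the vectors of the gaps at \<open>x\<close> and \<open>t x\<close>
    are added.\<close>
  define U where "U = {x\<in>C. I (sym_diff {orbit s g x} {v0}) {}}"
  have "U = C"
  proof -
    have "U \<subseteq> C" by (auto simp: U_def)
    moreover have "x0 \<in> U" using x0 unfolding U_def v0_def I_def par_def by (auto intro: exI[of _ "{}"])
    moreover have "s x \<in> U \<and> t x \<in> U \<and> g x \<in> U" if "x \<in> U" for x
    proof -
      have x: "x \<in> C" and Ix: "I (sym_diff {orbit s g x} {v0}) {}" using that by (auto simp: U_def)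
      have "I (sym_diff {orbit s g (t x)} {orbit s g x}) {}"
        using I_add[OF I_corner[of "t x"] I_corner[OF x]] tD(1)[OF x] orbit_step_eq(1)[OF mt mg x]
        by simp
      from I_add[OF this Ix] have "I (sym_diff (sym_diff {orbit s g (t x)} {orbit s g x})
         (sym_diff {orbit s g x} {v0})) {}" by simp
      moreover have "sym_diff (sym_diff {orbit s g (t x)} {orbit s g x})
         (sym_diff {orbit s g x} {v0}) = sym_diff {orbit s g (t x)} {v0}" by blast
      ultimately have "t x \<in> U" using tD(1)[OF x] by (simp add: U_def)
      then show ?thesis using x Ix sD(1) gD(1) orbit_step_eq[OF ms mg x] by (simp add: U_def)
    qed
    ultimately show ?thesis using transitive_onD[OF tr] by blast
  qed
  then have Iv: "I (sym_diff {orbit s g x} {v0}) {}" if "x \<in> C" for x using that by (auto simp: U_def)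
  have If: "I {v0} {orbit t g x}" if "x \<in> C" for x
  proof -
    have "sym_diff {orbit s g x} (sym_diff {orbit s g x} {v0}) = {v0}" by blast
    then show ?thesis using I_add[OF I_corner[OF that] Iv[OF that]] by simp
  qed
  \<comment> \<open>Every gap lies on exactly one vertex and one boundary component, so the parities
    over all of them add up to zero. Omitting \<open>v0\<close> removes this dependency.\<close>
  define N where "N = Inl ` (V - {v0}) \<union> Inr ` F"
  define K where "K = case_sum (\<lambda>u::'a set. u) (\<lambda>u. u)"
  have cN: "card N = card V - 1 + card F"
  proof -
    have "card N = card (Inl ` (V - {v0}) :: ('a set + 'a set) set) + card (Inr ` F :: ('a set + 'a set) set)"
      unfolding N_def using fV by (intro card_Un_disjoint) auto
    then show ?thesis using mem[OF x0] fV by (simp add: card_image v0_def)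
  qed
  define Z where "Z = {X. X \<subseteq> R \<and> (\<forall>n\<in>N. even (card (X \<inter> K n)))}"
  have parN: "{m\<in>N. odd (card (X \<inter> K m))} = Inl ` ((V - {v0}) \<inter> U) \<union> Inr ` (F \<inter> W)"
    if "par X U W" for X U W
  proof -
    have v: "odd (card (X \<inter> u)) \<longleftrightarrow> u \<in> U" if "u \<in> V" for u
      using \<open>par X U W\<close> that unfolding par_def by blast
    have f: "odd (card (X \<inter> u)) \<longleftrightarrow> u \<in> W" if "u \<in> F" for u
      using \<open>par X U W\<close> that unfolding par_def by blast
    show ?thesis
    proof (rule set_eqI)
      fix m show "m \<in> {m\<in>N. odd (card (X \<inter> K m))} \<longleftrightarrow> m \<in> Inl ` ((V - {v0}) \<inter> U) \<union> Inr ` (F \<inter> W)"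
        using v f by (cases m) (auto simp: N_def K_def)
    qed
  qed
  have cZ: "card Z * 2 ^ card N = 2 ^ card R"
    unfolding Z_def
  proof (rule card_even_sets[OF fR])
    show "finite N" unfolding N_def using fV by auto
    fix n assume "n \<in> N"
    then consider u where "n = Inl u" "u \<in> V" "u \<noteq> v0" | u where "n = Inr u" "u \<in> F"
      by (auto simp: N_def)
    then show "\<exists>X\<subseteq>R. {m\<in>N. odd (card (X \<inter> K m))} = {n}"
    proof cases
      case 1
      then obtain x where "x \<in> C" "u = orbit s g x" by (auto simp: V_def)
      then obtain X where X: "par X (sym_diff {u} {v0}) {}" using Iv[of x] unfolding I_def by blast
      have "(V - {v0}) \<inter> sym_diff {u} {v0} = {u}" using 1 by blast
      then have "{m\<in>N. odd (card (X \<inter> K m))} = {n}" using parN[OF X] 1(1) by simp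
      moreover have "X \<subseteq> R" using X by (simp add: par_def)
      ultimately show ?thesis by blast
    next
      case 2
      then obtain x where "x \<in> C" "u = orbit t g x" by (auto simp: F_def)
      then obtain X where X: "par X {v0} {u}" using If[of x] unfolding I_def by blast
      have "(V - {v0}) \<inter> {v0} = {}" "F \<inter> {u} = {u}" using 2 by blast+
      then have "{m\<in>N. odd (card (X \<inter> K m))} = {n}" using parN[OF X] 2(1) by simp
      moreover have "X \<subseteq> R" using X by (simp add: par_def)
      ultimately show ?thesis by blast
    qed
  qed
  \<comment> \<open>Complementary sides have the same cut; requiring \<open>e0\<close> to be absent
    selects one side of each complementary pair.\<close>
  define B where "B = (\<lambda>T. cut g R (\<Union>T)) ` Pow (E - {e0})"
  have closed: "edge_closed C s t (\<Union>T)" if "T \<subseteq> E" for T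
  proof -
    have "u \<subseteq> C \<and> (\<forall>x\<in>u. s x \<in> u \<and> t x \<in> u)" if "u \<in> E" for u
      using that orbits_closed[of u s t C] orbit_subset[OF ms mt] unfolding E_def by blast
    then show ?thesis using that unfolding edge_closed_def by blast
  qed
  have inj: "inj_on (\<lambda>T. cut g R (\<Union>T)) (Pow (E - {e0}))"
  proof (rule inj_onI)
    fix T T' assume T: "T \<in> Pow (E - {e0})" "T' \<in> Pow (E - {e0})"
      and c: "cut g R (\<Union>T) = cut g R (\<Union>T')"
    have x0T: "x0 \<notin> \<Union>T" if T: "T \<in> Pow (E - {e0})" for T
    proof
      assume "x0 \<in> \<Union>T"
      then obtain u where u: "u \<in> T" "x0 \<in> u" by blast
      then have "u \<in> orbit s t ` C" using T E_def by blast
      then have "u = e0" using mem_orbits_eq[OF ms mt _ u(2)] by (simp add: e0_def)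
      then show False using T u by blast
    qed
    have eq: "T = {u\<in>E. u \<inter> \<Union>T \<noteq> {}}" if T: "T \<subseteq> E" for T
    proof -
      have a: "u \<noteq> {}" if u: "u \<in> E" for u
      proof -
        obtain x where "u = orbit s t x" using u by (auto simp: E_def)
        then show ?thesis using orbit_refl[of x s t] by blast
      qed
      have b: "u = w" if "u \<in> E" "w \<in> E" "u \<inter> w \<noteq> {}" for u w
        using orbits_disjoint[OF ms mt, of u w] that by (simp only: E_def) blast
      show ?thesis
      proof (intro subset_antisym subsetI)
        fix u assume "u \<in> T" then show "u \<in> {u\<in>E. u \<inter> \<Union>T \<noteq> {}}" using a T by blast
      next
        fix u assume "u \<in> {u\<in>E. u \<inter> \<Union>T \<noteq> {}}"
        then obtain w where "u \<in> E" "w \<in> T" "u \<inter> w \<noteq> {}" by blast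
        then show "u \<in> T" using b[of u w] T by blast
      qed
    qed
    have TE: "T \<subseteq> E" "T' \<subseteq> E" using T by auto
    have "\<Union>T' = \<Union>T \<or> \<Union>T' = C - \<Union>T"
      by (rule cut_eq_iff[OF tr R closed[OF TE(1)] closed[OF TE(2)] c])
    moreover have "\<Union>T' \<noteq> C - \<Union>T" using x0T[OF T(1)] x0T[OF T(2)] x0 by blast
    ultimately have "\<Union>T' = \<Union>T" by simp
    moreover note TE
    ultimately show "T = T'" using eq[of T] eq[of T'] by simp
  qed
  have BZ: "B \<subseteq> Z"
  proof
    fix X assume "X \<in> B"
    then obtain T where T: "T \<subseteq> E" and X: "X = cut g R (\<Union>T)" by (auto simp: B_def)
    have "even (card (X \<inter> u))" if u: "u \<in> V" for u
      unfolding X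
    proof (rule even_card_cut_Int[OF R _ _ ms])
      show "u \<subseteq> C" using u orbit_subset[OF ms mg] unfolding V_def by blast
      show "g x \<in> u" if "x \<in> u" for x using orbits_closed(2)[OF u[unfolded V_def] that] .
      show "s x \<in> \<Union>T \<inter> u" if "x \<in> \<Union>T \<inter> u" for x
        using that orbits_closed(1)[OF u[unfolded V_def]] closed[OF T] unfolding edge_closed_def by blast
    qed
    moreover have "even (card (X \<inter> u))" if u: "u \<in> F" for u
      unfolding X
    proof (rule even_card_cut_Int[OF R _ _ mt])
      show "u \<subseteq> C" using u orbit_subset[OF mt mg] unfolding F_def by blast
      show "g x \<in> u" if "x \<in> u" for x using orbits_closed(2)[OF u[unfolded F_def] that] .
      show "t x \<in> \<Union>T \<inter> u" if "x \<in> \<Union>T \<inter> u" for x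
        using that orbits_closed(1)[OF u[unfolded F_def]] closed[OF T] unfolding edge_closed_def by blast
    qed
    moreover have "X \<subseteq> R" by (auto simp: X cut_def)
    ultimately show "X \<in> Z" by (auto simp: Z_def N_def K_def)
  qed
  have fZ: "finite Z" unfolding Z_def using fR by (auto intro: finite_subset[of _ "Pow R"])
  have cB: "card B = 2 ^ (card E - 1)"
    unfolding B_def card_image[OF inj] using fV mem[OF x0] by (simp add: card_Pow e0_def)
  have pos: "card E > 0" "card V > 0" using mem[OF x0] fV by (auto simp: card_gt_0_iff)
  have cR: "card R = 2 * card E" unfolding E_def by (rule card_half_of[OF R])
  have "(2::nat) ^ (card E - 1 + card N) \<le> 2 ^ (2 * card E)"
    using card_mono[OF fZ BZ] cZ cB cR by (metis mult_le_mono1 power_add)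
  then have "card E - 1 + card N \<le> 2 * card E" by (rule power_le_imp_le_exp[rotated]) simp
  then show ?le unfolding VFE using cN pos by linarith
  assume "card (orbit s g ` C) + card (orbit t g ` C) = card (orbit s t ` C) + 2"
  then have "card V + card F = card E + 2" by (simp add: VFE)
  then have "card N = card E + 1" using cN pos by linarith
  then have "card Z * 2 ^ (card E + 1) = 2 ^ ((card E - 1) + (card E + 1))"
    using cZ cR pos by (simp add: mult_2)
  \<comment> \<open>Euler's formula makes the two exponents equal, so the inclusion
    \<open>BZ\<close> is an equality.\<close>
  then have "card Z = card B" unfolding cB power_add[of 2 "card E - 1"] by simp
  then have BZ: "B = Z" using card_subset_eq[OF fZ BZ] by simp
  assume X: "X \<subseteq> R" and "\<And>u. u \<in> orbit s g ` C \<Longrightarrow> even (card (X \<inter> u))"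
    "\<And>u. u \<in> orbit t g ` C \<Longrightarrow> even (card (X \<inter> u))"
  then have "X \<in> B" unfolding BZ by (auto simp: Z_def N_def K_def VFE)
  then show "\<exists>S. edge_closed C s t S \<and> cut g R S = X" using closed unfolding B_def by blast
qed

end

section \<open>Parity of the Euler characteristic\<close>

text \<open>With both generators equal, \<open>orbit p p x\<close> is the forward orbit. It is
  finite and mapped injectively into itself, hence onto itself, so it is a whole cycle of
  \<open>p\<close>.\<close>

lemma permutes_orbit_back:
  assumes p: "p permutes B" "finite B" and x: "x \<in> B" and y: "p y \<in> orbit p p x"
  shows "y \<in> orbit p p x"
proof -
  have sub: "orbit p p x \<subseteq> B"
    by (rule orbit_minimal) (use x permutes_in_image[OF p(1)] in auto)
  have inj: "inj p" using permutes_inj[OF p(1)] .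
  have "p ` orbit p p x = orbit p p x"
    by (rule card_subset_eq)
      (use sub p(2) finite_subset card_image[OF inj_on_subset[OF inj]] in \<open>auto intro: orbit.intros\<close>)
  then obtain z where "z \<in> orbit p p x" "p y = p z" using y by (metis imageE)
  then show ?thesis using injD[OF inj] by metis
qed

lemma permutes_orbit_eq:
  assumes p: "p permutes B" "finite B" and x: "x \<in> B" and y: "y \<in> orbit p p x"
  shows "orbit p p y = orbit p p x"
proof
  show "orbit p p y \<subseteq> orbit p p x" by (rule orbit_minimal) (use y in \<open>auto intro: orbit.intros\<close>)
  have "y \<in> B \<and> x \<in> orbit p p y" if "y \<in> orbit p p x" for y
    using that
  proof induction
    case (orbit_left y)
    then have y: "p y \<in> B" using permutes_in_image[OF p(1)] by simp
    have "y \<in> orbit p p (p y)" by (rule permutes_orbit_back[OF p y orbit_refl])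
    then have "orbit p p y \<subseteq> orbit p p (p y)" by (rule orbit_minimal) (auto intro: orbit.intros)
    then show ?case using orbit_left y by blast
  next
    case (orbit_right y)
    then have y: "p y \<in> B" using permutes_in_image[OF p(1)] by simp
    have "y \<in> orbit p p (p y)" by (rule permutes_orbit_back[OF p y orbit_refl])
    then have "orbit p p y \<subseteq> orbit p p (p y)" by (rule orbit_minimal) (auto intro: orbit.intros)
    then show ?case using orbit_right y by blast
  qed (use x orbit_refl in auto)
  then have "x \<in> orbit p p y" using y by blast
  then show "orbit p p x \<subseteq> orbit p p y" by (rule orbit_minimal) (auto intro: orbit.intros)
qed

text \<open>Points are removed one at a time. A fixed point takes its own orbit with it. A moved
  point \<open>a\<close> is cut out of its cycle by composing with the transposition of
  \<open>a\<close> and \<open>p a\<close>: this flips the sign and keeps the number of cycles on the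
  remaining points.\<close>

lemma evenperm_iff_even_orbits:
  assumes "finite B" "p permutes B"
  shows "evenperm p \<longleftrightarrow> even (card B + card (orbit p p ` B))"
  using assms
proof (induction B arbitrary: p rule: finite_induct)
  case empty
  then show ?case by (simp add: permutes_empty)
next
  case (insert a B)
  note p = insert.prems
  have fin: "finite (insert a B)" using insert by simp
  show ?case
  proof (cases "p a = a")
    case True
    have pB: "p permutes B"
      by (rule permutes_superset[OF p]) (use True in auto)
    have a: "orbit p p a = {a}"
      using orbit_minimal[of a "{a}" p p] orbit_refl[of a p p] True by auto
    have "orbit p p x \<subseteq> B" if "x \<in> B" for x
      by (rule orbit_minimal) (use that permutes_in_image[OF pB] in auto)
    then have "{a} \<notin> orbit p p ` B" using insert.hyps(2) by blast
    then have "card (orbit p p ` insert a B) = card (orbit p p ` B) + 1"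
      using insert.hyps(1) by (simp add: a)
    then show ?thesis using insert.IH[OF pB] insert.hyps by simp
  next
    case False
    define q where "q = transpose a (p a) \<circ> p"
    have pa: "p a \<in> B" using permutes_in_image[OF p, of a] False by auto
    have inj: "inj p" using permutes_inj[OF p] .
    have q: "q x = (if p x = a then p a else p x)" if "x \<noteq> a" for x
      using injD[OF inj, of x a] that by (auto simp: q_def transpose_def)
    have qa: "q a = a" by (simp add: q_def)
    have "q permutes insert a B"
      unfolding q_def by (rule permutes_compose[OF p permutes_swap_id]) (use pa in auto)
    then have qB: "q permutes B"
      by (rule permutes_superset) (use qa in auto)
    have qp: "evenperm q \<longleftrightarrow> \<not> evenperm p"
      unfolding q_def
      by (subst evenperm_comp)
        (use p fin False in \<open>auto simp: permutation_swap_id evenperm_swap intro: permutes_imp_permutation\<close>)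
    have step: "q x \<in> orbit p p x" if "x \<noteq> a" for x
    proof -
      have "p x \<in> orbit p p x" by (intro orbit.intros)
      moreover from this have "p (p x) \<in> orbit p p x" by (rule orbit.orbit_left)
      ultimately show ?thesis using q[OF that] by auto
    qed
    have orb: "orbit q q x = orbit p p x \<inter> B" if x: "x \<in> B" for x
    proof
      have "y \<in> orbit p p x \<inter> B" if "y \<in> orbit q q x" for y
        using that
      proof induction
        case (orbit_left y)
        then have y: "y \<in> B" "y \<in> orbit p p x" "y \<noteq> a" using insert.hyps by auto
        then show ?case using step[OF y(3)] permutes_orbit_eq[OF p fin _ y(2)] x
            permutes_in_image[OF qB] by auto
      next
        case (orbit_right y)
        then have y: "y \<in> B" "y \<in> orbit p p x" "y \<noteq> a" using insert.hyps by auto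
        then show ?case using step[OF y(3)] permutes_orbit_eq[OF p fin _ y(2)] x
            permutes_in_image[OF qB] by auto
      qed (use x orbit_refl in auto)
      then show "orbit q q x \<subseteq> orbit p p x \<inter> B" by blast
      \<comment> \<open>\<open>q\<close> jumps over \<open>a\<close>, so a visit of the
        \<open>p\<close>-orbit to \<open>a\<close> is represented by the next point
        \<open>p a\<close>.\<close>
      have next_q: "(p y = a \<longrightarrow> p a \<in> orbit q q x) \<and> (p y \<noteq> a \<longrightarrow> p y \<in> orbit q q x)"
        if y: "(y = a \<longrightarrow> p a \<in> orbit q q x) \<and> (y \<noteq> a \<longrightarrow> y \<in> orbit q q x)" for y
      proof (cases "y = a")
        case True
        then show ?thesis using y False by simp
      next
        case ya: False
        then have "q y \<in> orbit q q x" using y by (auto intro: orbit.intros)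
        then show ?thesis using q[OF ya] by auto
      qed
      have "(y = a \<longrightarrow> p a \<in> orbit q q x) \<and> (y \<noteq> a \<longrightarrow> y \<in> orbit q q x)" if "y \<in> orbit p p x" for y
        using that
      proof induction
        case orbit_refl
        show ?case using x insert.hyps orbit.orbit_refl by auto
      next
        case (orbit_left y) show ?case by (rule next_q[OF orbit_left(2)])
      next
        case (orbit_right y) show ?case by (rule next_q[OF orbit_right(2)])
      qed
      then show "orbit p p x \<inter> B \<subseteq> orbit q q x" using insert.hyps by blast
    qed
    have "orbit p p (p a) = orbit p p a"
      by (rule permutes_orbit_eq[OF p fin]) (auto intro: orbit.intros)
    then have im: "orbit p p ` insert a B = orbit p p ` B" using pa by auto
    have "bij_betw (\<lambda>U. U \<inter> B) (orbit p p ` B) (orbit q q ` B)"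
    proof (rule bij_betwI')
      fix X Y assume "X \<in> orbit p p ` B" "Y \<in> orbit p p ` B"
      then obtain x y where x: "x \<in> B" "X = orbit p p x" and y: "y \<in> B" "Y = orbit p p y" by blast
      show "X \<inter> B = Y \<inter> B \<longleftrightarrow> X = Y"
      proof
        assume "X \<inter> B = Y \<inter> B"
        then have "x \<in> orbit p p y" using x y orbit_refl[of x p p] by auto
        then show "X = Y" using permutes_orbit_eq[OF p fin, of y x] x y by simp
      qed simp
    next
      fix X assume "X \<in> orbit p p ` B" then show "X \<inter> B \<in> orbit q q ` B" using orb by auto
    next
      fix Y assume "Y \<in> orbit q q ` B" then show "\<exists>X\<in>orbit p p ` B. Y = X \<inter> B" using orb by auto
    qed
    then have "card (orbit p p ` B) = card (orbit q q ` B)" by (rule bij_betw_same_card)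
    then show ?thesis using insert.IH[OF qB] insert.hyps qp im by auto
  qed
qed

text \<open>Colours alternate along an orbit of two matchings, so their composition preserves
  colours, and the coloured half of each orbit is exactly one cycle of the composition. This turns
  numbers of orbits into cycle numbers of permutations.\<close>

lemma card_orbits_coloured:
  fixes c :: "'a \<Rightarrow> bool"
  assumes fin: "finite C" and p: "matching_on C p" and q: "matching_on C q"
    and cp: "\<And>x. x \<in> C \<Longrightarrow> c (p x) \<noteq> c x" and cq: "\<And>x. x \<in> C \<Longrightarrow> c (q x) \<noteq> c x"
  defines "B \<equiv> {x\<in>C. c x}" and "r \<equiv> \<lambda>x. if x \<in> C \<and> c x then p (q x) else x"
  shows "r permutes B" and "card (orbit p q ` C) = card (orbit r r ` B)"
proof -
  note pD = matching_onD[OF p] and qD = matching_onD[OF q]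
  have rB: "r x = p (q x)" if "x \<in> B" for x using that by (simp add: B_def r_def)
  have "bij_betw r B B"
  proof (rule bij_betw_byWitness[where f' = "\<lambda>x. q (p x)"])
    show "\<forall>a\<in>B. q (p (r a)) = a" using pD qD by (auto simp: rB) (auto simp: B_def)
    show "r ` B \<subseteq> B" using pD qD cp cq by (auto simp: rB) (auto simp: B_def)
    have *: "q (p a) \<in> B" if "a \<in> B" for a
      using pD qD cp[of a] cq[of "p a"] that by (auto simp: B_def)
    then show "(\<lambda>x. q (p x)) ` B \<subseteq> B" by auto
    show "\<forall>a'\<in>B. r (q (p a')) = a'" using pD qD * by (auto simp: rB) (auto simp: B_def)
  qed
  then show perm: "r permutes B"
    by (rule bij_imp_permutes) (auto simp: r_def B_def)
  have fB: "finite B" using fin by (simp add: B_def)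
  have orb: "orbit r r x = orbit p q x \<inter> B" if x: "x \<in> B" for x
  proof
    have "y \<in> orbit p q x \<inter> B" if "y \<in> orbit r r x" for y
      using that
    proof induction
      case (orbit_left y)
      then have "r y \<in> orbit p q x" using rB[of y] by (auto intro: orbit.intros)
      then show ?case using orbit_left permutes_in_image[OF perm] by simp
    next
      case (orbit_right y)
      then have "r y \<in> orbit p q x" using rB[of y] by (auto intro: orbit.intros)
      then show ?case using orbit_right permutes_in_image[OF perm] by simp
    qed (use x orbit_refl in auto)
    then show "orbit r r x \<subseteq> orbit p q x \<inter> B" by blast
    \<comment> \<open>\<open>r\<close> fixes the points of the other colour, so for these the
      invariant records both neighbours instead.\<close>
    have "y \<in> C \<and> (c y \<longrightarrow> y \<in> orbit r r x) \<and> (\<not> c y \<longrightarrow> q y \<in> orbit r r x \<and> p y \<in> orbit r r x)"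
      if "y \<in> orbit p q x" for y
      using that
    proof induction
      case orbit_refl
      then show ?case using x orbit.orbit_refl[of x r r] by (simp add: B_def)
    next
      case (orbit_left y)
      then have y: "y \<in> C" by simp
      have "q (p y) \<in> orbit r r x" if "c y"
      proof (rule permutes_orbit_back[OF perm fB x])
        have "q (p y) \<in> B" using y that cp[OF y] cq[of "p y"] pD qD by (simp add: B_def)
        then show "r (q (p y)) \<in> orbit r r x" using rB y that orbit_left pD qD by simp
      qed
      then show ?case using orbit_left y pD cp[OF y] by auto
    next
      case (orbit_right y)
      then have y: "y \<in> C" by simp
      have "p (q y) \<in> orbit r r x" if "c y"
      proof -
        have "y \<in> B" using y that by (simp add: B_def)
        then show ?thesis using orbit_right that rB[of y] orbit.orbit_left[of y r r x] by simp
      qed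
      then show ?case using orbit_right y qD cq[OF y] by auto
    qed
    then show "orbit p q x \<inter> B \<subseteq> orbit r r x" by (auto simp: B_def)
  qed
  have im: "orbit p q ` C = orbit p q ` B"
  proof
    show "orbit p q ` C \<subseteq> orbit p q ` B"
    proof (rule image_subsetI)
      fix x assume x: "x \<in> C"
      show "orbit p q x \<in> orbit p q ` B"
      proof (cases "c x")
        case True then show ?thesis using x by (auto simp: B_def)
      next
        case False
        then have "p x \<in> B" using x pD cp[OF x] by (simp add: B_def)
        then show ?thesis using orbit_step_eq(1)[OF p q x] by (metis imageI)
      qed
    qed
  qed (auto simp: B_def)
  have BC: "B \<subseteq> C" by (auto simp: B_def)
  have "bij_betw (\<lambda>U. U \<inter> B) (orbit p q ` B) (orbit r r ` B)"
  proof (rule bij_betwI')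
    fix X Y assume "X \<in> orbit p q ` B" "Y \<in> orbit p q ` B"
    then obtain x y where x: "x \<in> B" "X = orbit p q x" and y: "y \<in> B" "Y = orbit p q y" by blast
    show "X \<inter> B = Y \<inter> B \<longleftrightarrow> X = Y"
    proof
      assume "X \<inter> B = Y \<inter> B"
      then have "x \<in> orbit p q y" using x y orbit_refl[of x p q] by auto
      then show "X = Y" using orbit_eq[OF p q, of y x] x y BC by auto
    qed simp
  next
    fix X assume "X \<in> orbit p q ` B" then show "X \<inter> B \<in> orbit r r ` B" using orb by auto
  next
    fix Y assume "Y \<in> orbit r r ` B" then show "\<exists>X\<in>orbit p q ` B. Y = X \<inter> B" using orb by auto
  qed
  then show "card (orbit p q ` C) = card (orbit r r ` B)" unfolding im by (rule bij_betw_same_card)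
qed

text \<open>On one colour class, vertices, boundary components and edges are the cycles of
  \<open>g s\<close>, \<open>g t\<close> and \<open>s t\<close>, and \<open>g t = (g s)(s t)\<close>
  because \<open>s\<close> is an involution. Multiplicativity of the sign relates the parities of
  the three cycle numbers, and the class has even size.\<close>

lemma (in medial) even_euler_char_orientable:
  fixes c :: "'a \<Rightarrow> bool"
  assumes "\<And>x. x \<in> C \<Longrightarrow> c (s x) \<noteq> c x \<and> c (t x) \<noteq> c x \<and> c (g x) \<noteq> c x"
  shows "even (card (orbit s g ` C) + card (orbit t g ` C) + card (orbit s t ` C))"
proof -
  define B where "B = {x\<in>C. c x}"
  define r where "r p q = (\<lambda>x. if x \<in> C \<and> c x then p (q x) else x)" for p q :: "'a \<Rightarrow> 'a"
  have fB: "finite B" using fin by (simp add: B_def)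
  have V: "r g s permutes B" "card (orbit g s ` C) = card (orbit (r g s) (r g s) ` B)"
    unfolding B_def r_def by (rule card_orbits_coloured[OF fin mg ms]; use assms in blast)+
  have F: "r g t permutes B" "card (orbit g t ` C) = card (orbit (r g t) (r g t) ` B)"
    unfolding B_def r_def by (rule card_orbits_coloured[OF fin mg mt]; use assms in blast)+
  have E: "r s t permutes B" "card (orbit s t ` C) = card (orbit (r s t) (r s t) ` B)"
    unfolding B_def r_def by (rule card_orbits_coloured[OF fin ms mt]; use assms in blast)+
  have "r g t = r g s \<circ> r s t"
  proof
    fix x
    show "r g t x = (r g s \<circ> r s t) x"
    proof (cases "x \<in> C \<and> c x")
      case True
      then have "s (t x) \<in> C" "c (s (t x))" "s (s (t x)) = t x"
        using sD tD assms[of x] assms[of "t x"] by auto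
      then show ?thesis using True by (simp add: r_def)
    qed (auto simp: r_def)
  qed
  then have "evenperm (r g t) \<longleftrightarrow> (evenperm (r g s) \<longleftrightarrow> evenperm (r s t))"
    using V(1) E(1) fB by (simp add: evenperm_comp permutes_imp_permutation)
  then have "even (card B + card (orbit g t ` C)) \<longleftrightarrow>
      (even (card B + card (orbit g s ` C)) \<longleftrightarrow> even (card B + card (orbit s t ` C)))"
    using V F E fB by (simp add: evenperm_iff_even_orbits)
  moreover have "even (card B)"
  proof -
    \<comment> \<open>Gaps change colour, so the class contains one end of each gap.\<close>
    have h: "half_of C g B" using gD assms by (auto simp: half_of_def B_def)
    show ?thesis using card_half_of[OF h] by simp
  qed
  ultimately show ?thesis unfolding orbit_commute[of s g] orbit_commute[of t g] by auto
qed

section \<open>The plane case\<close>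

context medial
begin

abbreviation (input) dual_seg :: "'a set \<Rightarrow> 'a \<Rightarrow> 'a" where
  "dual_seg A \<equiv> \<lambda>x. if x \<in> A then t x else s x"

abbreviation (input) dual_side :: "'a set \<Rightarrow> 'a \<Rightarrow> 'a" where
  "dual_side A \<equiv> \<lambda>x. if x \<in> A then s x else t x"

lemma closed_iff:
  assumes "edge_closed C s t A" "x \<in> C"
  shows "s x \<in> A \<longleftrightarrow> x \<in> A" "t x \<in> A \<longleftrightarrow> x \<in> A"
  using edge_closed_iff[OF ms mt assms] .

lemma medial_dual:
  assumes A: "edge_closed C s t A"
  shows "medial C (dual_seg A) (dual_side A) g"
proof
  show "matching_on C (dual_seg A)" "matching_on C (dual_side A)"
    using sD tD closed_iff[OF A] by (auto simp: matching_on_def)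
  show "dual_seg A (dual_side A x) = dual_side A (dual_seg A x)" if "x \<in> C" for x
    using that st[OF that] closed_iff[OF A] by simp
  show "dual_seg A x \<noteq> dual_side A x" if "x \<in> C" for x
    using s_neq_t[OF that] by auto
qed (use fin mg in auto)

lemma dual_orbit:
  assumes A: "edge_closed C s t A" and x: "x \<in> C"
  shows "orbit (dual_seg A) (dual_side A) x = orbit s t x"
proof -
  have "orbit (dual_seg A) (dual_side A) x = {x, dual_seg A x, dual_side A x, dual_seg A (dual_side A x)}"
    by (rule medial.edge_orbit[OF medial_dual[OF A] x])
  also have "\<dots> = {x, s x, t x, s (t x)}"
  proof (cases "x \<in> A")
    case True
    then have "dual_seg A (dual_side A x) = s (t x)" using closed_iff[OF A x] st[OF x] by simp
    then show ?thesis using True by (simp add: insert_commute)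
  next
    case False
    then have "dual_seg A (dual_side A x) = s (t x)" using closed_iff[OF A x] st[OF x] by simp
    then show ?thesis using False by simp
  qed
  finally show ?thesis using edge_orbit[OF x] by simp
qed

lemma dual_edge_closed:
  "edge_closed C (dual_seg A) (dual_side A) S \<longleftrightarrow> edge_closed C s t S"
proof -
  have "(dual_seg A x \<in> S \<and> dual_side A x \<in> S) \<longleftrightarrow> (s x \<in> S \<and> t x \<in> S)" for x by auto
  then show ?thesis unfolding edge_closed_def by simp
qed

lemma dual_transitive_on:
  "transitive_on C (dual_seg A) (dual_side A) g \<longleftrightarrow> transitive_on C s t g"
proof -
  have "(dual_seg A x \<in> U \<and> dual_side A x \<in> U \<and> g x \<in> U) \<longleftrightarrow> (s x \<in> U \<and> t x \<in> U \<and> g x \<in> U)"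
    for x U by auto
  then show ?thesis unfolding transitive_on_def by simp
qed

lemma half_of_exists: "\<exists>R. half_of C g R"
proof -
  define r where "r x = (SOME y. y \<in> {x, g x})" for x
  have r: "r x = x \<or> r x = g x" for x
    using someI[of "\<lambda>y. y \<in> {x, g x}" x] by (auto simp: r_def)
  have rg: "r (g x) = r x" if "x \<in> C" for x
  proof -
    have "{g x, g (g x)} = {x, g x}" using gD(3)[OF that] by auto
    then show ?thesis by (simp add: r_def)
  qed
  have "half_of C g {x\<in>C. r x = x}"
    unfolding half_of_def
  proof (intro conjI ballI)
    fix x assume x: "x \<in> C"
    show "x \<in> {x\<in>C. r x = x} \<longleftrightarrow> g x \<notin> {x\<in>C. r x = x}"
      using x gD[OF x] r[of x] rg[OF x] by auto
  qed auto
  then show ?thesis by blast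
qed

lemma card_cut:
  assumes R: "half_of C g R" and S: "S \<subseteq> C"
  shows "card {x\<in>S. g x \<notin> S} = card (cut g R S)"
proof (rule bij_betw_same_card)
  have RC: "R \<subseteq> C" and half: "x \<in> R \<longleftrightarrow> g x \<notin> R" if "x \<in> C" for x
    using R that by (auto simp: half_of_def)
  let ?f = "\<lambda>x. if x \<in> R then x else g x" and ?f' = "\<lambda>x. if x \<in> S then x else g x"
  have a: "?f x \<in> cut g R S \<and> ?f' (?f x) = x" if "x \<in> S" "g x \<notin> S" for x
  proof -
    have "x \<in> C" using that S by blast
    then show ?thesis using half[of x] gD(3)[of x] that by (cases "x \<in> R") (simp_all add: cut_def)
  qed
  have b: "?f' x \<in> S \<and> g (?f' x) \<notin> S \<and> ?f (?f' x) = x" if "x \<in> cut g R S" for x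
  proof -
    have x: "x \<in> R" "x \<in> S \<longleftrightarrow> g x \<notin> S" using that by (auto simp: cut_def)
    then have "x \<in> C" using R by (auto simp: half_of_def)
    then show ?thesis using half[of x] gD(3)[of x] x by (cases "x \<in> S") simp_all
  qed
  show "bij_betw ?f {x\<in>S. g x \<notin> S} (cut g R S)"
    by (rule bij_betw_byWitness[where f' = ?f']) (use a b in blast)+
qed

text \<open>The criterion is applied to the dual, not to the given encoding: there it produces a
  side \<open>S\<close> whose links are the mixed gaps on \<open>v\<close>. Whether a set is
  edge-closed does not depend on the duality, so \<open>S\<close> is also a side of a cut before
  dualizing.\<close>

lemma even_mixed_gaps:
  assumes tr: "transitive_on C s t g" and ne: "C \<noteq> {}" and R: "half_of C g R"
    and A: "edge_closed C s t A"
    and euler: "card (orbit (dual_seg A) g ` C) + card (orbit (dual_side A) g ` C)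
      = card (orbit s t ` C) + 2"
    and v: "v \<in> orbit s g ` C" and f: "f \<in> orbit t g ` C"
  shows "even (card (cut g R A \<inter> v \<inter> f))"
proof -
  interpret D: medial C "dual_seg A" "dual_side A" g by (rule medial_dual[OF A])
  have RC: "R \<subseteq> C" using R by (simp add: half_of_def)
  have vC: "v \<subseteq> C" using v orbit_subset[OF ms mg] by blast
  have fC: "f \<subseteq> C" using f orbit_subset[OF mt mg] by blast
  \<comment> \<open>A vertex of the dual follows \<open>s\<close> on edges outside \<open>A\<close>,
    a boundary component of the dual follows \<open>s\<close> on edges inside \<open>A\<close>. So
    \<open>s\<close> pairs up the corners outside \<open>A\<close> in the first case and those
    inside \<open>A\<close> in the second; the mixed gaps must therefore be available as the cut of
    \<open>C - A\<close> as well as of \<open>A\<close>.\<close>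
  have compl: "cut g R A = cut g R (C - A)"
    using RC gD(1) by (auto simp: cut_def subset_iff)
  have "\<exists>S. edge_closed C (dual_seg A) (dual_side A) S \<and> cut g R S = cut g R A \<inter> v"
  proof (rule D.cut_criterion(2)[OF _ ne R])
    show "transitive_on C (dual_seg A) (dual_side A) g" using tr by (simp only: dual_transitive_on)
    have "orbit (dual_seg A) (dual_side A) ` C = orbit s t ` C"
      using dual_orbit[OF A] by (auto intro!: image_cong)
    then show "card (orbit (dual_seg A) g ` C) + card (orbit (dual_side A) g ` C) =
        card (orbit (dual_seg A) (dual_side A) ` C) + 2"
      using euler by simp
    show "cut g R A \<inter> v \<subseteq> R" by (auto simp: cut_def)
    fix u assume u: "u \<in> orbit (dual_seg A) g ` C"
    have "even (card (cut g R (C - A) \<inter> (v \<inter> u)))"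
    proof (rule even_card_cut_Int[OF R _ _ ms])
      show "v \<inter> u \<subseteq> C" using vC by blast
      show "g x \<in> v \<inter> u" if "x \<in> v \<inter> u" for x
        using that orbits_closed(2)[OF v] orbits_closed(2)[OF u] by blast
      fix x assume x: "x \<in> (C - A) \<inter> (v \<inter> u)"
      then have "s x \<in> v" "s x \<in> u"
        using orbits_closed(1)[OF v, of x] orbits_closed(1)[OF u, of x] by auto
      then show "s x \<in> (C - A) \<inter> (v \<inter> u)" using x closed_iff(1)[OF A, of x] sD(1) by blast
    qed
    then show "even (card (cut g R A \<inter> v \<inter> u))" using compl by (simp add: Int_assoc)
  next
    fix u assume u: "u \<in> orbit (dual_side A) g ` C"
    have "even (card (cut g R A \<inter> (v \<inter> u)))"
    proof (rule even_card_cut_Int[OF R _ _ ms])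
      show "v \<inter> u \<subseteq> C" using vC by blast
      show "g x \<in> v \<inter> u" if "x \<in> v \<inter> u" for x
        using that orbits_closed(2)[OF v] orbits_closed(2)[OF u] by blast
      fix x assume x: "x \<in> A \<inter> (v \<inter> u)"
      then have "s x \<in> v" "s x \<in> u"
        using orbits_closed(1)[OF v, of x] orbits_closed(1)[OF u, of x] by auto
      moreover have "x \<in> C" using x vC by blast
      ultimately show "s x \<in> A \<inter> (v \<inter> u)" using x closed_iff(1)[OF A, of x] by blast
    qed
    then show "even (card (cut g R A \<inter> v \<inter> u))" by (simp add: Int_assoc)
  qed
  then obtain S where S: "edge_closed C s t S" "cut g R S = cut g R A \<inter> v"
    unfolding dual_edge_closed by blast
  \<comment> \<open>Any cut meets the original boundary components evenly, here along
    \<open>t\<close>.\<close>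
  have "even (card (cut g R S \<inter> f))"
  proof (rule even_card_cut_Int[OF R fC _ mt])
    show "g x \<in> f" if "x \<in> f" for x using orbits_closed(2)[OF f that] .
    fix x assume x: "x \<in> S \<inter> f"
    then show "t x \<in> S \<inter> f" using closed_iff(2)[OF S(1), of x] orbits_closed(1)[OF f] fC by blast
  qed
  then show ?thesis by (simp add: S(2))
qed

text \<open>Evenness on each intersection guarantees a partner \<open>y\<close> for \<open>x\<close>
  on the same vertex and on the same boundary component. Then every boundary contains both or none
  of the two, so the pair is a cut, and removing it leaves all the parities unchanged.\<close>

lemma plane_decomposition:
  assumes tr: "transitive_on C s t g" and ne: "C \<noteq> {}" and R: "half_of C g R"
    and euler: "card (orbit s g ` C) + card (orbit t g ` C) = card (orbit s t ` C) + 2"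
    and X: "X \<subseteq> R"
    and even: "\<And>v f. v \<in> orbit s g ` C \<Longrightarrow> f \<in> orbit t g ` C \<Longrightarrow> even (card (X \<inter> v \<inter> f))"
  shows "\<exists>S\<in>two_cut_span C s t g. cut g R S = X"
proof -
  have RC: "R \<subseteq> C" using R by (simp add: half_of_def)
  have fX: "finite X" by (rule finite_subset[OF subset_trans[OF X RC] fin])
  from fX X even show ?thesis
  proof (induction X rule: finite_psubset_induct)
    case (psubset X)
    show ?case
    proof (cases "X = {}")
      case True
      have "cut g R {} = X" using True by (auto simp: cut_def)
      then show ?thesis using span_empty by blast
    next
      case False
      then obtain x where x: "x \<in> X" by blast
      then have xC: "x \<in> C" using psubset.prems(1) RC by blast
      define v where "v = orbit s g x"
      define f where "f = orbit t g x"
      have xvf: "x \<in> v" "x \<in> f" by (auto simp: v_def f_def intro: orbit_refl)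
      have "even (card (X \<inter> v \<inter> f))" using psubset.prems(2) xC by (auto simp: v_def f_def)
      then have "X \<inter> v \<inter> f \<noteq> {x}" by auto
      then obtain y where y: "y \<in> X" "y \<noteq> x" "y \<in> v" "y \<in> f" using x xvf by blast
      have iff: "y \<in> u \<longleftrightarrow> x \<in> u" if "u \<in> orbit s g ` C" for u
        using mem_orbits_eq[OF ms mg that, of x] mem_orbits_eq[OF ms mg that, of y]
          orbit_eq[OF ms mg xC] y xvf v_def orbit_refl by blast
      have iff': "y \<in> u \<longleftrightarrow> x \<in> u" if "u \<in> orbit t g ` C" for u
        using mem_orbits_eq[OF mt mg that, of x] mem_orbits_eq[OF mt mg that, of y]
          orbit_eq[OF mt mg xC] y xvf f_def orbit_refl by blast
      have pair: "even (card ({x, y} \<inter> u))" if "y \<in> u \<longleftrightarrow> x \<in> u" for u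
        using that y(2) by (cases "x \<in> u") auto
      have "\<exists>S. edge_closed C s t S \<and> cut g R S = {x, y}"
        by (rule cut_criterion(2)[OF tr ne R euler])
          (use x y psubset.prems(1) pair iff iff' in auto)
      then obtain S where S: "edge_closed C s t S" "cut g R S = {x, y}" by blast
      have "two_cut C s t g S"
        using S card_cut[OF R, of S] y(2) unfolding two_cut_def by (simp add: edge_closed_def)
      moreover have "\<exists>T\<in>two_cut_span C s t g. cut g R T = X - {x, y}"
      proof (rule psubset.IH)
        show "X - {x, y} \<subset> X" using x by blast
        show "X - {x, y} \<subseteq> R" using psubset.prems(1) by blast
        fix v' f' assume vf: "v' \<in> orbit s g ` C" "f' \<in> orbit t g ` C"
        have "(X - {x, y}) \<inter> (v' \<inter> f') = sym_diff X {x, y} \<inter> (v' \<inter> f')" using x y by blast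
        moreover have "even (card (sym_diff X {x, y} \<inter> (v' \<inter> f')))"
          using odd_card_sym_diff_Int[OF psubset.hyps, of "{x, y}" "v' \<inter> f'"]
            psubset.prems(2)[OF vf] pair[of "v' \<inter> f'"] iff[OF vf(1)] iff'[OF vf(2)]
          by (simp add: Int_assoc)
        ultimately show "even (card ((X - {x, y}) \<inter> v' \<inter> f'))" by (simp add: Int_assoc)
      qed
      then obtain T where T: "T \<in> two_cut_span C s t g" "cut g R T = X - {x, y}" by blast
      ultimately have "sym_diff T S \<in> two_cut_span C s t g" by (intro span_add)
      moreover have "cut g R (sym_diff T S) = X"
        unfolding cut_sym_diff T(2) S(2) using x y by blast
      ultimately show ?thesis by blast
    qed
  qed
qed

lemma two_cut_compl:
  assumes Q: "two_cut C s t g Q"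
  shows "two_cut C s t g (C - Q)"
proof -
  obtain R where R: "half_of C g R" using half_of_exists by blast
  have cl: "edge_closed C s t Q" using Q by (simp add: two_cut_def)
  have "edge_closed C s t (C - Q)"
    unfolding edge_closed_def using closed_iff[OF cl] sD(1) tD(1) by simp
  moreover have "cut g R (C - Q) = cut g R Q"
    using R gD(1) by (auto simp: cut_def half_of_def subset_iff)
  then have "card {x\<in>C - Q. g x \<notin> C - Q} = 2"
    using card_cut[OF R, of "C - Q"] card_cut[OF R, of Q] Q cl
    by (simp add: two_cut_def edge_closed_def)
  ultimately show ?thesis by (simp add: two_cut_def)
qed

text \<open>The complement of a sum is again a sum as soon as there is one two-link cut
  \<open>Q\<close>, because \<open>Q\<close> and its complement add up to \<open>C\<close>.
  Otherwise the span contains only the empty set, whose complement is \<open>C\<close>.\<close>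

lemma span_of_cut:
  assumes tr: "transitive_on C s t g" and R: "half_of C g R"
    and A: "edge_closed C s t A" and S: "S \<in> two_cut_span C s t g" and c: "cut g R S = cut g R A"
  shows "A \<in> two_cut_span C s t g \<or> A = C"
proof -
  have Sc: "edge_closed C s t S" by (rule two_cut_span_closed[OF ms mt S])
  then consider "A = S" | "A = C - S" using cut_eq_iff[OF tr R Sc A c] by blast
  then show ?thesis
  proof cases
    case 1 then show ?thesis using S by simp
  next
    case 2
    show ?thesis
    proof (cases "\<exists>Q. two_cut C s t g Q")
      case True
      then obtain Q where Q: "two_cut C s t g Q" by blast
      then have QC: "Q \<subseteq> C" by (simp add: two_cut_def edge_closed_def)
      have "sym_diff (sym_diff S Q) (C - Q) \<in> two_cut_span C s t g"
        by (intro span_add S Q two_cut_compl)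
      moreover have "sym_diff (sym_diff S Q) (C - Q) = C - S"
        using QC Sc unfolding edge_closed_def by blast
      ultimately show ?thesis using 2 by simp
    next
      case False
      from S have "S = {}" by cases (use False in auto)
      then show ?thesis using 2 by simp
    qed
  qed
qed

lemma plane_span:
  assumes tr: "transitive_on C s t g" and ne: "C \<noteq> {}" and A: "edge_closed C s t A"
    and euler: "card (orbit s g ` C) + card (orbit t g ` C) = card (orbit s t ` C) + 2"
    and dual_euler: "card (orbit (dual_seg A) g ` C) + card (orbit (dual_side A) g ` C)
      = card (orbit s t ` C) + 2"
  shows "A \<in> two_cut_span C s t g \<or> A = C"
proof -
  obtain R where R: "half_of C g R" using half_of_exists by blast
  have "\<exists>S\<in>two_cut_span C s t g. cut g R S = cut g R A"
    by (rule plane_decomposition[OF tr ne R euler _ even_mixed_gaps[OF tr ne R A dual_euler]])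
      (auto simp: cut_def)
  then show ?thesis using span_of_cut[OF tr R A] by blast
qed

end

section \<open>The orientable double cover\<close>

text \<open>All three matchings change the sheet, so the sheet is a colouring that witnesses
  orientability of the cover.\<close>

definition lift :: "('a \<Rightarrow> 'a) \<Rightarrow> 'a \<times> bool \<Rightarrow> 'a \<times> bool" where
  "lift f z = (f (fst z), \<not> snd z)"

lemma lift_simp [simp]: "lift f (x, b) = (f x, \<not> b)"
  by (simp add: lift_def)

lemma matching_on_lift:
  assumes "matching_on C f" shows "matching_on (C \<times> UNIV) (lift f)"
  using assms by (auto simp: matching_on_def)

lemma orbit_lift_fst:
  assumes "z \<in> orbit (lift p) (lift q) w"
  shows "fst z \<in> orbit p q (fst w)"
  using assms by induction (auto simp: lift_def intro: orbit.intros)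

lemma orbit_lift_exists:
  assumes "y \<in> orbit p q x"
  shows "\<exists>b. (y, b) \<in> orbit (lift p) (lift q) (x, c)"
  using assms
proof induction
  case orbit_refl
  show ?case by (intro exI[of _ c] orbit.orbit_refl)
next
  case (orbit_left y)
  then obtain b where "(y, b) \<in> orbit (lift p) (lift q) (x, c)" by blast
  from orbit.orbit_left[OF this] show ?case by auto
next
  case (orbit_right y)
  then obtain b where "(y, b) \<in> orbit (lift p) (lift q) (x, c)" by blast
  from orbit.orbit_right[OF this] show ?case by auto
qed

text \<open>The middle step of an odd closed walk would be a fixed point of a matching.\<close>

lemma alternating_walk_odd:
  assumes p: "matching_on C p" and q: "matching_on C q" and x: "x \<in> C"
  shows "p x \<noteq> ((q \<circ> p) ^^ k) x"
  using x
proof (induction k arbitrary: x rule: less_induct)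
  case (less k)
  note pD = matching_onD[OF p] and qD = matching_onD[OF q]
  define r where "r = q \<circ> p"
  have r: "r z = q (p z)" for z by (simp add: r_def)
  consider "k = 0" | "k = 1" | j where "k = Suc (Suc j)"
    by (metis One_nat_def not0_implies_Suc)
  then have "p x \<noteq> (r ^^ k) x"
  proof cases
    case 1 then show ?thesis using pD(2)[OF less.prems] by simp
  next
    case 2 then show ?thesis using qD(2)[OF pD(1)[OF less.prems]] by (simp add: r)
  next
    case 3
    define y where "y = r x"
    have y: "y \<in> C" using less.prems pD qD by (simp add: y_def r)
    have yj: "(r ^^ j) y \<in> C" using y by (induction j) (use pD qD r in auto)
    \<comment> \<open>Cancelling one step at either end turns the equation for \<open>x\<close> and
      \<open>k\<close> into that for \<open>y\<close> and \<open>k - 2\<close>.\<close>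
    have k: "(r ^^ k) x = r ((r ^^ j) y)"
      using funpow_swap1[of r j x] by (simp add: 3 y_def)
    show ?thesis
    proof
      assume "p x = (r ^^ k) x"
      then have "q (p x) = p ((r ^^ j) y)" using k qD(3)[OF pD(1)[OF yj]] by (simp add: r)
      then have "p y = (r ^^ j) y" using pD(3)[OF yj] by (simp add: y_def r)
      then show False using less.IH[of j y] 3 y by (simp add: r_def)
    qed
  qed
  then show ?case unfolding r_def .
qed

text \<open>The sheet records the parity of the length of a walk. An alternating walk cannot return
  to its start after an odd number of steps, so the lift of an orbit never reaches the second copy
  of a point.\<close>

lemma orbit_lift_sheets:
  assumes fin: "finite C" and p: "matching_on C p" and q: "matching_on C q" and x: "x \<in> C"
  shows "(x, False) \<notin> orbit (lift p) (lift q) (x, True)"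
proof -
  note pD = matching_onD[OF p] and qD = matching_onD[OF q]
  define y where "y i = ((q \<circ> p) ^^ i) x" for i
  have y0: "y 0 = x" and yS: "y (Suc i) = q (p (y i))" for i by (auto simp: y_def)
  have yC: "y i \<in> C" for i by (induction i) (use x pD qD in \<open>auto simp: y0 yS\<close>)
  have "\<not> inj y" using fin yC by (meson finite_subset image_subsetI finite_imageD infinite_UNIV_nat)
  then obtain i k where ik: "y i = y (i + Suc k)"
    unfolding inj_def by (metis less_imp_Suc_add linorder_neqE_nat add_Suc_right)
  have "y 0 = y (Suc k)"
    using ik
  proof (induction i)
    case (Suc i)
    then have "q (p (y i)) = q (p (y (i + Suc k)))" by (simp add: yS)
    then have "p (q (q (p (y i)))) = p (q (q (p (y (i + Suc k)))))" by simp
    then have "y i = y (i + Suc k)" using pD qD yC by simp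
    then show ?case by (rule Suc.IH)
  qed simp
  \<comment> \<open>This closes up the walk at its start. Corners reached after an even number of
    steps, the \<open>y i\<close>, then stay on the sheet \<open>True\<close> and the
    \<open>p (y i)\<close> on the sheet \<open>False\<close>.\<close>
  then have qx: "q x = p (y k)" using y0 yS qD(3)[OF pD(1)[OF yC]] by simp
  let ?T = "{(y i, True) | i. True} \<union> {(p (y i), False) | i. True}"
  have "orbit (lift p) (lift q) (x, True) \<subseteq> ?T"
  proof (rule orbit_minimal)
    show "(x, True) \<in> ?T" using y0 by force
    fix z assume "z \<in> ?T"
    then consider i where "z = (y i, True)" | i where "z = (p (y i), False)" by blast
    then show "lift p z \<in> ?T"
    proof cases
      case 2 then show ?thesis using pD(3)[OF yC[of i]] by auto
    qed auto
  next
    fix z assume "z \<in> ?T"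
    then consider "z = (y 0, True)" | i where "z = (y (Suc i), True)" | i where "z = (p (y i), False)"
      by (auto) (metis not0_implies_Suc)
    then show "lift q z \<in> ?T"
    proof cases
      case 1 then show ?thesis using qx y0 by auto
    next
      case (2 i) then show ?thesis using qD(3)[OF pD(1)[OF yC[of i]]] yS by auto
    next
      case (3 i) then show ?thesis using yS[of i, symmetric] by auto
    qed
  qed
  moreover have "x \<noteq> p (y i)" for i
    using alternating_walk_odd[OF p q x, of i] pD(3)[OF yC[of i]] by (auto simp: y_def)
  ultimately show ?thesis by auto
qed

text \<open>Each orbit has two disjoint lifts through a chosen base corner. The lower bound
  suffices, as the opposite estimate comes from \<open>cut_criterion\<close>.\<close>

lemma card_orbits_lift:
  assumes fin: "finite C" and p: "matching_on C p" and q: "matching_on C q"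
  shows "2 * card (orbit p q ` C) \<le> card (orbit (lift p) (lift q) ` (C \<times> UNIV))"
proof -
  note P = matching_on_lift[OF p] and Q = matching_on_lift[OF q]
  define r where "r v = (SOME x. x \<in> C \<and> orbit p q x = v)" for v
  have r: "r v \<in> C \<and> orbit p q (r v) = v" if "v \<in> orbit p q ` C" for v
    unfolding r_def by (rule someI_ex) (use that in auto)
  let ?h = "\<lambda>(v, b). orbit (lift p) (lift q) (r v, b)"
  have "inj_on ?h (orbit p q ` C \<times> (UNIV :: bool set))"
  proof (rule inj_onI)
    fix z z' assume z: "z \<in> orbit p q ` C \<times> UNIV" and z': "z' \<in> orbit p q ` C \<times> UNIV"
      and h: "?h z = ?h z'"
    obtain v b v' b' where vb: "z = (v, b)" "z' = (v', b')" by (cases z, cases z') auto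
    then have v: "v \<in> orbit p q ` C" and v': "v' \<in> orbit p q ` C" using z z' by auto
    have *: "orbit (lift p) (lift q) (r v, b) = orbit (lift p) (lift q) (r v', b')"
      using h vb by simp
    have in1: "(r v', b') \<in> orbit (lift p) (lift q) (r v, b)" unfolding * by (rule orbit_refl)
    have "r v' \<in> orbit p q (r v)" using orbit_lift_fst[OF in1] by simp
    then have vv: "v' = v" using orbit_eq[OF p q, of "r v" "r v'"] r[OF v] r[OF v'] by simp
    have in2: "(r v, b) \<in> orbit (lift p) (lift q) (r v', b')" unfolding *[symmetric] by (rule orbit_refl)
    have "b' = b"
    proof (rule ccontr)
      assume "b' \<noteq> b"
      then have "(r v, False) \<in> orbit (lift p) (lift q) (r v, True)"
        using in1 in2 vv by (cases b; cases b') auto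
      then show False using orbit_lift_sheets[OF fin p q] r[OF v] by blast
    qed
    then show "z = z'" using vb vv by simp
  qed
  then have "card (?h ` (orbit p q ` C \<times> (UNIV :: bool set))) = card (orbit p q ` C \<times> (UNIV :: bool set))"
    by (rule card_image)
  also have "\<dots> = 2 * card (orbit p q ` C)" by (simp add: card_cartesian_product card_UNIV_bool)
  finally have c: "card (?h ` (orbit p q ` C \<times> (UNIV :: bool set))) = 2 * card (orbit p q ` C)" .
  have sub: "?h ` (orbit p q ` C \<times> (UNIV :: bool set)) \<subseteq> orbit (lift p) (lift q) ` (C \<times> UNIV)"
  proof (rule image_subsetI)
    fix z assume "z \<in> orbit p q ` C \<times> (UNIV :: bool set)"
    then obtain v b where "z = (v, b)" "v \<in> orbit p q ` C" by (cases z) auto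
    then show "?h z \<in> orbit (lift p) (lift q) ` (C \<times> UNIV)" using r[of v] by simp
  qed
  have "finite (orbit (lift p) (lift q) ` (C \<times> UNIV))" using fin by simp
  from card_mono[OF this sub] show ?thesis using c by simp
qed

context medial
begin

lemma medial_lift: "medial (C \<times> UNIV) (lift s) (lift t) (lift g)"
proof
  show "finite (C \<times> (UNIV :: bool set))" using fin by simp
  show "matching_on (C \<times> UNIV) (lift s)" "matching_on (C \<times> UNIV) (lift t)"
    "matching_on (C \<times> UNIV) (lift g)"
    using ms mt mg by (simp_all add: matching_on_lift)
  show "lift s (lift t z) = lift t (lift s z)" if "z \<in> C \<times> UNIV" for z
    using that st by auto
  show "lift s z \<noteq> lift t z" if "z \<in> C \<times> UNIV" for z
    using that s_neq_t by auto
qed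

text \<open>A closed set meeting every fibre in exactly one point would be an orientation colouring.
  Hence some fibre is contained in \<open>U\<close>, and connectivity spreads this to all
  fibres.\<close>

lemma transitive_on_lift:
  assumes tr: "transitive_on C s t g"
    and nonor: "\<not> (\<exists>c :: 'a \<Rightarrow> bool. \<forall>x\<in>C. c (s x) \<noteq> c x \<and> c (t x) \<noteq> c x \<and> c (g x) \<noteq> c x)"
  shows "transitive_on (C \<times> UNIV) (lift s) (lift t) (lift g)"
  unfolding transitive_on_def
proof (intro allI impI)
  fix U :: "('a \<times> bool) set"
  assume UC: "U \<subseteq> C \<times> UNIV" and ne: "U \<noteq> {}"
    and cl: "\<forall>z\<in>U. lift s z \<in> U \<and> lift t z \<in> U \<and> lift g z \<in> U"
  have cl': "(s x, \<not> b) \<in> U" "(t x, \<not> b) \<in> U" "(g x, \<not> b) \<in> U" if "(x, b) \<in> U" for x b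
    using cl that by (force simp: lift_def)+
  obtain x0 b0 where x0: "(x0, b0) \<in> U" using ne by auto
  have "{x\<in>C. \<exists>b. (x, b) \<in> U} = C"
  proof (rule transitive_onD[OF tr])
    show "x0 \<in> {x\<in>C. \<exists>b. (x, b) \<in> U}" using x0 UC by blast
    show "s x \<in> {x\<in>C. \<exists>b. (x, b) \<in> U} \<and> t x \<in> {x\<in>C. \<exists>b. (x, b) \<in> U} \<and> g x \<in> {x\<in>C. \<exists>b. (x, b) \<in> U}"
      if "x \<in> {x\<in>C. \<exists>b. (x, b) \<in> U}" for x
      using that cl' sD(1) tD(1) gD(1) by blast
  qed blast
  then have ex: "\<exists>b. (x, b) \<in> U" if "x \<in> C" for x using that by blast
  have "\<exists>x\<in>C. (x, True) \<in> U \<and> (x, False) \<in> U"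
  proof (rule ccontr)
    assume "\<not> (\<exists>x\<in>C. (x, True) \<in> U \<and> (x, False) \<in> U)"
    then have one: "(x, b) \<in> U \<longleftrightarrow> (x, \<not> b) \<notin> U" if "x \<in> C" for x b
      using ex[OF that] that by (cases b) (metis (full_types))+
    have "(f x, True) \<in> U \<longleftrightarrow> (x, True) \<notin> U"
      if f: "f x \<in> C" "\<And>b. (x, b) \<in> U \<Longrightarrow> (f x, \<not> b) \<in> U" and x: "x \<in> C" for f x
      using f(2)[of True] f(2)[of False] one[OF x, of True] one[OF f(1), of True] by auto
    note flip = this
    have "((s x, True) \<in> U) \<noteq> ((x, True) \<in> U) \<and> ((t x, True) \<in> U) \<noteq> ((x, True) \<in> U) \<and>
        ((g x, True) \<in> U) \<noteq> ((x, True) \<in> U)" if "x \<in> C" for x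
      using flip[of s x] flip[of t x] flip[of g x] cl' sD(1) tD(1) gD(1) that by simp
    then have "\<exists>c :: 'a \<Rightarrow> bool. \<forall>x\<in>C. c (s x) \<noteq> c x \<and> c (t x) \<noteq> c x \<and> c (g x) \<noteq> c x"
      by (intro exI[of _ "\<lambda>x. (x, True) \<in> U"]) blast
    then show False using nonor by contradiction
  qed
  then obtain x1 where "x1 \<in> C" "(x1, True) \<in> U" "(x1, False) \<in> U" by blast
  then have x1: "x1 \<in> {x\<in>C. \<forall>b. (x, b) \<in> U}" by (simp add: all_bool_eq)
  have "{x\<in>C. \<forall>b. (x, b) \<in> U} = C"
  proof (rule transitive_onD[OF tr _ x1])
    fix x assume x: "x \<in> {x\<in>C. \<forall>b. (x, b) \<in> U}"
    then have b: "(x, \<not> b) \<in> U" for b by blast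
    show "s x \<in> {x\<in>C. \<forall>b. (x, b) \<in> U} \<and> t x \<in> {x\<in>C. \<forall>b. (x, b) \<in> U} \<and> g x \<in> {x\<in>C. \<forall>b. (x, b) \<in> U}"
      using x cl'[OF b] sD(1) tD(1) gD(1) by simp
  qed blast
  then show "U = C \<times> UNIV" using UC by blast
qed

text \<open>A squeeze: edges double exactly since each has four corners, so twice the projective
  Euler formula gives the lower bound, and the inequality of \<open>cut_criterion\<close> gives the
  same number from above.\<close>

lemma card_orbits_lift_eq:
  assumes tr: "transitive_on C s t g" and ne: "C \<noteq> {}"
    and nonor: "\<not> (\<exists>c :: 'a \<Rightarrow> bool. \<forall>x\<in>C. c (s x) \<noteq> c x \<and> c (t x) \<noteq> c x \<and> c (g x) \<noteq> c x)"
    and euler: "card (orbit s g ` C) + card (orbit t g ` C) = card (orbit s t ` C) + 1"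
  shows "card (orbit (lift s) (lift g) ` (C \<times> UNIV)) + card (orbit (lift t) (lift g) ` (C \<times> UNIV))
    = card (orbit (lift s) (lift t) ` (C \<times> UNIV)) + 2"
proof -
  interpret L: medial "C \<times> UNIV" "lift s" "lift t" "lift g" by (rule medial_lift)
  obtain R where R: "half_of (C \<times> UNIV) (lift g) R" using L.half_of_exists by blast
  have ne2: "C \<times> (UNIV :: bool set) \<noteq> {}" using ne by auto
  have "card (C \<times> (UNIV :: bool set)) = 2 * card C"
    by (simp add: card_cartesian_product card_UNIV_bool)
  then have "card (orbit (lift s) (lift t) ` (C \<times> UNIV)) = 2 * card (orbit s t ` C)"
    using L.card_corners card_corners by simp
  then show ?thesis
    using L.cut_criterion(1)[OF transitive_on_lift[OF tr nonor] ne2 R]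
      card_orbits_lift[OF fin ms mg] card_orbits_lift[OF fin mt mg] euler by linarith
qed

text \<open>Projection modulo 2: a corner with both lifts in \<open>S\<close> cancels. This is what
  makes the map additive for \<open>sym_diff\<close>.\<close>

definition pushdown :: "('a \<times> bool) set \<Rightarrow> 'a set" where
  "pushdown S = {x\<in>C. (x, True) \<in> S \<longleftrightarrow> (x, False) \<notin> S}"

lemma edge_closed_pushdown:
  assumes S: "edge_closed (C \<times> UNIV) (lift s) (lift t) S"
  shows "edge_closed C s t (pushdown S)"
proof -
  interpret L: medial "C \<times> UNIV" "lift s" "lift t" "lift g" by (rule medial_lift)
  have "(s x, b) \<in> S \<longleftrightarrow> (x, \<not> b) \<in> S" "(t x, b) \<in> S \<longleftrightarrow> (x, \<not> b) \<in> S" if "x \<in> C" for x b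
    using L.closed_iff[OF S, of "(x, \<not> b)"] that by auto
  then show ?thesis using sD(1) tD(1) unfolding edge_closed_def pushdown_def by auto
qed

text \<open>The two lifts of the gap at \<open>x\<close> have the ends \<open>(x, True)\<close> and
  \<open>(g x, True)\<close> on the sheet \<open>True\<close>. The gap crosses the projection iff
  exactly one of its lifts crosses \<open>S\<close>.\<close>

lemma pushdown_boundary:
  assumes x: "x \<in> C"
  shows "(x \<in> pushdown S \<longleftrightarrow> g x \<notin> pushdown S) \<longleftrightarrow>
    ((x, True) \<in> cut (lift g) (C \<times> {True}) S \<longleftrightarrow> (g x, True) \<notin> cut (lift g) (C \<times> {True}) S)"
  using x gD(1)[OF x] gD(3)[OF x] by (auto simp: pushdown_def cut_def)

lemma half_of_lift: "half_of (C \<times> UNIV) (lift g) (C \<times> {True})"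
  using gD(1) by (auto simp: half_of_def)

text \<open>The danger is that the two links are lifts of one gap and cancel. Since a cut is even on
  every lifted vertex, both links lie on the same one, and by \<open>orbit_lift_sheets\<close> this
  does not contain both copies of a corner.\<close>

lemma two_cut_pushdown:
  assumes S: "two_cut (C \<times> UNIV) (lift s) (lift t) (lift g) S"
  shows "two_cut C s t g (pushdown S)"
proof -
  interpret L: medial "C \<times> UNIV" "lift s" "lift t" "lift g" by (rule medial_lift)
  have cl: "edge_closed (C \<times> UNIV) (lift s) (lift t) S" using S by (simp add: two_cut_def)
  define X where "X = cut (lift g) (C \<times> {True}) S"
  have "card X = 2"
    using L.card_cut[OF half_of_lift, of S] S cl unfolding X_def
    by (simp add: two_cut_def edge_closed_def)
  then obtain z w where zw: "X = {z, w}" "z \<noteq> w" by (auto simp: card_2_iff)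
  have "X \<subseteq> C \<times> {True}" by (auto simp: X_def cut_def)
  then obtain x y where xy: "z = (x, True)" "w = (y, True)" "x \<in> C" "y \<in> C" "x \<noteq> y"
    using zw by auto
  let ?v = "orbit (lift s) (lift g) (x, True)"
  have "even (card (X \<inter> ?v))"
    unfolding X_def
  proof (rule L.even_card_cut_Int[OF half_of_lift _ _ L.ms])
    show "?v \<subseteq> C \<times> UNIV" by (rule orbit_subset[OF L.ms L.mg]) (use xy in auto)
    show "lift g z \<in> ?v" if "z \<in> ?v" for z using that by (rule orbit_right)
    show "lift s z \<in> S \<inter> ?v" if "z \<in> S \<inter> ?v" for z
      using that cl orbit_left[of z "lift s" "lift g"] by (auto simp: edge_closed_def)
  qed
  moreover have "(x, True) \<in> ?v" by (rule orbit_refl)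
  ultimately have yv: "(y, True) \<in> ?v"
    using zw xy by (cases "(y, True) \<in> ?v") auto
  have "y \<noteq> g x"
  proof
    assume "y = g x"
    then have "lift g (y, True) = (x, False)" using gD(3) xy by simp
    then have "(x, False) \<in> ?v" using orbit_right[OF yv] by simp
    then show False using orbit_lift_sheets[OF fin ms mg xy(3)] by blast
  qed
  then have gxy: "g x \<noteq> y" "g y \<noteq> x" "g x \<noteq> g y" using gD xy by metis+
  have bd: "(u \<in> pushdown S \<longleftrightarrow> g u \<notin> pushdown S) \<longleftrightarrow> u \<in> {x, y, g x, g y}" if u: "u \<in> C" for u
  proof -
    have "(u, True) \<in> X \<longleftrightarrow> u = x \<or> u = y" "(g u, True) \<in> X \<longleftrightarrow> u = g x \<or> u = g y"
      using zw xy gD(3)[OF u] gD(3)[of x] gD(3)[of y] by auto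
    then show ?thesis
      using pushdown_boundary[OF u, of S] gxy xy gD(2)[of x] gD(2)[of y] unfolding X_def[symmetric]
      by auto
  qed
  let ?e = "\<lambda>x. if x \<in> pushdown S then x else g x"
  have P: "pushdown S \<subseteq> C" by (auto simp: pushdown_def)
  have e: "{u\<in>{v, g v}. u \<in> pushdown S \<and> g u \<notin> pushdown S} = {?e v}" if "v = x \<or> v = y" for v
    using bd[of v] that xy gD(2)[of v] gD(3)[of v] by auto
  have "{u\<in>pushdown S. g u \<notin> pushdown S} =
      {u\<in>{x, g x}. u \<in> pushdown S \<and> g u \<notin> pushdown S} \<union> {u\<in>{y, g y}. u \<in> pushdown S \<and> g u \<notin> pushdown S}"
    using bd P by blast
  also have "{u\<in>{x, g x}. u \<in> pushdown S \<and> g u \<notin> pushdown S} = {?e x}" by (rule e) simp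
  also have "{u\<in>{y, g y}. u \<in> pushdown S \<and> g u \<notin> pushdown S} = {?e y}" by (rule e) simp
  also have "{?e x} \<union> {?e y} = {?e x, ?e y}" by (rule insert_is_Un[symmetric])
  also have "card \<dots> = 2" using gxy xy by auto
  finally show ?thesis using edge_closed_pushdown[OF cl] by (simp add: two_cut_def)
qed

lemma two_cut_span_pushdown:
  assumes "S \<in> two_cut_span (C \<times> UNIV) (lift s) (lift t) (lift g)"
  shows "pushdown S \<in> two_cut_span C s t g"
  using assms
proof induction
  case span_empty
  have "pushdown {} = {}" by (auto simp: pushdown_def)
  then show ?case using two_cut_span.span_empty by simp
next
  case (span_add S T)
  have "pushdown (sym_diff S T) = sym_diff (pushdown S) (pushdown T)"
    by (auto simp: pushdown_def)
  then show ?case using two_cut_span.span_add[OF span_add(3) two_cut_pushdown[OF span_add(2)]] by simp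
qed

lemma RP2_span:
  assumes tr: "transitive_on C s t g" and ne: "C \<noteq> {}" and A: "edge_closed C s t A"
    and nonor: "\<not> (\<exists>c :: 'a \<Rightarrow> bool. \<forall>x\<in>C. c (s x) \<noteq> c x \<and> c (t x) \<noteq> c x \<and> c (g x) \<noteq> c x)"
    and euler: "card (orbit s g ` C) + card (orbit t g ` C) = card (orbit s t ` C) + 1"
    and dual_euler: "card (orbit (dual_seg A) g ` C) + card (orbit (dual_side A) g ` C)
      = card (orbit s t ` C) + 1"
  shows "A \<in> two_cut_span C s t g \<or> A = C"
proof -
  obtain R where R: "half_of C g R" using half_of_exists by blast
  interpret L: medial "C \<times> UNIV" "lift s" "lift t" "lift g" by (rule medial_lift)
  interpret D: medial C "dual_seg A" "dual_side A" g by (rule medial_dual[OF A])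
  define A2 where "A2 = A \<times> (UNIV :: bool set)"
  define X where "X = cut (lift g) (C \<times> {True}) A2"
  have A2: "edge_closed (C \<times> UNIV) (lift s) (lift t) A2"
    using A by (auto simp: A2_def edge_closed_def)
  have ne2: "C \<times> (UNIV :: bool set) \<noteq> {}" using ne by auto
  have tr2: "transitive_on (C \<times> UNIV) (lift s) (lift t) (lift g)"
    by (rule transitive_on_lift[OF tr nonor])
  \<comment> \<open>Taking the double cover commutes with partial duality.\<close>
  have lift_dual: "(\<lambda>z. if z \<in> A2 then lift t z else lift s z) = lift (dual_seg A)"
    "(\<lambda>z. if z \<in> A2 then lift s z else lift t z) = lift (dual_side A)"
    by (auto simp: A2_def fun_eq_iff)
  have E: "orbit (dual_seg A) (dual_side A) ` C = orbit s t ` C"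
    using dual_orbit[OF A] by (auto intro!: image_cong)
  have E2: "orbit (lift (dual_seg A)) (lift (dual_side A)) ` (C \<times> UNIV) = orbit (lift s) (lift t) ` (C \<times> UNIV)"
    unfolding lift_dual[symmetric] using L.dual_orbit[OF A2] by (intro image_cong) auto
  have nonor': "\<not> (\<exists>c :: 'a \<Rightarrow> bool. \<forall>x\<in>C. c (dual_seg A x) \<noteq> c x \<and> c (dual_side A x) \<noteq> c x \<and> c (g x) \<noteq> c x)"
  proof -
    have "(c (dual_seg A x) \<noteq> c x \<and> c (dual_side A x) \<noteq> c x) = (c (s x) \<noteq> c x \<and> c (t x) \<noteq> c x)"
      for x and c :: "'a \<Rightarrow> bool" by auto
    then show ?thesis using nonor by (metis (no_types, lifting))
  qed
  have tr': "transitive_on C (dual_seg A) (dual_side A) g"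
    using tr by (simp only: dual_transitive_on)
  have euler2: "card (orbit (lift s) (lift g) ` (C \<times> UNIV)) + card (orbit (lift t) (lift g) ` (C \<times> UNIV))
    = card (orbit (lift s) (lift t) ` (C \<times> UNIV)) + 2"
    by (rule card_orbits_lift_eq[OF tr ne nonor euler])
  have dual_euler2: "card (orbit (lift (dual_seg A)) (lift g) ` (C \<times> UNIV)) +
      card (orbit (lift (dual_side A)) (lift g) ` (C \<times> UNIV))
    = card (orbit (lift s) (lift t) ` (C \<times> UNIV)) + 2"
    using D.card_orbits_lift_eq[OF tr' ne nonor'] dual_euler E E2 by simp
  have mixed: "even (card (X \<inter> v \<inter> f))"
    if "v \<in> orbit (lift s) (lift g) ` (C \<times> UNIV)" "f \<in> orbit (lift t) (lift g) ` (C \<times> UNIV)" for v f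
    unfolding X_def
    by (rule L.even_mixed_gaps[OF tr2 ne2 half_of_lift A2 _ that])
      (use dual_euler2 in \<open>simp only: lift_dual\<close>)
  \<comment> \<open>\<open>X\<close> contains both lifts of every mixed gap, and a set with cut
    \<open>X\<close> would project to one with empty cut. So one lift \<open>h x\<close> of the
    vertex at \<open>x\<close> is chosen through a base corner that depends on the vertex only, and
    \<open>X\<close> is restricted to the union \<open>U\<close> of these lifts.\<close>
  define r where "r v = (SOME x. x \<in> C \<and> orbit s g x = v)" for v
  have r: "r (orbit s g x) \<in> C \<and> orbit s g (r (orbit s g x)) = orbit s g x" if "x \<in> C" for x
    unfolding r_def by (rule someI_ex) (use that in auto)
  define h where "h x = orbit (lift s) (lift g) (r (orbit s g x), True)" for x
  define U where "U = \<Union>(h ` C)"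
  have hV: "h x \<in> orbit (lift s) (lift g) ` (C \<times> UNIV)" if "x \<in> C" for x
    using r[OF that] by (auto simp: h_def)
  have U_iff: "(x, b) \<in> U \<longleftrightarrow> (x, b) \<in> h x" if x: "x \<in> C" for x b
  proof
    assume "(x, b) \<in> U"
    then obtain y where y: "y \<in> C" "(x, b) \<in> h y" by (auto simp: U_def)
    have "x \<in> orbit s g (r (orbit s g y))" using orbit_lift_fst[OF y(2)[unfolded h_def]] by simp
    then have "x \<in> orbit s g y" using r[OF y(1)] by simp
    then have "orbit s g x = orbit s g y" using orbit_eq[OF ms mg y(1)] by simp
    then show "(x, b) \<in> h x" using y by (simp add: h_def)
  qed (use x in \<open>auto simp: U_def\<close>)
  have sheet: "(x, True) \<in> U \<longleftrightarrow> (x, False) \<notin> U" if x: "x \<in> C" for x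
  proof -
    have "x \<in> orbit s g (r (orbit s g x))" using r[OF x] orbit_refl[of x s g] by simp
    from orbit_lift_exists[OF this, of True] obtain b where "(x, b) \<in> h x"
      unfolding h_def by blast
    moreover have "\<not> ((x, True) \<in> h x \<and> (x, False) \<in> h x)"
    proof
      assume a: "(x, True) \<in> h x \<and> (x, False) \<in> h x"
      then have "h x = orbit (lift s) (lift g) (x, True)"
        using mem_orbits_eq[OF L.ms L.mg hV[OF x]] by simp
      then show False using a orbit_lift_sheets[OF fin ms mg x] by simp
    qed
    ultimately show ?thesis unfolding U_iff[OF x] by (cases b) auto
  qed
  have Ug: "(g x, b) \<in> U \<longleftrightarrow> (x, \<not> b) \<in> U" if x: "x \<in> C" for x b
  proof -
    have hg: "h (g x) = h x" unfolding h_def orbit_step_eq(2)[OF ms mg x] by simp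
    have "lift g (x, \<not> b) = (g x, b)" "lift g (g x, b) = (x, \<not> b)" using gD(3)[OF x] by auto
    then have "(g x, b) \<in> h x \<longleftrightarrow> (x, \<not> b) \<in> h x"
      using orbits_closed(2)[OF hV[OF x]] by metis
    then show ?thesis unfolding U_iff[OF x] U_iff[OF gD(1)[OF x]] hg by simp
  qed
  have "\<exists>S\<in>two_cut_span (C \<times> UNIV) (lift s) (lift t) (lift g). cut (lift g) (C \<times> {True}) S = X \<inter> U"
  proof (rule L.plane_decomposition[OF tr2 ne2 half_of_lift euler2])
    show "X \<inter> U \<subseteq> C \<times> {True}" by (auto simp: X_def cut_def)
    fix v f assume vf: "v \<in> orbit (lift s) (lift g) ` (C \<times> UNIV)" "f \<in> orbit (lift t) (lift g) ` (C \<times> UNIV)"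
    \<comment> \<open>A lifted vertex is either chosen as a whole or avoided, so the restriction
      keeps evenness.\<close>
    have "v \<inter> h x = {} \<or> v \<inter> h x = v" if "x \<in> C" for x
      using orbits_disjoint[OF L.ms L.mg vf(1) hV[OF that]] by blast
    then have "v \<inter> U = {} \<or> v \<inter> U = v" unfolding U_def by blast
    then have "X \<inter> U \<inter> v \<inter> f = {} \<or> X \<inter> U \<inter> v \<inter> f = X \<inter> v \<inter> f" by blast
    then show "even (card (X \<inter> U \<inter> v \<inter> f))" using mixed[OF vf] by auto
  qed
  then obtain S where S: "S \<in> two_cut_span (C \<times> UNIV) (lift s) (lift t) (lift g)"
    "cut (lift g) (C \<times> {True}) S = X \<inter> U" by blast
  \<comment> \<open>By \<open>sheet\<close> and \<open>Ug\<close> exactly one lift of each gap lies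
    in \<open>U\<close>, so precisely the mixed gaps survive the projection.\<close>
  have "cut g R (pushdown S) = cut g R A"
  proof -
    have "(x \<in> pushdown S \<longleftrightarrow> g x \<notin> pushdown S) \<longleftrightarrow> (x \<in> A \<longleftrightarrow> g x \<notin> A)" if x: "x \<in> C" for x
    proof -
      have X: "(x, True) \<in> X \<longleftrightarrow> (x \<in> A \<longleftrightarrow> g x \<notin> A)" "(g x, True) \<in> X \<longleftrightarrow> (x \<in> A \<longleftrightarrow> g x \<notin> A)"
        using x gD(1)[OF x] gD(3)[OF x] by (auto simp: X_def cut_def A2_def)
      show ?thesis unfolding pushdown_boundary[OF x] S(2) Int_iff X Ug[OF x] using sheet[OF x] by auto
    qed
    then show ?thesis using R unfolding cut_def half_of_def by blast
  qed
  then show ?thesis using span_of_cut[OF tr R A two_cut_span_pushdown[OF S(1)]] by blast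
qed

end

section \<open>The sides of a two-link cut: connectedness and the arc on the shared vertex\<close>

context medial
begin

lemma even_boundary:
  assumes U: "U \<subseteq> C" "\<And>x. x \<in> U \<Longrightarrow> s x \<in> U"
  shows "even (card {x\<in>U. g x \<notin> U})"
proof -
  obtain R where R: "half_of C g R" using half_of_exists by blast
  have "even (card (cut g R U \<inter> C))"
    by (rule even_card_cut_Int[OF R _ _ ms]) (use U sD gD in auto)
  moreover have "cut g R U \<inter> C = cut g R U" using R by (auto simp: cut_def half_of_def)
  ultimately show ?thesis using card_cut[OF R U(1)] by simp
qed

lemma boundary_empty_iff:
  assumes tr: "transitive_on C s t g" and U: "edge_closed C s t U" and b: "{x\<in>U. g x \<notin> U} = {}"
  shows "U = {} \<or> U = C"
proof -
  obtain R where R: "half_of C g R" using half_of_exists by blast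
  have UC: "U \<subseteq> C" using U by (simp add: edge_closed_def)
  have "finite (cut g R U)" using R fin by (auto simp: cut_def half_of_def intro: finite_subset)
  moreover have "card (cut g R U) = 0" using card_cut[OF R UC] unfolding b by simp
  ultimately have "cut g R U = {}" by simp
  then show ?thesis by (rule cut_empty_iff[OF tr R U])
qed

lemma two_cut_boundary:
  assumes "two_cut C s t g S"
  obtains x y where "{z\<in>S. g z \<notin> S} = {x, y}" "x \<noteq> y"
proof -
  have "card {z\<in>S. g z \<notin> S} = 2" using assms by (simp add: two_cut_def)
  then obtain x y where "{z\<in>S. g z \<notin> S} = {x, y}" "x \<noteq> y" unfolding card_2_iff by metis
  then show thesis by (rule that)
qed

text \<open>A part \<open>U\<close> of \<open>S\<close> closed under gaps inside \<open>S\<close>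
  can be left only through the two links, and by parity through none or both. In the first case
  \<open>U\<close> would be a component of the whole graph; in the second the remaining part
  \<open>S - U\<close> has no leaving gap, so it is empty.\<close>

lemma two_cut_connected:
  assumes tr: "transitive_on C s t g" and S: "two_cut C s t g S"
    and U: "U \<subseteq> S" "x \<in> U" "\<And>x. x \<in> U \<Longrightarrow> s x \<in> U \<and> t x \<in> U"
      "\<And>x. x \<in> U \<Longrightarrow> g x \<in> S \<Longrightarrow> g x \<in> U"
  shows "U = S"
proof -
  let ?B = "\<lambda>U. {z\<in>U. g z \<notin> U}"
  have cS: "edge_closed C s t S" and SC: "S \<subseteq> C" using S by (auto simp: two_cut_def edge_closed_def)
  have cU: "edge_closed C s t U" using U SC by (auto simp: edge_closed_def)
  obtain a b where ab: "?B S = {a, b}" "a \<noteq> b" by (rule two_cut_boundary[OF S])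
  have ne: "S \<noteq> C" using ab gD(1) by blast
  have BU: "?B U \<subseteq> ?B S" using U by blast
  have cSU: "edge_closed C s t (S - U)"
    using SC closed_iff[OF cS] closed_iff[OF cU] unfolding edge_closed_def by blast
  have "even (card (?B U))" using even_boundary[of U] U SC by blast
  then have single: "?B U \<noteq> {z}" for z by (metis card_1_singleton_iff One_nat_def odd_one)
  have "X = {} \<or> X = {a} \<or> X = {b} \<or> X = {a, b}" if "X \<subseteq> {a, b}" for X
    using that by blast
  from this[OF BU[unfolded ab(1)]] have "?B U = {} \<or> ?B U = {a, b}" using single by simp
  then consider "?B U = {}" | "?B U = ?B S" unfolding ab(1) by argo
  then show ?thesis
  proof cases
    case 1
    then have "U = {} \<or> U = C" by (rule boundary_empty_iff[OF tr cU])
    then show ?thesis using U ne SC by blast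
  next
    case 2
    have "?B (S - U) = {}"
    proof -
      have False if z: "z \<in> S - U" "g z \<notin> S - U" for z
      proof (cases "g z \<in> U")
        case True
        have "z \<in> C" using z SC by blast
        then have "g (g z) \<in> S" using gD(3) z by simp
        then have "z \<in> U" using U(4)[OF True] gD(3)[OF \<open>z \<in> C\<close>] by simp
        then show False using z by blast
      next
        case False
        then have "z \<in> ?B S" using z by blast
        then show False using 2 z by blast
      qed
      then show ?thesis by blast
    qed
    then have "S - U = {} \<or> S - U = C" by (rule boundary_empty_iff[OF tr cSU])
    then show ?thesis using U SC by blast
  qed
qed

text \<open>
  The arc starts just after one of the two links of the cut and runs until it reaches the other.
\<close>

lemma two_cut_arc:
  assumes tr: "transitive_on C s t g" and S: "two_cut C s t g S"
    and x: "x \<in> S" "g x \<notin> S" and v: "v = orbit s g x"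
    and b: "\<And>z. z \<in> S \<Longrightarrow> g z \<notin> S \<Longrightarrow> z \<in> v"
  defines "w \<equiv> \<lambda>i. ((g \<circ> s) ^^ i) x"
  shows "\<exists>n. v \<inter> S \<subseteq> (\<Union>i<n. {w i, s (w i)}) \<and> (\<Union>i<n. {w i, s (w i)}) \<subseteq> S"
proof -
  have cS: "edge_closed C s t S" and SC: "S \<subseteq> C" using S by (auto simp: two_cut_def edge_closed_def)
  have xC: "x \<in> C" using x SC by blast
  have w0: "w 0 = x" and wS: "w (Suc i) = g (s (w i))" for i by (auto simp: w_def)
  have wC: "w i \<in> C" for i by (induction i) (use xC sD gD in \<open>auto simp: w0 wS\<close>)
  have gw: "g (w (Suc i)) = s (w i)" for i using gD(3)[OF sD(1)[OF wC]] by (simp add: wS)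
  \<comment> \<open>If the walk stayed in \<open>S\<close>, the set of its corners could be left at
    \<open>x\<close> only, against \<open>even_boundary\<close>.\<close>
  have "\<exists>n. w n \<notin> S"
  proof (rule ccontr)
    assume "\<not> (\<exists>n. w n \<notin> S)"
    then have in_S: "w n \<in> S" for n by blast
    define W where "W = range w \<union> range (\<lambda>i. s (w i))"
    have WC: "W \<subseteq> C" using wC sD(1) by (auto simp: W_def)
    have Ws: "s z \<in> W" if "z \<in> W" for z using that sD(3)[OF wC] by (auto simp: W_def)
    have WS: "W \<subseteq> S" using in_S closed_iff(1)[OF cS wC] by (auto simp: W_def)
    have "{z\<in>W. g z \<notin> W} = {x}"
    proof
      show "{z\<in>W. g z \<notin> W} \<subseteq> {x}"
      proof clarify
        fix z assume z: "z \<in> W" "g z \<notin> W"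
        from z(1) consider i where "z = w i" | i where "z = s (w i)" by (auto simp: W_def)
        then show "z = x"
        proof cases
          case (1 i) then show ?thesis using z(2) gw w0 by (cases i) (auto simp: W_def)
        next
          case (2 i) then show ?thesis using z(2) wS[of i, symmetric] by (auto simp: W_def)
        qed
      qed
      have "x \<in> W" unfolding W_def using w0 by (metis UnI1 rangeI)
      then show "{x} \<subseteq> {z\<in>W. g z \<notin> W}" using x WS by blast
    qed
    then show False using even_boundary[OF WC Ws] by simp
  qed
  then obtain n where n: "w n \<notin> S" "\<And>i. i < n \<Longrightarrow> w i \<in> S"
    using LeastI_ex[of "\<lambda>n. w n \<notin> S"] not_less_Least[of _ "\<lambda>n. w n \<notin> S"] by metis
  then have n0: "n \<noteq> 0" using w0 x by metis
  then obtain m where m: "n = Suc m" by (cases n) auto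
  define W where "W = (\<Union>i<n. {w i, s (w i)})"
  have W_iff: "z \<in> W \<longleftrightarrow> (\<exists>i<n. z = w i \<or> z = s (w i))" for z by (auto simp: W_def)
  have WS: "W \<subseteq> S" using n(2) closed_iff(1)[OF cS wC] by (auto simp: W_def)
  have WC: "W \<subseteq> C" using WS SC by blast
  have Ws: "s z \<in> W" if "z \<in> W" for z using that sD(3)[OF wC] by (auto simp: W_def)
  define y where "y = s (w m)"
  have yW: "y \<in> W" unfolding W_iff y_def m by auto
  have xW: "x \<in> W" unfolding W_iff using w0 n0 by (metis neq0_conv)
  have gy: "g y = w n" by (simp add: y_def m wS)
  have bW: "{z\<in>W. g z \<notin> W} = {x, y}"
  proof
    show "{z\<in>W. g z \<notin> W} \<subseteq> {x, y}"
    proof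
      fix z assume "z \<in> {z\<in>W. g z \<notin> W}"
      then have z: "z \<in> W" "g z \<notin> W" by simp_all
      from z(1) consider i where "i < n" "z = w i" | i where "i < n" "z = s (w i)"
        unfolding W_iff by blast
      then show "z \<in> {x, y}"
      proof cases
        case (1 i)
        show ?thesis
        proof (cases i)
          case 0 then show ?thesis using 1 w0 by simp
        next
          case (Suc j)
          then have "g z = s (w j)" "j < n" using 1 gw by auto
          then show ?thesis using z(2) unfolding W_iff by blast
        qed
      next
        case (2 i)
        show ?thesis
        proof (cases "i = m")
          case True then show ?thesis using 2 by (simp add: y_def)
        next
          case False
          then have "Suc i < n" using 2 m by simp
          moreover have "g z = w (Suc i)" using 2 wS by simp
          ultimately show ?thesis using z(2) unfolding W_iff by blast
        qed
      qed
    qed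
    show "{x, y} \<subseteq> {z\<in>W. g z \<notin> W}" using x xW yW WS gy n(1) by auto
  qed
  have xy: "x \<noteq> y"
  proof
    assume "x = y"
    then have "card {z\<in>W. g z \<notin> W} = 1" unfolding bW by simp
    then show False using even_boundary[OF WC Ws] by simp
  qed
  obtain p q where pq: "{z\<in>S. g z \<notin> S} = {p, q}" by (rule two_cut_boundary[OF S])
  have "{x, y} \<subseteq> {z\<in>S. g z \<notin> S}" using x yW WS gy n(1) by auto
  then have bS: "{z\<in>S. g z \<notin> S} = {x, y}" using pq xy by auto
  have "v \<inter> S \<subseteq> W"
  proof
    fix c assume c: "c \<in> v \<inter> S"
    show "c \<in> W"
    proof (rule ccontr)
      assume cW: "c \<notin> W"
      \<comment> \<open>The leaving gaps of the arc, at \<open>x\<close> and \<open>y\<close>,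
        already are both links. So the rest of \<open>S\<close> on \<open>v\<close> has no way out
        and would contain the whole orbit \<open>v\<close>, including \<open>x\<close>.\<close>
      define U where "U = v \<inter> S - W"
      have vV: "v \<in> orbit s g ` C" using v xC by simp
      have "orbit s g c \<subseteq> U"
      proof (rule orbit_minimal)
        show "c \<in> U" using c cW by (simp add: U_def)
        fix z assume z: "z \<in> U"
        then have zC: "z \<in> C" using SC by (auto simp: U_def)
        have zv: "s z \<in> v" "g z \<in> v" using orbits_closed[OF vV, of z] z by (auto simp: U_def)
        have "s z \<notin> W"
        proof
          assume "s z \<in> W"
          then have "z \<in> W" using Ws[of "s z"] sD(3)[OF zC] by simp
          then show False using z by (simp add: U_def)
        qed
        then show "s z \<in> U" using z zv closed_iff(1)[OF cS zC] by (simp add: U_def)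
        have gS: "g z \<in> S"
        proof (rule ccontr)
          assume "g z \<notin> S"
          then have "z \<in> {x, y}" using bS z by (auto simp: U_def)
          then show False using z xW yW by (auto simp: U_def)
        qed
        have "g z \<notin> W"
        proof
          assume "g z \<in> W"
          moreover have "g (g z) \<notin> W" using z gD(3)[OF zC] by (simp add: U_def)
          ultimately have "g z \<in> {x, y}" using bW by blast
          then have "g (g z) \<notin> S" using bS by blast
          then show False using z gD(3)[OF zC] by (simp add: U_def)
        qed
        then show "g z \<in> U" using zv gS by (simp add: U_def)
      qed
      moreover have "orbit s g c = v" using mem_orbits_eq[OF ms mg vV] c by blast
      moreover have "x \<in> v" unfolding v by (rule orbit_refl)
      ultimately show False using xW by (auto simp: U_def)
    qed
  qed
  then show ?thesis using WS unfolding W_def by blast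
qed

end

section \<open>Sets of edges as sets of corners, and partial duals up to homeomorphism\<close>

lemma medial_ribbon_graph:
  "is_ribbon_graph G \<Longrightarrow> medial (corners G) (seg G) (side G) (gap G)"
  by (auto simp: is_ribbon_graph_def medial_def)

abbreviation (input) rg_closed :: "'a ribbon_graph \<Rightarrow> 'a set \<Rightarrow> bool" where
  "rg_closed G \<equiv> edge_closed (corners G) (seg G) (side G)"

abbreviation (input) rg_two_cut :: "'a ribbon_graph \<Rightarrow> 'a set \<Rightarrow> bool" where
  "rg_two_cut G \<equiv> two_cut (corners G) (seg G) (side G) (gap G)"

abbreviation (input) rg_transitive :: "'a ribbon_graph \<Rightarrow> bool" where
  "rg_transitive G \<equiv> transitive_on (corners G) (seg G) (side G) (gap G)"

lemma edges_eq: "edges G = orbit (seg G) (side G) ` corners G"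
  by (simp add: edges_def edge_of_def[abs_def])

definition edges_in :: "'a ribbon_graph \<Rightarrow> 'a set \<Rightarrow> 'a set set" where
  "edges_in G S = {e\<in>edges G. e \<subseteq> S}"

lemma Union_edges_in:
  assumes S: "rg_closed G S"
  shows "\<Union>(edges_in G S) = S"
proof
  show "S \<subseteq> \<Union>(edges_in G S)"
  proof
    fix x assume x: "x \<in> S"
    have "orbit (seg G) (side G) x \<subseteq> S"
      by (rule orbit_minimal) (use S x in \<open>auto simp: edge_closed_def\<close>)
    moreover have "x \<in> corners G" using S x by (auto simp: edge_closed_def)
    ultimately show "x \<in> \<Union>(edges_in G S)"
      using orbit_refl[of x "seg G" "side G"] by (auto simp: edges_in_def edges_eq)
  qed
qed (auto simp: edges_in_def)

lemma edges_in_Union: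
  assumes G: "is_ribbon_graph G" and A: "A \<subseteq> edges G"
  shows "edges_in G (\<Union>A) = A"
proof
  interpret medial "corners G" "seg G" "side G" "gap G" by (rule medial_ribbon_graph[OF G])
  show "edges_in G (\<Union>A) \<subseteq> A"
  proof
    fix e assume e: "e \<in> edges_in G (\<Union>A)"
    then obtain x where x: "e = orbit (seg G) (side G) x" by (auto simp: edges_in_def edges_eq)
    then have "x \<in> e" by (simp add: orbit_refl)
    then obtain e' where e': "e' \<in> A" "x \<in> e'" using e by (auto simp: edges_in_def)
    then have "e' = e"
      using orbits_disjoint[OF ms mt, of e' e] e A \<open>x \<in> e\<close> by (auto simp: edges_in_def edges_eq)
    then show "e \<in> A" using e' by simp
  qed
qed (use A in \<open>auto simp: edges_in_def\<close>)

lemma rg_closed_Union: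
  assumes G: "is_ribbon_graph G" and A: "A \<subseteq> edges G"
  shows "rg_closed G (\<Union>A)"
proof -
  interpret medial "corners G" "seg G" "side G" "gap G" by (rule medial_ribbon_graph[OF G])
  have "e \<subseteq> corners G \<and> (\<forall>x\<in>e. seg G x \<in> e \<and> side G x \<in> e)" if "e \<in> A" for e
  proof -
    have e: "e \<in> orbit (seg G) (side G) ` corners G" using that A by (auto simp: edges_eq)
    then show ?thesis using orbits_closed[OF e] orbit_subset[OF ms mt] by blast
  qed
  then show ?thesis unfolding edge_closed_def by blast
qed

text \<open>
  The partial dual up to the irrelevant values outside the corners.
\<close>

definition dualized :: "'a ribbon_graph \<Rightarrow> 'a set \<Rightarrow> 'a ribbon_graph \<Rightarrow> bool" where
  "dualized G S K \<longleftrightarrow> corners K = corners G \<and> isolated K = isolated G \<and>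
     (\<forall>x\<in>corners G. gap K x = gap G x \<and> seg K x = (if x \<in> S then side G x else seg G x) \<and>
        side K x = (if x \<in> S then seg G x else side G x))"

lemma dualized_partial_dual:
  assumes G: "is_ribbon_graph G" and A: "A \<subseteq> edges G"
  shows "dualized G (\<Union>A) (partial_dual G A)"
proof -
  have d: "edge_orientation G (SOME d. edge_orientation G d)"
    by (rule someI_ex[OF edge_orientation_exists[OF G]])
  show ?thesis
    using attached_side_eq[OF G A d]
    by (simp add: dualized_def partial_dual_def marked_arc_def Let_def)
qed

lemma dualized_empty: "dualized G {} G"
  by (simp add: dualized_def)

text \<open>Exchanging \<open>seg\<close> and \<open>side\<close> twice on an edge cancels, so
  successive duals add modulo 2.\<close>

lemma dualized_trans:
  assumes "dualized G S K" "dualized K T L"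
  shows "dualized G (sym_diff S T) L"
  using assms by (auto simp: dualized_def)

lemma edge_closed_cong:
  assumes "\<And>x. x \<in> C \<Longrightarrow> (s' x = s x \<and> t' x = t x) \<or> (s' x = t x \<and> t' x = s x)"
  shows "edge_closed C s' t' U \<longleftrightarrow> edge_closed C s t U"
proof (cases "U \<subseteq> C")
  case True
  have "(s' x \<in> U \<and> t' x \<in> U) \<longleftrightarrow> (s x \<in> U \<and> t x \<in> U)" if "x \<in> U" for x
  proof -
    have "x \<in> C" using that True by blast
    from assms[OF this] show ?thesis by auto
  qed
  then show ?thesis unfolding edge_closed_def by simp
qed (simp add: edge_closed_def)

text \<open>All three notions ignore which of the two exchanged matchings is which. In particular
  every partial dual offers the same two-link cuts, so they may be dualized one after
  another.\<close>

lemma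
  assumes K: "dualized G S K"
  shows dualized_closed: "rg_closed K U \<longleftrightarrow> rg_closed G U"
    and dualized_two_cut: "rg_two_cut K U \<longleftrightarrow> rg_two_cut G U"
    and dualized_transitive: "rg_transitive K \<longleftrightarrow> rg_transitive G"
proof -
  have C: "corners K = corners G" and g: "\<And>x. x \<in> corners G \<Longrightarrow> gap K x = gap G x"
    and st: "\<And>x. x \<in> corners G \<Longrightarrow> (seg K x = seg G x \<and> side K x = side G x) \<or>
      (seg K x = side G x \<and> side K x = seg G x)"
    using K by (auto simp: dualized_def)
  show cl: "rg_closed K U \<longleftrightarrow> rg_closed G U" for U
    unfolding C by (rule edge_closed_cong[OF st])
  have "{x\<in>U. gap K x \<notin> U} = {x\<in>U. gap G x \<notin> U}" if "rg_closed G U"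
  proof -
    have "U \<subseteq> corners G" using that by (simp add: edge_closed_def)
    then show ?thesis using g by auto
  qed
  then show "rg_two_cut K U \<longleftrightarrow> rg_two_cut G U"
    unfolding two_cut_def cl by auto
  have "(\<forall>x\<in>U. seg K x \<in> U \<and> side K x \<in> U \<and> gap K x \<in> U) \<longleftrightarrow>
      (\<forall>x\<in>U. seg G x \<in> U \<and> side G x \<in> U \<and> gap G x \<in> U)" if U: "U \<subseteq> corners G" for U
  proof (rule ball_cong[OF refl])
    fix x assume "x \<in> U"
    then have x: "x \<in> corners G" using U by blast
    show "(seg K x \<in> U \<and> side K x \<in> U \<and> gap K x \<in> U) \<longleftrightarrow>
        (seg G x \<in> U \<and> side G x \<in> U \<and> gap G x \<in> U)"
      using st[OF x] g[OF x] by auto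
  qed
  then show "rg_transitive K \<longleftrightarrow> rg_transitive G"
    unfolding transitive_on_def C by (metis (no_types, lifting))
qed

lemma is_ribbon_graph_dualized:
  assumes G: "is_ribbon_graph G" and S: "rg_closed G S" and K: "dualized G S K"
  shows "is_ribbon_graph K"
proof -
  have A: "edges_in G S \<subseteq> edges G" by (auto simp: edges_in_def)
  let ?D = "partial_dual G (edges_in G S)"
  have D: "dualized G S ?D" using dualized_partial_dual[OF G A] Union_edges_in[OF S] by simp
  have R: "is_ribbon_graph ?D" by (rule is_ribbon_graph_partial_dual[OF G A])
  have c: "corners K = corners ?D" "isolated K = isolated ?D"
    using D K by (simp_all add: dualized_def)
  have e: "seg K x = seg ?D x" "side K x = side ?D x" "gap K x = gap ?D x" if "x \<in> corners ?D" for x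
    using D K that by (simp_all add: dualized_def)
  have m: "matching_on C f \<longleftrightarrow> matching_on C f'" if "\<And>x. x \<in> C \<Longrightarrow> f x = f' x"
    for C and f f' :: "'a \<Rightarrow> 'a"
    using that by (auto simp: matching_on_def)
  have "seg K (side K x) = side K (seg K x)" if "x \<in> corners ?D" for x
    using that R e by (auto simp: is_ribbon_graph_def matching_on_def)
  moreover have "seg K x \<noteq> side K x" if "x \<in> corners ?D" for x
    using that R e by (auto simp: is_ribbon_graph_def)
  ultimately show ?thesis
    using R m[OF e(1)] m[OF e(2)] m[OF e(3)] unfolding is_ribbon_graph_def c by simp
qed

lemma dualized_homeo:
  assumes "dualized G S K" "dualized G S L"
  shows "K \<simeq> L"
  using assms unfolding rg_homeo_def by (intro exI[of _ id]) (simp add: dualized_def)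

lemma rg_homeo_trans:
  assumes "G \<simeq> H" "H \<simeq> K"
  shows "G \<simeq> K"
proof -
  obtain f h where f: "bij_betw f (corners G) (corners H)" "bij_betw h (isolated G) (isolated H)"
    "\<And>x. x \<in> corners G \<Longrightarrow> f (seg G x) = seg H (f x) \<and> f (side G x) = side H (f x) \<and> f (gap G x) = gap H (f x)"
    using assms(1) unfolding rg_homeo_def by blast
  obtain f' h' where f': "bij_betw f' (corners H) (corners K)" "bij_betw h' (isolated H) (isolated K)"
    "\<And>x. x \<in> corners H \<Longrightarrow> f' (seg H x) = seg K (f' x) \<and> f' (side H x) = side K (f' x) \<and> f' (gap H x) = gap K (f' x)"
    using assms(2) unfolding rg_homeo_def by blast
  have "f x \<in> corners H" if "x \<in> corners G" for x using f(1) that by (auto simp: bij_betw_def)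
  then show ?thesis
    unfolding rg_homeo_def
    by (intro exI[of _ "f' \<circ> f"] exI[of _ "h' \<circ> h"] conjI)
      (use f f' in \<open>auto intro: bij_betw_trans\<close>)
qed

section \<open>Ribbon graphs and join decompositions\<close>

lemma corner_mem_vert:
  assumes "is_ribbon_graph G" "v \<in> verts G" "x \<in> v" "x \<in> corners G"
  shows "v = orbit (seg G) (gap G) x"
proof -
  interpret medial "corners G" "seg G" "side G" "gap G" by (rule medial_ribbon_graph[OF assms(1)])
  have "v \<notin> (\<lambda>x. {x}) ` isolated G"
    using assms by (auto simp: is_ribbon_graph_def)
  then have "v \<in> orbit (seg G) (gap G) ` corners G" using assms(2) by (auto simp: verts_def)
  then show ?thesis using mem_orbits_eq[OF ms mg _ assms(3)] by simp
qed

text \<open>A closed set of corners contains, with one corner, every vertex reachable through edges.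
  Applied to all corners, this would make an isolated vertex consist of a corner.\<close>

lemma rg_connectedD:
  assumes G: "is_ribbon_graph G" and con: "rg_connected G" and ne: "corners G \<noteq> {}"
  shows "rg_transitive G" and "isolated G = {}"
proof -
  interpret medial "corners G" "seg G" "side G" "gap G" by (rule medial_ribbon_graph[OF G])
  have reach: "w \<subseteq> U"
    if U: "U \<subseteq> corners G" "\<And>x. x \<in> U \<Longrightarrow> seg G x \<in> U \<and> side G x \<in> U \<and> gap G x \<in> U"
      and x0: "x0 \<in> U" and w: "w \<in> verts G" for U x0 w
  proof -
    let ?r = "{(u', w'). u' \<in> verts G \<and> w' \<in> verts G \<and> (\<exists>e\<in>edges G. u' \<inter> e \<noteq> {} \<and> w' \<inter> e \<noteq> {})}"
    let ?u = "orbit (seg G) (gap G) x0"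
    have u: "?u \<in> verts G" using x0 U by (auto simp: verts_def)
    have orb: "orbit (seg G) (gap G) x \<subseteq> U" if "x \<in> U" for x
      by (rule orbit_minimal) (use that U in auto)
    have "(?u, w) \<in> ?r\<^sup>*"
      using con u w unfolding rg_connected_def connected_sub_def joined_in_def by simp
    then show ?thesis
    proof (induction rule: rtrancl_induct)
      case base show ?case by (rule orb[OF x0])
    next
      case (step y z)
      then obtain e where e: "e \<in> edges G" "y \<inter> e \<noteq> {}" "z \<inter> e \<noteq> {}" and z: "z \<in> verts G" by auto
      obtain a b where ab: "a \<in> y" "a \<in> e" "b \<in> z" "b \<in> e" using e by blast
      have "orbit (seg G) (side G) a \<subseteq> U"
        by (rule orbit_minimal) (use ab step.IH U in auto)
      moreover have "orbit (seg G) (side G) a = e"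
        using mem_orbits_eq[OF ms mt _ ab(2)] e(1) by (simp add: edges_eq)
      ultimately have b: "b \<in> U" using ab by blast
      then have "z = orbit (seg G) (gap G) b" using corner_mem_vert[OF G z ab(3)] U by blast
      then show ?case using orb[OF b] by simp
    qed
  qed
  show "rg_transitive G"
    unfolding transitive_on_def
  proof (intro allI impI)
    fix U assume U: "U \<subseteq> corners G" "U \<noteq> {}" "\<forall>x\<in>U. seg G x \<in> U \<and> side G x \<in> U \<and> gap G x \<in> U"
    then obtain x0 where x0: "x0 \<in> U" by blast
    have "x \<in> U" if x: "x \<in> corners G" for x
    proof -
      have "orbit (seg G) (gap G) x \<in> verts G" using x by (simp add: verts_def)
      then have "orbit (seg G) (gap G) x \<subseteq> U" using reach[OF U(1) _ x0] U(3) by blast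
      then show ?thesis using orbit_refl[of x "seg G" "gap G"] by blast
    qed
    then show "U = corners G" using U(1) by blast
  qed
  obtain x0 where x0: "x0 \<in> corners G" using ne by blast
  have "i \<in> corners G" if "i \<in> isolated G" for i
  proof -
    have "{i} \<in> verts G" using that by (simp add: verts_def)
    then have "{i} \<subseteq> corners G" using reach[OF subset_refl _ x0] sD(1) tD(1) gD(1) by blast
    then show ?thesis by simp
  qed
  then show "isolated G = {}" using G by (auto simp: is_ribbon_graph_def)
qed

text \<open>The premise has the form in which \<open>two_cut_connected\<close> supplies it; if
  \<open>S\<close> is the set of all corners, it is plain transitivity.\<close>

lemma connected_subI:
  assumes G: "is_ribbon_graph G" and S: "rg_closed G S" "S \<noteq> {}"
    and con: "\<And>U x. U \<subseteq> S \<Longrightarrow> x \<in> U \<Longrightarrow> (\<And>x. x \<in> U \<Longrightarrow> seg G x \<in> U \<and> side G x \<in> U) \<Longrightarrow>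
      (\<And>x. x \<in> U \<Longrightarrow> gap G x \<in> S \<Longrightarrow> gap G x \<in> U) \<Longrightarrow> U = S"
  shows "connected_sub (orbit (seg G) (gap G) ` S, edges_in G S)"
  unfolding connected_sub_def fst_conv
proof (intro conjI ballI)
  interpret medial "corners G" "seg G" "side G" "gap G" by (rule medial_ribbon_graph[OF G])
  have SC: "S \<subseteq> corners G" using S by (simp add: edge_closed_def)
  show "orbit (seg G) (gap G) ` S \<noteq> {}" using S by simp
  fix u w assume "u \<in> orbit (seg G) (gap G) ` S" "w \<in> orbit (seg G) (gap G) ` S"
  then obtain x y where x: "x \<in> S" "u = orbit (seg G) (gap G) x"
    and y: "y \<in> S" "w = orbit (seg G) (gap G) y" by blast
  let ?F = "orbit (seg G) (gap G) ` S"
  let ?r = "{(u', w'). u' \<in> ?F \<and> w' \<in> ?F \<and> (\<exists>e\<in>edges_in G S. u' \<inter> e \<noteq> {} \<and> w' \<inter> e \<noteq> {})}"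
  define U where "U = {z\<in>S. (u, orbit (seg G) (gap G) z) \<in> ?r\<^sup>*}"
  have "U = S"
  proof (rule con)
    show "U \<subseteq> S" by (auto simp: U_def)
    show "x \<in> U" using x by (simp add: U_def)
    show "gap G z \<in> U" if z: "z \<in> U" "gap G z \<in> S" for z
    proof -
      have "z \<in> corners G" using z SC by (auto simp: U_def)
      then show ?thesis using z orbit_step_eq(2)[OF ms mg] by (simp add: U_def)
    qed
    show "seg G z \<in> U \<and> side G z \<in> U" if z: "z \<in> U" for z
    proof
      have zS: "z \<in> S" and uz: "(u, orbit (seg G) (gap G) z) \<in> ?r\<^sup>*" using z by (auto simp: U_def)
      have zC: "z \<in> corners G" using zS SC by blast
      have zS': "seg G z \<in> S" "side G z \<in> S" using S(1) zS by (auto simp: edge_closed_def)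
      show "seg G z \<in> U" using uz zS' orbit_step_eq(1)[OF ms mg zC] by (simp add: U_def)
      let ?e = "orbit (seg G) (side G) z"
      have "?e \<subseteq> S" by (rule orbit_minimal) (use S(1) zS in \<open>auto simp: edge_closed_def\<close>)
      then have e: "?e \<in> edges_in G S" using zC by (auto simp: edges_in_def edges_eq)
      have "z \<in> orbit (seg G) (gap G) z \<inter> ?e" by (simp add: orbit_refl)
      moreover have "side G z \<in> orbit (seg G) (gap G) (side G z) \<inter> ?e"
        by (auto intro: orbit.intros)
      ultimately have "(orbit (seg G) (gap G) z, orbit (seg G) (gap G) (side G z)) \<in> ?r"
        using e zS zS' by blast
      then have "(u, orbit (seg G) (gap G) (side G z)) \<in> ?r\<^sup>*" using uz by (rule rtrancl_into_rtrancl[rotated])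
      then show "side G z \<in> U" using zS' by (simp add: U_def)
    qed
  qed
  then have "y \<in> U" using y by simp
  then show "(u, w) \<in> joined_in (orbit (seg G) (gap G) ` S, edges_in G S)"
    using x y unfolding joined_in_def U_def by auto
qed

lemma edges_in_corners:
  assumes "is_ribbon_graph G" shows "edges_in G (corners G) = edges G"
proof -
  interpret medial "corners G" "seg G" "side G" "gap G" by (rule medial_ribbon_graph[OF assms])
  show ?thesis using orbit_subset[OF ms mt] by (auto simp: edges_in_def edges_eq)
qed

lemma rg_connectedI:
  assumes G: "is_ribbon_graph G" and tr: "rg_transitive G" and ne: "corners G \<noteq> {}"
    and iso: "isolated G = {}"
  shows "rg_connected G"
proof -
  interpret medial "corners G" "seg G" "side G" "gap G" by (rule medial_ribbon_graph[OF G])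
  have "connected_sub (orbit (seg G) (gap G) ` corners G, edges_in G (corners G))"
  proof (rule connected_subI[OF G _ ne])
    show "rg_closed G (corners G)" using sD(1) tD(1) by (simp add: edge_closed_def)
    fix U x assume U: "U \<subseteq> corners G" "x \<in> U" "\<And>x. x \<in> U \<Longrightarrow> seg G x \<in> U \<and> side G x \<in> U"
      "\<And>x. x \<in> U \<Longrightarrow> gap G x \<in> corners G \<Longrightarrow> gap G x \<in> U"
    show "U = corners G"
      by (rule transitive_onD[OF tr U(1,2)]) (use U gD(1) in blast)
  qed
  then show ?thesis using iso edges_in_corners[OF G] by (simp add: rg_connected_def verts_def)
qed

text \<open>The second summand \<open>P\<close> is the complement \<open>T\<close> of
  \<open>S\<close>. A vertex with corners on both sides must carry both links of the cut, so there
  is only one, and \<open>two_cut_arc\<close> provides the arc on it.\<close>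

lemma two_cut_is_join:
  assumes G: "is_ribbon_graph G" and con: "rg_connected G" and ne: "corners G \<noteq> {}"
    and S: "rg_two_cut G S"
  shows "\<exists>P. is_join G P (orbit (seg G) (gap G) ` S, edges_in G S)"
proof -
  interpret medial "corners G" "seg G" "side G" "gap G" by (rule medial_ribbon_graph[OF G])
  let ?C = "corners G" and ?o = "orbit (seg G) (gap G)"
  define T where "T = ?C - S"
  have tr: "rg_transitive G" and iso: "isolated G = {}" using rg_connectedD[OF G con ne] by auto
  have V: "verts G = ?o ` ?C" using iso by (simp add: verts_def)
  have T2: "rg_two_cut G T" unfolding T_def by (rule two_cut_compl[OF S])
  have Sc: "rg_closed G S" and Tc: "rg_closed G T" using S T2 by (auto simp: two_cut_def)
  have SC: "S \<subseteq> ?C" and TC: "T \<subseteq> ?C" using Sc Tc by (auto simp: edge_closed_def)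
  have "\<exists>x y. {z\<in>U. gap G z \<notin> U} = {x, y} \<and> x \<noteq> y" if "rg_two_cut G U" for U
    using two_cut_boundary[OF that] by metis
  from this[OF T2] obtain x y where xy: "{z\<in>T. gap G z \<notin> T} = {x, y}" "x \<noteq> y" by blast
  have x: "x \<in> T" "gap G x \<notin> T" "x \<in> ?C" using xy TC by auto
  have gx: "gap G x \<in> S" using x gD(1) by (auto simp: T_def)
  define v where "v = ?o x"
  have sub: "ribbon_subgraph G (?o ` U, edges_in G U)" if U: "rg_closed G U" for U
    unfolding ribbon_subgraph_def fst_conv snd_conv
  proof (intro conjI ballI impI)
    have UC: "U \<subseteq> ?C" using U by (simp add: edge_closed_def)
    show "?o ` U \<subseteq> verts G" using UC V by blast
    show "edges_in G U \<subseteq> edges G" by (auto simp: edges_in_def)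
    fix u e assume u: "u \<in> verts G" and e: "e \<in> edges_in G U" and "u \<inter> e \<noteq> {}"
    then obtain z where z: "z \<in> u" "z \<in> U" by (auto simp: edges_in_def)
    then show "u \<in> ?o ` U" using corner_mem_vert[OF G u z(1)] UC by blast
  qed
  have con_sub: "connected_sub (?o ` U, edges_in G U)" if U: "rg_two_cut G U" "U \<noteq> {}" for U
    by (rule connected_subI[OF G _ U(2) two_cut_connected[OF tr U(1)]])
      (use U(1) in \<open>simp_all add: two_cut_def\<close>)
  have edges_ne: "edges_in G U \<noteq> {}" if "rg_closed G U" "U \<noteq> {}" for U
    using Union_edges_in[OF that(1)] that(2) by auto
  have edge_cases: "e \<subseteq> S \<or> e \<subseteq> T" if e: "e \<in> edges G" for e
  proof -
    obtain z where z: "z \<in> ?C" "e = orbit (seg G) (side G) z" using e by (auto simp: edges_eq)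
    show ?thesis
    proof (cases "z \<in> S")
      case True
      have "e \<subseteq> S" unfolding z by (rule orbit_minimal) (use True Sc in \<open>auto simp: edge_closed_def\<close>)
      then show ?thesis ..
    next
      case False
      have "e \<subseteq> T" unfolding z
        by (rule orbit_minimal) (use False z Tc in \<open>auto simp: edge_closed_def T_def\<close>)
      then show ?thesis ..
    qed
  qed
  \<comment> \<open>Such a vertex \<open>u\<close> is left by \<open>T\<close> an even number of
    times, and not zero times, since its corners in \<open>T\<close> would otherwise form a closed
    set missing those in \<open>S\<close>.\<close>
  have both: "x \<in> u \<and> y \<in> u" if u: "u \<in> ?o ` T" "u \<in> ?o ` S" for u
  proof -
    have uV: "u \<in> ?o ` ?C" using u(1) TC by blast
    have uC: "u \<subseteq> ?C" using uV orbit_subset[OF ms mg] by blast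
    obtain a b where a: "a \<in> T" "u = ?o a" and b: "b \<in> S" "u = ?o b" using u by blast
    have ab: "a \<in> u" "b \<in> u" using a b orbit_refl by metis+
    let ?B = "{z\<in>T \<inter> u. gap G z \<notin> T \<inter> u}"
    have "even (card ?B)"
    proof (rule even_boundary)
      show "T \<inter> u \<subseteq> ?C" using TC by blast
      show "seg G z \<in> T \<inter> u" if "z \<in> T \<inter> u" for z
        using that orbits_closed(1)[OF uV] Tc by (auto simp: edge_closed_def)
    qed
    have Bsub: "?B \<subseteq> {x, y}" unfolding xy(1)[symmetric] using orbits_closed(2)[OF uV] by blast
    have ne_B: "?B \<noteq> {}"
    proof
      assume B: "?B = {}"
      have "?o a \<subseteq> T \<inter> u"
      proof (rule orbit_minimal)
        show "a \<in> T \<inter> u" using a ab by blast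
        show "seg G z \<in> T \<inter> u" if "z \<in> T \<inter> u" for z
          using that orbits_closed(1)[OF uV] Tc by (auto simp: edge_closed_def)
        show "gap G z \<in> T \<inter> u" if "z \<in> T \<inter> u" for z using that B by blast
      qed
      then show False using a ab b by (auto simp: T_def)
    qed
    have single: "?B \<noteq> {z}" for z using \<open>even (card ?B)\<close> by (metis card_1_singleton_iff One_nat_def odd_one)
    have "X = {} \<or> X = {x} \<or> X = {y} \<or> X = {x, y}" if "X \<subseteq> {x, y}" for X
      using that by blast
    from this[OF Bsub] have "?B = {x, y}" using ne_B single[of x] single[of y] by argo
    then show ?thesis by blast
  qed
  have vT: "v \<in> ?o ` T" using x by (simp add: v_def)
  have vS: "v \<in> ?o ` S"
    using gx orbit_step_eq(2)[OF ms mg x(3)] by (metis imageI v_def)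
  have yv: "y \<in> v" using both[OF vT vS] by simp
  have inter: "?o ` T \<inter> ?o ` S = {v}"
  proof
    show "?o ` T \<inter> ?o ` S \<subseteq> {v}"
    proof
      fix u assume u: "u \<in> ?o ` T \<inter> ?o ` S"
      then have "x \<in> u" "u \<in> verts G" using both[of u] V TC by auto
      then show "u \<in> {v}" using corner_mem_vert[OF G, of u x] x by (simp add: v_def)
    qed
  qed (use vT vS in blast)
  have "\<exists>n. v \<inter> T \<subseteq> (\<Union>i<n. {((gap G \<circ> seg G) ^^ i) x, seg G (((gap G \<circ> seg G) ^^ i) x)}) \<and>
      (\<Union>i<n. {((gap G \<circ> seg G) ^^ i) x, seg G (((gap G \<circ> seg G) ^^ i) x)}) \<subseteq> T"
  \<comment> \<open>The arc has to enclose the corners of \<open>P\<close>, hence is taken on the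
    side of \<open>T\<close>; the side \<open>S\<close> is the one to be dualized.\<close>
  proof (rule two_cut_arc[OF tr T2 x(1,2) v_def])
    fix z assume "z \<in> T" "gap G z \<notin> T"
    then have "z = x \<or> z = y" using xy by blast
    then show "z \<in> v" using yv orbit_refl[of x "seg G" "gap G"] by (auto simp: v_def)
  qed
  then obtain n where n: "v \<inter> T \<subseteq> boundary_arc G x n" "boundary_arc G x n \<subseteq> T"
    unfolding boundary_arc_def Let_def by blast
  have xv: "x \<in> v" by (simp add: v_def orbit_refl)
  have "is_join G (?o ` T, edges_in G T) (?o ` S, edges_in G S)"
    unfolding is_join_def fst_conv snd_conv
  proof (intro conjI)
    show "edges_in G T \<noteq> {}" using edges_ne[OF Tc] x by blast
    show "edges_in G S \<noteq> {}" using edges_ne[OF Sc] gx by blast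
    show "connected_sub (?o ` T, edges_in G T)" using con_sub[OF T2] x by blast
    show "connected_sub (?o ` S, edges_in G S)" using con_sub[OF S] gx by blast
    show "?o ` T \<union> ?o ` S = verts G" using SC by (auto simp: V T_def)
    show "edges_in G T \<union> edges_in G S = edges G" using edge_cases by (auto simp: edges_in_def)
    have "edges_in G T \<inter> edges_in G S = {}"
    proof -
      have "e \<noteq> {}" if "e \<in> edges G" for e
      proof -
        obtain z where "e = orbit (seg G) (side G) z" using \<open>e \<in> edges G\<close> by (auto simp: edges_eq)
        then show ?thesis using orbit_refl[of z "seg G" "side G"] by blast
      qed
      then show ?thesis by (auto simp: edges_in_def T_def)
    qed
    moreover have "boundary_arc G x n \<inter> S = {}" using n by (auto simp: T_def)
    ultimately show "\<exists>v. ?o ` T \<inter> ?o ` S = {v} \<and> edges_in G T \<inter> edges_in G S = {} \<and>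
        (\<exists>x\<in>v. \<exists>n. v \<inter> \<Union>(edges_in G T) \<subseteq> boundary_arc G x n \<and>
          boundary_arc G x n \<inter> \<Union>(edges_in G S) = {})"
      unfolding Union_edges_in[OF Tc] Union_edges_in[OF Sc] using inter n(1) xv by blast
  qed (rule con sub[OF Tc] sub[OF Sc])+
  then show ?thesis by blast
qed

text \<open>Each further summand is dualized in the graph \<open>K\<close> reached so far. This
  works because \<open>K\<close> is again a connected ribbon graph with the two-link cuts of
  \<open>G\<close>.\<close>

lemma span_moves:
  assumes G: "is_ribbon_graph G" and con: "rg_connected G" and ne: "corners G \<noteq> {}"
    and S: "S \<in> two_cut_span (corners G) (seg G) (side G) (gap G)"
  shows "\<exists>K. join_summand_move\<^sup>*\<^sup>* G K \<and> dualized G S K"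
  using S
proof induction
  case span_empty
  show ?case using dualized_empty by blast
next
  case (span_add S T)
  then obtain K where K: "join_summand_move\<^sup>*\<^sup>* G K" "dualized G S K" by blast
  interpret medial "corners G" "seg G" "side G" "gap G" by (rule medial_ribbon_graph[OF G])
  have tr: "rg_transitive G" and iso: "isolated G = {}" using rg_connectedD[OF G con ne] by auto
  have KR: "is_ribbon_graph K"
    by (rule is_ribbon_graph_dualized[OF G two_cut_span_closed[OF ms mt span_add(1)] K(2)])
  have cK: "corners K \<noteq> {}" "isolated K = {}" using K(2) ne iso by (auto simp: dualized_def)
  have "rg_transitive K" using dualized_transitive[OF K(2)] tr by simp
  then have Kcon: "rg_connected K" by (rule rg_connectedI[OF KR _ cK])
  have T2: "rg_two_cut K T" using dualized_two_cut[OF K(2)] span_add(2) by simp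
  then have Tc: "rg_closed K T" by (simp add: two_cut_def)
  let ?L = "partial_dual K (edges_in K T)"
  have "join_summand_move K ?L"
    using two_cut_is_join[OF KR Kcon cK(1) T2] unfolding join_summand_move_def by auto
  moreover have "dualized K T ?L"
    using dualized_partial_dual[OF KR, of "edges_in K T"] Union_edges_in[OF Tc]
    by (simp add: edges_in_def)
  ultimately show ?case using K dualized_trans by (meson rtranclp.rtrancl_into_rtrancl)
qed

lemma moves_dualized:
  assumes G: "is_ribbon_graph G" and K: "join_summand_move\<^sup>*\<^sup>* G K"
  shows "\<exists>S. rg_closed G S \<and> dualized G S K"
  using K
proof induction
  case base
  have "rg_closed G {}" by (simp add: edge_closed_def)
  then show ?case using dualized_empty by blast
next
  case (step K L)
  interpret medial "corners G" "seg G" "side G" "gap G" by (rule medial_ribbon_graph[OF G])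
  obtain S where S: "rg_closed G S" "dualized G S K" using step.IH by blast
  have KR: "is_ribbon_graph K" by (rule is_ribbon_graph_dualized[OF G S])
  obtain P Q where Q: "is_join K P Q" "L = partial_dual K (snd Q)"
    using step.hyps(2) by (auto simp: join_summand_move_def)
  then have sub: "snd Q \<subseteq> edges K" by (auto simp: is_join_def ribbon_subgraph_def)
  have L: "dualized K (\<Union>(snd Q)) L" unfolding Q(2) by (rule dualized_partial_dual[OF KR sub])
  have "rg_closed G (\<Union>(snd Q))"
    using rg_closed_Union[OF KR sub] dualized_closed[OF S(2)] by simp
  then have "rg_closed G (sym_diff S (\<Union>(snd Q)))" by (rule edge_closed_sym_diff[OF ms mt S(1)])
  then show ?case using dualized_trans[OF S(2) L] by blast
qed

section \<open>Euler characteristics and the two implications\<close>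

lemma card_orbits_bij:
  assumes f: "bij_betw f C D" and C: "\<And>x. x \<in> C \<Longrightarrow> p x \<in> C \<and> q x \<in> C"
    and h: "\<And>x. x \<in> C \<Longrightarrow> f (p x) = p' (f x) \<and> f (q x) = q' (f x)"
  shows "card (orbit p' q' ` D) = card (orbit p q ` C)"
proof -
  have sub: "orbit p q x \<subseteq> C" if "x \<in> C" for x
    by (rule orbit_minimal) (use that C in auto)
  have orb: "orbit p' q' (f x) = f ` orbit p q x" if x: "x \<in> C" for x
  proof
    show "orbit p' q' (f x) \<subseteq> f ` orbit p q x"
    proof (rule orbit_minimal)
      show "f x \<in> f ` orbit p q x" by (simp add: orbit_refl)
      fix z assume "z \<in> f ` orbit p q x"
      then obtain y where y: "y \<in> orbit p q x" "z = f y" by blast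
      then have yC: "y \<in> C" using sub[OF x] by blast
      show "p' z \<in> f ` orbit p q x" using y h[OF yC] orbit_left[OF y(1)] by (metis imageI)
      show "q' z \<in> f ` orbit p q x" using y h[OF yC] orbit_right[OF y(1)] by (metis imageI)
    qed
    have "y \<in> C \<and> f y \<in> orbit p' q' (f x)" if "y \<in> orbit p q x" for y
      using that
    proof induction
      case orbit_refl then show ?case using x by (simp add: orbit.orbit_refl)
    next
      case (orbit_left y) then show ?case using C h orbit.orbit_left[of "f y" p' q' "f x"] by simp
    next
      case (orbit_right y) then show ?case using C h orbit.orbit_right[of "f y" p' q' "f x"] by simp
    qed
    then show "f ` orbit p q x \<subseteq> orbit p' q' (f x)" by blast
  qed
  have D: "D = f ` C" using f by (simp add: bij_betw_def)
  have "orbit p' q' ` D = (`) f ` (orbit p q ` C)"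
    unfolding D image_image by (rule image_cong[OF refl orb])
  moreover have "inj_on ((`) f) (orbit p q ` C)"
  proof (rule inj_on_subset[OF inj_on_image_Pow])
    show "inj_on f C" using f by (simp add: bij_betw_def)
    show "orbit p q ` C \<subseteq> Pow C" using sub by blast
  qed
  ultimately show ?thesis by (simp add: card_image)
qed

lemma euler_char_eq:
  assumes G: "is_ribbon_graph G" and iso: "isolated G = {}"
  shows "euler_char G = int (card (orbit (seg G) (gap G) ` corners G))
    + int (card (orbit (side G) (gap G) ` corners G)) - int (card (orbit (seg G) (side G) ` corners G))"
proof -
  interpret medial "corners G" "seg G" "side G" "gap G" by (rule medial_ribbon_graph[OF G])
  have cl: "rg_closed G (corners G)" using sD(1) tD(1) by (simp add: edge_closed_def)
  have "\<Union>(edges G) = corners G" using Union_edges_in[OF cl] edges_in_corners[OF G] by simp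
  then have m: "marked_arc G (edges G) x = side G x" if "x \<in> corners G" for x
    using that by (simp add: marked_arc_def)
  have "orbit (marked_arc G (edges G)) (gap G) x = orbit (side G) (gap G) x" if "x \<in> corners G" for x
    by (rule orbit_cong[of x "corners G"]) (use that m tD gD in auto)
  then have "orbit (marked_arc G (edges G)) (gap G) ` corners G = orbit (side G) (gap G) ` corners G"
    by (rule image_cong[OF refl])
  then show ?thesis
    using iso by (simp add: euler_char_def verts_def boundary_components_def edges_eq)
qed

lemma card_components_connected:
  assumes "rg_connected G"
  shows "card (components (verts G, edges G)) = 1"
proof -
  have con: "connected_sub (verts G, edges G)" using assms by (simp add: rg_connected_def)
  have "joined_in (verts G, edges G) `` {u} = verts G" if "u \<in> verts G" for u
    using con that by (auto simp: connected_sub_def joined_in_def)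
  moreover have "verts G \<noteq> {}" using con by (simp add: connected_sub_def)
  ultimately have "components (verts G, edges G) = {verts G}"
    by (auto simp: components_def quotient_def)
  then show ?thesis by simp
qed

text \<open>
  For an orientable ribbon graph, Euler genus 0 alone only yields \<open>\<chi> \<in> {1, 2}\<close>, as the genus is
  defined by an integer division.
\<close>

lemma plane_euler_char:
  assumes G: "is_ribbon_graph G" and iso: "isolated G = {}" and pl: "plane G"
  shows "euler_char G = 2"
proof (cases "orientable G")
  case True
  interpret medial "corners G" "seg G" "side G" "gap G" by (rule medial_ribbon_graph[OF G])
  have "(2 - euler_char G) div 2 = 0"
    using pl True card_components_connected[of G]
    by (simp add: plane_def euler_genus_def orientable_genus_def)
  then have "euler_char G = 2 \<or> euler_char G = 1" by presburger
  \<comment> \<open>The sign argument excludes the value 1.\<close>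
  moreover have "even (euler_char G)"
  proof -
    obtain c :: "'a \<Rightarrow> bool" where "\<forall>x\<in>corners G. c (seg G x) \<noteq> c x \<and> c (side G x) \<noteq> c x \<and> c (gap G x) \<noteq> c x"
      using True unfolding orientable_def by blast
    then have "even (card (orbit (seg G) (gap G) ` corners G) + card (orbit (side G) (gap G) ` corners G)
        + card (orbit (seg G) (side G) ` corners G))"
      by (intro even_euler_char_orientable[of c]) blast
    then show ?thesis unfolding euler_char_eq[OF G iso] by simp
  qed
  ultimately show ?thesis by auto
next
  case False
  then show ?thesis
    using pl card_components_connected[of G]
    by (simp add: plane_def euler_genus_def nonorientable_genus_def)
qed

text \<open>The Euler genus of an orientable graph is twice an integer, so it cannot be 1.\<close>

lemma RP2_euler_char:
  assumes "RP2 G"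
  shows "euler_char G = 1" and "\<not> orientable G"
proof -
  show n: "\<not> orientable G"
  proof
    assume "orientable G"
    then have "2 * orientable_genus G = 1" using assms by (simp add: RP2_def euler_genus_def)
    then show False by presburger
  qed
  show "euler_char G = 1"
    using assms n card_components_connected[of G]
    by (simp add: RP2_def euler_genus_def nonorientable_genus_def)
qed

lemma euler_char_homeo:
  assumes G: "is_ribbon_graph G" and H: "is_ribbon_graph H" and GH: "G \<simeq> H"
    and iso: "isolated G = {}"
  shows "euler_char G = euler_char H" and "isolated H = {}"
proof -
  interpret medial "corners G" "seg G" "side G" "gap G" by (rule medial_ribbon_graph[OF G])
  obtain f h where f: "bij_betw f (corners G) (corners H)" and h: "bij_betw h (isolated G) (isolated H)"
    and e: "\<And>x. x \<in> corners G \<Longrightarrow> f (seg G x) = seg H (f x) \<and> f (side G x) = side H (f x) \<and> f (gap G x) = gap H (f x)"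
    using GH unfolding rg_homeo_def by blast
  show iso': "isolated H = {}" using h iso by (simp add: bij_betw_def)
  have c: "x \<in> corners G \<Longrightarrow> seg G x \<in> corners G \<and> side G x \<in> corners G \<and> gap G x \<in> corners G" for x
    using sD(1) tD(1) gD(1) by blast
  have "card (orbit (seg H) (gap H) ` corners H) = card (orbit (seg G) (gap G) ` corners G)"
    "card (orbit (side H) (gap H) ` corners H) = card (orbit (side G) (gap G) ` corners G)"
    "card (orbit (seg H) (side H) ` corners H) = card (orbit (seg G) (side G) ` corners G)"
    by (rule card_orbits_bij[OF f]; use c e in blast)+
  then show "euler_char G = euler_char H"
    unfolding euler_char_eq[OF G iso] euler_char_eq[OF H iso'] by simp
qed

lemma partial_duals_imp_related:
  fixes G :: "'a ribbon_graph" and H :: "'b ribbon_graph"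
  assumes G: "is_ribbon_graph G" and H: "is_ribbon_graph H" and con: "rg_connected G"
    and cases: "(plane G \<and> plane H) \<or> (RP2 G \<and> RP2 H)" and pd: "partial_duals G H"
  shows "related_by_dualling_join_summands G H"
proof -
  interpret medial "corners G" "seg G" "side G" "gap G" by (rule medial_ribbon_graph[OF G])
  obtain A where A: "A \<subseteq> edges G" and AH: "partial_dual G A \<simeq> H"
    using pd by (auto simp: partial_duals_def)
  let ?D = "partial_dual G A"
  define S where "S = \<Union>A"
  have D: "dualized G S ?D" unfolding S_def by (rule dualized_partial_dual[OF G A])
  have Sc: "rg_closed G S" unfolding S_def by (rule rg_closed_Union[OF G A])
  show ?thesis
  proof (cases "corners G = {}")
    \<comment> \<open>Without edges the dual is \<open>G\<close> itself, and the empty sequence of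
      moves suffices.\<close>
    case True
    then have "S = {}" using Sc by (simp add: edge_closed_def)
    then have "G \<simeq> H" using rg_homeo_trans[OF dualized_homeo[OF dualized_empty] AH] D by simp
    then show ?thesis unfolding related_by_dualling_join_summands_def by blast
  next
    case ne: False
    have tr: "rg_transitive G" and iso: "isolated G = {}" using rg_connectedD[OF G con ne] by auto
    have DR: "is_ribbon_graph ?D" by (rule is_ribbon_graph_partial_dual[OF G A])
    have isoD: "isolated ?D = {}" using D iso by (simp add: dualized_def)
    have chi: "euler_char ?D = euler_char H" and isoH: "isolated H = {}"
      using euler_char_homeo[OF DR H AH isoD] by auto
    \<comment> \<open>The genus of \<open>H\<close> is known only up to homeomorphism; this
      expresses it on the corners of \<open>G\<close>, with the edges of \<open>G\<close>, as the
      Euler condition on the dual.\<close>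
    have "euler_char ?D = int (card (orbit (dual_seg S) (gap G) ` corners G)) +
        int (card (orbit (dual_side S) (gap G) ` corners G)) - int (card (orbit (seg G) (side G) ` corners G))"
    proof -
      interpret E: medial "corners G" "dual_seg S" "dual_side S" "gap G" by (rule medial_dual[OF Sc])
      have c: "corners ?D = corners G" using D by (simp add: dualized_def)
      have e: "seg ?D x = dual_seg S x" "side ?D x = dual_side S x" "gap ?D x = gap G x"
        if "x \<in> corners G" for x using D that by (simp_all add: dualized_def)
      have "orbit (seg ?D) (gap ?D) x = orbit (dual_seg S) (gap G) x"
        "orbit (side ?D) (gap ?D) x = orbit (dual_side S) (gap G) x"
        "orbit (seg ?D) (side ?D) x = orbit (dual_seg S) (dual_side S) x" if x: "x \<in> corners G" for x
        by (rule orbit_cong[of x "corners G"]; use x e E.sD(1) E.tD(1) E.gD(1) in simp)+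
      then have "orbit (seg ?D) (gap ?D) ` corners G = orbit (dual_seg S) (gap G) ` corners G"
        "orbit (side ?D) (gap ?D) ` corners G = orbit (dual_side S) (gap G) ` corners G"
        "orbit (seg ?D) (side ?D) ` corners G = orbit (seg G) (side G) ` corners G"
        using dual_orbit[OF Sc] by (simp_all cong: image_cong)
      then show ?thesis unfolding euler_char_eq[OF DR isoD] c by simp
    qed
    note dual = this
    note prim = euler_char_eq[OF G iso]
    have "S \<in> two_cut_span (corners G) (seg G) (side G) (gap G) \<or> S = corners G"
      using cases
    proof
      assume pl: "plane G \<and> plane H"
      have e: "euler_char G = 2" "euler_char H = 2"
        using plane_euler_char[OF G iso] plane_euler_char[OF H isoH] pl by auto
      show ?thesis
        by (rule plane_span[OF tr ne Sc]) (use e prim dual chi in linarith)+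
    next
      assume rp: "RP2 G \<and> RP2 H"
      then have e: "euler_char G = 1" "euler_char H = 1" and nonor: "\<not> orientable G"
        using RP2_euler_char by blast+
      show ?thesis
        by (rule RP2_span[OF tr ne Sc nonor[unfolded orientable_def]])
          (use e prim dual chi in linarith)+
    qed
    then show ?thesis
    proof
      assume "S \<in> two_cut_span (corners G) (seg G) (side G) (gap G)"
      then obtain K where K: "join_summand_move\<^sup>*\<^sup>* G K" "dualized G S K"
        using span_moves[OF G con ne] by blast
      have "K \<simeq> H" by (rule rg_homeo_trans[OF dualized_homeo[OF K(2) D] AH])
      then show ?thesis using K(1) unfolding related_by_dualling_join_summands_def by blast
    next
      \<comment> \<open>The complement that is not a sum of two-link cuts is the geometric dual, the
        separate alternative in the relation.\<close>
      assume "S = corners G"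
      then have "A = edges G" using edges_in_Union[OF G A] edges_in_corners[OF G] by (simp add: S_def)
      then show ?thesis
        using AH unfolding related_by_dualling_join_summands_def geometric_dual_def by simp
    qed
  qed
qed

text \<open>Each move is a partial dual, and by \<open>moves_dualized\<close> a sequence of them
  accumulates to a single one.\<close>

lemma related_imp_partial_duals:
  assumes G: "is_ribbon_graph G" and r: "related_by_dualling_join_summands G H"
  shows "partial_duals G H"
  using r unfolding related_by_dualling_join_summands_def
proof
  assume "\<exists>K. join_summand_move\<^sup>*\<^sup>* G K \<and> K \<simeq> H"
  then obtain K where K: "join_summand_move\<^sup>*\<^sup>* G K" "K \<simeq> H" by blast
  obtain S where S: "rg_closed G S" "dualized G S K" using moves_dualized[OF G K(1)] by blast
  have A: "edges_in G S \<subseteq> edges G" by (auto simp: edges_in_def)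
  have "dualized G S (partial_dual G (edges_in G S))"
    using dualized_partial_dual[OF G A] Union_edges_in[OF S(1)] by simp
  then have "partial_dual G (edges_in G S) \<simeq> H"
    using rg_homeo_trans[OF dualized_homeo[OF _ S(2)] K(2)] by blast
  then show ?thesis using A unfolding partial_duals_def by blast
next
  assume "geometric_dual G \<simeq> H"
  then show ?thesis unfolding partial_duals_def geometric_dual_def by blast
qed

theorem theorem5:
  fixes G :: "'a ribbon_graph" and H :: "'b ribbon_graph"
  assumes "is_ribbon_graph G" and "is_ribbon_graph H"
    and "rg_connected G" and "rg_connected H"
  shows "(plane G \<and> plane H \<longrightarrow>
            (partial_duals G H \<longleftrightarrow> related_by_dualling_join_summands G H)) \<and>
         (RP2 G \<and> RP2 H \<longrightarrow>
            (partial_duals G H \<longleftrightarrow> related_by_dualling_join_summands G H))"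
  using partial_duals_imp_related[OF assms(1-3)] related_imp_partial_duals[OF assms(1)] by blast

end
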